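(* Let $f\colon\Gamma\to\Delta$ be a regular covering map of connected profinite graphs and let $G=\operatorname{Aut}(\Gamma,f)$. For any closed subgroup $H$ of $G$, let $h\colon\Gamma\to\Gamma/H$ be the orbit map and let $f_H\colon\Gamma/H\to\Delta$ be the map induced by $f$ (sending the $H$-orbit of $x$ to $f(x)$), so that $f_H\circ h=f$. Then $h$ is a regular covering map of connected profinite graphs and $f_H$ is a covering map of connected profinite graphs. Moreover, $f_H$ is a regular covering if $H$ is a normal subgroup of $G$.
   Context: A graph $\Gamma$ is a set that is the disjoint union of a set $V(\Gamma)$ of vertices and a set $E(\Gamma)$ of edges, with maps $s,t\colon E(\Gamma)\to V(\Gamma)$ and an involution $e\mapsto\overline e$ of $E(\Gamma)$ such that $\overline e\ne e$, $s(\overline e)=t(e)$, $t(\overline e)=s(e)$. A map of graphs sends vertices to vertices and edges to edges and commutes with $s$, $t$ and $e\mapsto\overline e$. It is locally bijective if for every vertex $v$ it restricts to a bijection from $\{e\mid s(e)=v\}$ onto $\{e'\mid s(e')=f(v)\}$. A graph is path connected if it is nonempty and any two vertices are joined by a finite edge path. A regular covering of finite path connected graphs is a locally bijective map $q\colon X\to Y$ of such graphs with $q_*\pi_1(X,x)$ normal in $\pi_1(Y,q(x))$ for a vertex $x$ (equivalently, the group of automorphisms of $X$ over $Y$ is transitive on each vertex fiber). An equivalence relation $R$ on a graph $\Gamma$ is compatible if no vertex is equivalent to an edge, if $(e_1,e_2)\in R$ for edges implies $(s(e_1),s(e_2)),(t(e_1),t(e_2)),(\overline{e_1},\overline{e_2})\in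 R$, and $(e,\overline e)\notin R$ for all edges $e$; thus the set $\Gamma/R$ of classes is a graph. A cofinite graph is a graph with a Hausdorff uniformity in which every entourage contains a compatible cofinite entourage, i.e. an entourage that is a compatible equivalence relation with finitely many classes. A profinite graph is a compact cofinite graph (equivalently, an inverse limit of finite discrete graphs). It is connected if $\Gamma/R$ is path connected for every compatible cofinite entourage $R$. An inverse system of maps $(f_i\colon\Gamma_i\to\Delta_i,\phi_{ij},\psi_{ij})$ over a directed set $I$ consists of continuous maps of graphs $f_i$, and, for $j\ge i$, continuous maps of graphs $\phi_{ij}\colon\Gamma_j\to\Gamma_i$, $\psi_{ij}\colon\Delta_j\to\Delta_i$ forming inverse systems, with $f_i\phi_{ij}=\psi_{ij}f_j$. Its inverse limit is the induced continuous map $f\colon\varprojlim\Gamma_i\to\varprojlim\Delta_i$. A map of profinite graphs is a covering (respectively, a regular covering) if it is the inverse limit of an inverse system in which each $f_i$ is a locally bijective map of finite discrete graphs (respectively, a regular covering of path connected finite discrete graphs). $\operatorname{Aut}(\Gamma,f)$ is the group $G$ of continuous maps of graphs $\alpha\colon\Gamma\to\Gamma$ with continuous inverse and $f\alpha=f$. It carries the group topology induced by its action: a base of neighbourhoods of $1$ is given by the finite-index normal subgroups $N_R=\{g\in G\mid (gx,x)\in R\ \forall x\in\Gamma\}$, where $R$ runs over the $G$-invariant compatible cofinite entourages of $\Gamma$ (those with $(g\times g)[R]=R$ for all $g$). The orbit graph $\Gamma/H$ has the quotient topology. *)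

theory Defs
  imports "HOL-Analysis.Analysis" "HOL-Algebra.Coset" "HOL-Algebra.Bij"
begin

section \<open>Graphs\<close>

text \<open>Vertices and edges of a graph live in the same type, since a graph is a single set that is
  the disjoint union of its vertices and edges.\<close>

record 'a graph =
  verts :: "'a set"
  edges :: "'a set"
  src :: "'a \<Rightarrow> 'a"
  tgt :: "'a \<Rightarrow> 'a"
  bar :: "'a \<Rightarrow> 'a"

definition gset :: "('a, 'm) graph_scheme \<Rightarrow> 'a set" where
  "gset \<Gamma> = verts \<Gamma> \<union> edges \<Gamma>"

definition is_graph :: "('a, 'm) graph_scheme \<Rightarrow> bool" where
  "is_graph \<Gamma> \<longleftrightarrow> verts \<Gamma> \<inter> edges \<Gamma> = {} \<and>
     (\<forall>e\<in>edges \<Gamma>. src \<Gamma> e \<in> verts \<Gamma> \<and> tgt \<Gamma> e \<in> verts \<Gamma> \<and> bar \<Gamma> e \<in> edges \<Gamma> \<and>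
        bar \<Gamma> (bar \<Gamma> e) = e \<and> bar \<Gamma> e \<noteq> e \<and>
        src \<Gamma> (bar \<Gamma> e) = tgt \<Gamma> e \<and> tgt \<Gamma> (bar \<Gamma> e) = src \<Gamma> e)"

definition graph_map :: "('a, 'm) graph_scheme \<Rightarrow> ('b, 'n) graph_scheme \<Rightarrow> ('a \<Rightarrow> 'b) \<Rightarrow> bool" where
  "graph_map \<Gamma> \<Delta> f \<longleftrightarrow> f ` verts \<Gamma> \<subseteq> verts \<Delta> \<and> f ` edges \<Gamma> \<subseteq> edges \<Delta> \<and>
     (\<forall>e\<in>edges \<Gamma>. f (src \<Gamma> e) = src \<Delta> (f e) \<and> f (tgt \<Gamma> e) = tgt \<Delta> (f e) \<and>
        f (bar \<Gamma> e) = bar \<Delta> (f e))"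

definition locally_bijective ::
  "('a, 'm) graph_scheme \<Rightarrow> ('b, 'n) graph_scheme \<Rightarrow> ('a \<Rightarrow> 'b) \<Rightarrow> bool" where
  "locally_bijective \<Gamma> \<Delta> f \<longleftrightarrow> graph_map \<Gamma> \<Delta> f \<and>
     (\<forall>v\<in>verts \<Gamma>. bij_betw f {e \<in> edges \<Gamma>. src \<Gamma> e = v} {e' \<in> edges \<Delta>. src \<Delta> e' = f v})"

fun edge_path :: "('a, 'm) graph_scheme \<Rightarrow> 'a \<Rightarrow> 'a list \<Rightarrow> 'a \<Rightarrow> bool" where
  "edge_path \<Gamma> v [] w \<longleftrightarrow> v \<in> verts \<Gamma> \<and> v = w"
| "edge_path \<Gamma> v (e # p) w \<longleftrightarrow> e \<in> edges \<Gamma> \<and> src \<Gamma> e = v \<and> edge_path \<Gamma> (tgt \<Gamma> e) p w"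

definition graph_path_connected :: "('a, 'm) graph_scheme \<Rightarrow> bool" where
  "graph_path_connected \<Gamma> \<longleftrightarrow> gset \<Gamma> \<noteq> {} \<and>
     (\<forall>v\<in>verts \<Gamma>. \<forall>w\<in>verts \<Gamma>. \<exists>p. edge_path \<Gamma> v p w)"


section \<open>Fundamental groups and regular coverings\<close>

definition loops :: "('a, 'm) graph_scheme \<Rightarrow> 'a \<Rightarrow> 'a list set" where
  "loops \<Gamma> x = {p. edge_path \<Gamma> x p x}"

definition backtracks :: "('a, 'm) graph_scheme \<Rightarrow> 'a list rel" where
  "backtracks \<Gamma> = {(p @ e # bar \<Gamma> e # q, p @ q) | p e q. e \<in> edges \<Gamma>}"

text \<open>Homotopy of edge loops at \<open>x\<close>: inserting and deleting backtracks, staying among the loops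
  at \<open>x\<close>.\<close>

definition loop_homotopy :: "('a, 'm) graph_scheme \<Rightarrow> 'a \<Rightarrow> 'a list rel" where
  "loop_homotopy \<Gamma> x =
     ((backtracks \<Gamma> \<union> (backtracks \<Gamma>)\<inverse>) \<inter> (loops \<Gamma> x \<times> loops \<Gamma> x))\<^sup>*"

definition pi1 :: "('a, 'm) graph_scheme \<Rightarrow> 'a \<Rightarrow> 'a list set monoid" where
  "pi1 \<Gamma> x = \<lparr>carrier = loops \<Gamma> x // loop_homotopy \<Gamma> x,
     monoid.mult = (\<lambda>A B. loop_homotopy \<Gamma> x `` {p @ q | p q. p \<in> A \<and> q \<in> B}),
     one = loop_homotopy \<Gamma> x `` {[]}\<rparr>"

definition pi1_map :: "('b, 'n) graph_scheme \<Rightarrow> ('a \<Rightarrow> 'b) \<Rightarrow> 'a \<Rightarrow> 'a list set \<Rightarrow> 'b list set" where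
  "pi1_map Y q x A = loop_homotopy Y (q x) `` (map q ` A)"

definition finite_regular_covering ::
  "('a, 'm) graph_scheme \<Rightarrow> ('b, 'n) graph_scheme \<Rightarrow> ('a \<Rightarrow> 'b) \<Rightarrow> bool" where
  "finite_regular_covering X Y q \<longleftrightarrow>
     is_graph X \<and> finite (gset X) \<and> graph_path_connected X \<and>
     is_graph Y \<and> finite (gset Y) \<and> graph_path_connected Y \<and>
     locally_bijective X Y q \<and>
     (\<exists>x\<in>verts X. pi1_map Y q x ` carrier (pi1 X x) \<lhd> pi1 Y (q x))"


section \<open>Uniformities\<close>

definition uniformity_on :: "'a set \<Rightarrow> 'a rel set \<Rightarrow> bool" where
  "uniformity_on X \<U> \<longleftrightarrow> \<U> \<noteq> {} \<and>
     (\<forall>W\<in>\<U>. Id_on X \<subseteq> W \<and> W \<subseteq> X \<times> X) \<and>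
     (\<forall>W\<in>\<U>. \<forall>W'. W \<subseteq> W' \<and> W' \<subseteq> X \<times> X \<longrightarrow> W' \<in> \<U>) \<and>
     (\<forall>W\<in>\<U>. \<forall>W'\<in>\<U>. W \<inter> W' \<in> \<U>) \<and>
     (\<forall>W\<in>\<U>. W\<inverse> \<in> \<U>) \<and>
     (\<forall>W\<in>\<U>. \<exists>W'\<in>\<U>. W' O W' \<subseteq> W)"

definition uniform_topology :: "'a set \<Rightarrow> 'a rel set \<Rightarrow> 'a topology" where
  "uniform_topology X \<U> = topology (\<lambda>S. S \<subseteq> X \<and> (\<forall>x\<in>S. \<exists>W\<in>\<U>. W `` {x} \<subseteq> S))"

lemma openin_uniform_topology:
  assumes "uniformity_on X \<U>"
  shows "openin (uniform_topology X \<U>) S \<longleftrightarrow> S \<subseteq> X \<and> (\<forall>x\<in>S. \<exists>W\<in>\<U>. W `` {x} \<subseteq> S)"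
proof -
  have "istopology (\<lambda>S. S \<subseteq> X \<and> (\<forall>x\<in>S. \<exists>W\<in>\<U>. W `` {x} \<subseteq> S))"
    unfolding istopology_def
  proof (intro conjI allI impI ballI)
    fix S T x
    assume S: "S \<subseteq> X \<and> (\<forall>x\<in>S. \<exists>W\<in>\<U>. W `` {x} \<subseteq> S)"
      and T: "T \<subseteq> X \<and> (\<forall>x\<in>T. \<exists>W\<in>\<U>. W `` {x} \<subseteq> T)" and x: "x \<in> S \<inter> T"
    obtain V W where "V \<in> \<U>" "V `` {x} \<subseteq> S" "W \<in> \<U>" "W `` {x} \<subseteq> T"
      using S T x by blast
    moreover from this have "V \<inter> W \<in> \<U>"
      using assms unfolding uniformity_on_def by blast
    ultimately show "\<exists>W\<in>\<U>. W `` {x} \<subseteq> S \<inter> T" by blast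
  next
    fix \<K> x
    assume \<K>: "\<forall>K\<in>\<K>. K \<subseteq> X \<and> (\<forall>x\<in>K. \<exists>W\<in>\<U>. W `` {x} \<subseteq> K)" and "x \<in> \<Union>\<K>"
    then obtain K W where "K \<in> \<K>" "W \<in> \<U>" "W `` {x} \<subseteq> K" by blast
    then show "\<exists>W\<in>\<U>. W `` {x} \<subseteq> \<Union>\<K>" by blast
  qed blast+
  then show ?thesis
    by (simp add: uniform_topology_def topology_inverse')
qed

lemma topspace_uniform_topology:
  assumes "uniformity_on X \<U>"
  shows "topspace (uniform_topology X \<U>) = X"
proof
  show "topspace (uniform_topology X \<U>) \<subseteq> X"
    using openin_uniform_topology[OF assms] openin_topspace by blast
  have "\<U> \<noteq> {}" "\<forall>W\<in>\<U>. W \<subseteq> X \<times> X"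
    using assms by (simp_all add: uniformity_on_def)
  then have "\<exists>W\<in>\<U>. W `` {x} \<subseteq> X" for x by blast
  then have "openin (uniform_topology X \<U>) X"
    by (simp add: openin_uniform_topology[OF assms])
  then show "X \<subseteq> topspace (uniform_topology X \<U>)"
    by (rule openin_subset)
qed

lemma compact_uniformity:
  assumes U: "uniformity_on X \<U>" and cpt: "compact_space (uniform_topology X \<U>)"
  shows "\<U> = {W. W \<subseteq> X \<times> X \<and>
    (\<exists>O'. openin (prod_topology (uniform_topology X \<U>) (uniform_topology X \<U>)) O' \<and>
       Id_on X \<subseteq> O' \<and> O' \<subseteq> W)}" (is "_ = ?N")
proof -
  let ?T = "uniform_topology X \<U>"
  note op = openin_uniform_topology[OF U]
  have sub: "Id_on X \<subseteq> W" "W \<subseteq> X \<times> X" if "W \<in> \<U>" for W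
    using U that unfolding uniformity_on_def by blast+
  have up: "W' \<in> \<U>" if "W \<in> \<U>" "W \<subseteq> W'" "W' \<subseteq> X \<times> X" for W W'
    using U that unfolding uniformity_on_def by blast
  have int: "W \<inter> W' \<in> \<U>" if "W \<in> \<U>" "W' \<in> \<U>" for W W'
    using U that unfolding uniformity_on_def by blast
  have cv: "W\<inverse> \<in> \<U>" if "W \<in> \<U>" for W
    using U that unfolding uniformity_on_def by blast
  have half: "\<exists>W'\<in>\<U>. W' O W' \<subseteq> W" if "W \<in> \<U>" for W
    using U that unfolding uniformity_on_def by blast
  have nbhd: "\<exists>S. openin ?T S \<and> x \<in> S \<and> S \<subseteq> W `` {x}" if "W \<in> \<U>" "x \<in> X" for W x
  proof -
    let ?S = "{y\<in>X. \<exists>V\<in>\<U>. V `` {y} \<subseteq> W `` {x}}"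
    have "\<exists>V\<in>\<U>. V `` {y} \<subseteq> ?S" if y: "y \<in> ?S" for y
    proof -
      obtain V where V: "V \<in> \<U>" "V `` {y} \<subseteq> W `` {x}" using y by blast
      obtain V' where V': "V' \<in> \<U>" "V' O V' \<subseteq> V" using half[OF V(1)] by blast
      have "V' `` {y} \<subseteq> ?S"
      proof
        fix z assume z: "z \<in> V' `` {y}"
        then have "V' `` {z} \<subseteq> W `` {x}" using V V' by blast
        moreover have "z \<in> X" using z sub(2)[OF V'(1)] by blast
        ultimately show "z \<in> ?S" using V'(1) by blast
      qed
      then show ?thesis using V'(1) by blast
    qed
    then have "openin ?T ?S" by (auto simp: op)
    moreover have "x \<in> ?S" using that by blast
    moreover have "?S \<subseteq> W `` {x}" using sub(1) by blast
    ultimately show ?thesis by blast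
  qed
  have "\<U> \<subseteq> ?N"
  proof
    fix W assume W: "W \<in> \<U>"
    obtain V where V: "V \<in> \<U>" "V O V \<subseteq> W" using half[OF W] by blast
    let ?V = "V \<inter> V\<inverse>"
    have V2: "?V \<in> \<U>" using int[OF V(1) cv[OF V(1)]] .
    have "\<forall>x\<in>X. \<exists>S. openin ?T S \<and> x \<in> S \<and> S \<subseteq> ?V `` {x}"
      using nbhd[OF V2] by blast
    then obtain S where S: "\<forall>x\<in>X. openin ?T (S x) \<and> x \<in> S x \<and> S x \<subseteq> ?V `` {x}"
      by (rule bchoice[THEN exE])
    let ?O = "\<Union>x\<in>X. S x \<times> S x"
    have "openin (prod_topology ?T ?T) ?O"
      using S by (intro openin_Union) (auto simp: openin_prod_Times_iff)
    moreover have "Id_on X \<subseteq> ?O" using S by blast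
    moreover have "?O \<subseteq> W"
    proof clarify
      fix x y z assume "x \<in> X" "y \<in> S x" "z \<in> S x"
      then have "(y, x) \<in> V" "(x, z) \<in> V" using S by blast+
      then show "(y, z) \<in> W" using V(2) by blast
    qed
    ultimately show "W \<in> ?N" using sub(2)[OF W] by blast
  qed
  moreover have "?N \<subseteq> \<U>"
  proof
    fix W assume "W \<in> ?N"
    then obtain O' where O': "openin (prod_topology ?T ?T) O'" "Id_on X \<subseteq> O'" "O' \<subseteq> W"
      and WX: "W \<subseteq> X \<times> X" by blast
    have "\<forall>x\<in>X. \<exists>V. V \<in> \<U> \<and> (V O V) `` {x} \<times> (V O V) `` {x} \<subseteq> O'"
    proof
      fix x assume x: "x \<in> X"
      have "(x, x) \<in> O'" using O'(2) x by blast
      then obtain A B where AB: "openin ?T A" "openin ?T B" "x \<in> A" "x \<in> B" "A \<times> B \<subseteq> O'"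
        using openin_prod_topology_alt[THEN iffD1, OF O'(1), rule_format] by metis
      then obtain P Q where PQ: "P \<in> \<U>" "P `` {x} \<subseteq> A" "Q \<in> \<U>" "Q `` {x} \<subseteq> B"
        unfolding op by meson
      obtain V where "V \<in> \<U>" "V O V \<subseteq> P \<inter> Q" using half[OF int[OF PQ(1,3)]] by blast
      moreover from this have "(V O V) `` {x} \<times> (V O V) `` {x} \<subseteq> A \<times> B" using PQ by blast
      ultimately show "\<exists>V. V \<in> \<U> \<and> (V O V) `` {x} \<times> (V O V) `` {x} \<subseteq> O'"
        using AB(5) by (meson subset_trans)
    qed
    then obtain V where
      V': "\<forall>x\<in>X. V x \<in> \<U> \<and> (V x O V x) `` {x} \<times> (V x O V x) `` {x} \<subseteq> O'"
      by (rule bchoice[THEN exE])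
    then have V: "V x \<in> \<U>" "(V x O V x) `` {x} \<times> (V x O V x) `` {x} \<subseteq> O'" if "x \<in> X" for x
      using that by auto
    have "\<forall>x\<in>X. \<exists>S. openin ?T S \<and> x \<in> S \<and> S \<subseteq> V x `` {x}"
      using nbhd V(1) by blast
    then obtain S where S': "\<forall>x\<in>X. openin ?T (S x) \<and> x \<in> S x \<and> S x \<subseteq> V x `` {x}"
      by (rule bchoice[THEN exE])
    then have S: "openin ?T (S x)" "x \<in> S x" "S x \<subseteq> V x `` {x}" if "x \<in> X" for x
      using that by auto
    have "Ball (S ` X) (openin ?T)" "X \<subseteq> \<Union>(S ` X)" using S by auto
    then obtain \<F> where \<F>: "finite \<F>" "\<F> \<subseteq> S ` X" "X \<subseteq> \<Union>\<F>"
      using cpt unfolding compact_space_alt topspace_uniform_topology[OF U] by metis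
    from finite_subset_image[OF \<F>(1,2)]
    obtain F where F: "finite F" "F \<subseteq> X" "X \<subseteq> (\<Union>x\<in>F. S x)"
      using \<F>(3) by auto
    have "\<U> \<noteq> {}" using U by (simp add: uniformity_on_def)
    then obtain W0 where W0: "W0 \<in> \<U>" by blast
    have "W0 \<inter> (\<Inter>x\<in>F. V x) \<in> \<U>"
      using F(1,2)
    proof (induction F)
      case (insert a F)
      have "V a \<inter> (W0 \<inter> \<Inter> (V ` F)) \<in> \<U>"
        using insert V(1) int by auto
      then show ?case by (simp add: Int_left_commute)
    qed (use W0 in simp)
    moreover have "W0 \<inter> (\<Inter>x\<in>F. V x) \<subseteq> W"
    proof clarify
      fix y z assume yz: "(y, z) \<in> W0" "(y, z) \<in> (\<Inter>x\<in>F. V x)"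
      then have "y \<in> X" using sub(2)[OF W0] by blast
      then obtain x where x: "x \<in> F" "y \<in> S x" using F(3) by blast
      then have xX: "x \<in> X" using F(2) by blast
      have y: "(x, y) \<in> V x" using S(3)[OF xX] x by blast
      have "(y, y) \<in> V x" using sub(1)[OF V(1)[OF xX]] \<open>y \<in> X\<close> by blast
      then have "y \<in> (V x O V x) `` {x}" using y by blast
      moreover have "z \<in> (V x O V x) `` {x}" using y yz(2) x(1) by blast
      ultimately show "(y, z) \<in> W" using V(2)[OF xX] O'(3) by blast
    qed
    ultimately show "W \<in> \<U>" using up WX by blast
  qed
  ultimately show ?thesis by blast
qed


section \<open>Profinite graphs\<close>

definition quotient_graph :: "('a, 'm) graph_scheme \<Rightarrow> 'a rel \<Rightarrow> 'a set graph" where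
  "quotient_graph \<Gamma> R = \<lparr>verts = verts \<Gamma> // R, edges = edges \<Gamma> // R,
     src = (\<lambda>A. R `` (src \<Gamma> ` A)), tgt = (\<lambda>A. R `` (tgt \<Gamma> ` A)),
     bar = (\<lambda>A. R `` (bar \<Gamma> ` A))\<rparr>"

definition compatible :: "('a, 'm) graph_scheme \<Rightarrow> 'a rel \<Rightarrow> bool" where
  "compatible \<Gamma> R \<longleftrightarrow> equiv (gset \<Gamma>) R \<and>
     (\<forall>v\<in>verts \<Gamma>. \<forall>e\<in>edges \<Gamma>. (v, e) \<notin> R) \<and>
     (\<forall>e1\<in>edges \<Gamma>. \<forall>e2\<in>edges \<Gamma>. (e1, e2) \<in> R \<longrightarrow>
        (src \<Gamma> e1, src \<Gamma> e2) \<in> R \<and> (tgt \<Gamma> e1, tgt \<Gamma> e2) \<in> R \<and> (bar \<Gamma> e1, bar \<Gamma> e2) \<in> R) \<and>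
     (\<forall>e\<in>edges \<Gamma>. (e, bar \<Gamma> e) \<notin> R)"

definition cofinite_graph :: "('a, 'm) graph_scheme \<Rightarrow> 'a rel set \<Rightarrow> bool" where
  "cofinite_graph \<Gamma> \<U> \<longleftrightarrow> is_graph \<Gamma> \<and> uniformity_on (gset \<Gamma>) \<U> \<and>
     Hausdorff_space (uniform_topology (gset \<Gamma>) \<U>) \<and>
     (\<forall>W\<in>\<U>. \<exists>R\<in>\<U>. R \<subseteq> W \<and> compatible \<Gamma> R \<and> finite (gset \<Gamma> // R))"

record 'a top_graph = "'a graph" +
  gtop :: "'a topology"

text \<open>A compact space carries at most one uniformity inducing its topology
  (lemma \<open>compact_uniformity\<close>), so a compact cofinite graph is determined by its graph structure
  and its topology.\<close>

definition profinite_graph :: "'a top_graph \<Rightarrow> bool" where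
  "profinite_graph \<Gamma> \<longleftrightarrow> compact_space (gtop \<Gamma>) \<and>
     (\<exists>\<U>. cofinite_graph \<Gamma> \<U> \<and> uniform_topology (gset \<Gamma>) \<U> = gtop \<Gamma>)"

definition entourages :: "'a top_graph \<Rightarrow> 'a rel set" where
  "entourages \<Gamma> =
     (THE \<U>. uniformity_on (gset \<Gamma>) \<U> \<and> uniform_topology (gset \<Gamma>) \<U> = gtop \<Gamma>)"

lemma entourages_eq:
  assumes "compact_space (gtop \<Gamma>)" "uniformity_on (gset \<Gamma>) \<U>"
    "uniform_topology (gset \<Gamma>) \<U> = gtop \<Gamma>"
  shows "entourages \<Gamma> = \<U>"
  unfolding entourages_def
proof (rule the_equality)
  fix \<V> assume "uniformity_on (gset \<Gamma>) \<V> \<and> uniform_topology (gset \<Gamma>) \<V> = gtop \<Gamma>"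
  then show "\<V> = \<U>"
    using compact_uniformity[of "gset \<Gamma>" \<U>] compact_uniformity[of "gset \<Gamma>" \<V>] assms by simp
qed (use assms in simp)

lemma profinite_graph_entourages:
  assumes "profinite_graph \<Gamma>"
  shows "cofinite_graph \<Gamma> (entourages \<Gamma>)"
    "uniform_topology (gset \<Gamma>) (entourages \<Gamma>) = gtop \<Gamma>"
  using assms entourages_eq unfolding profinite_graph_def cofinite_graph_def by metis+

definition cofinite_entourages :: "'a top_graph \<Rightarrow> 'a rel set" where
  "cofinite_entourages \<Gamma> = {R \<in> entourages \<Gamma>. compatible \<Gamma> R \<and> finite (gset \<Gamma> // R)}"

definition connected_profinite_graph :: "'a top_graph \<Rightarrow> bool" where
  "connected_profinite_graph \<Gamma> \<longleftrightarrow> profinite_graph \<Gamma> \<and>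
     (\<forall>R\<in>cofinite_entourages \<Gamma>. graph_path_connected (quotient_graph \<Gamma> R))"


section \<open>Inverse limits and coverings\<close>

definition cont_graph_map :: "'a top_graph \<Rightarrow> 'b top_graph \<Rightarrow> ('a \<Rightarrow> 'b) \<Rightarrow> bool" where
  "cont_graph_map \<Gamma> \<Delta> f \<longleftrightarrow> graph_map \<Gamma> \<Delta> f \<and> continuous_map (gtop \<Gamma>) (gtop \<Delta>) f"

definition top_graph_iso :: "'a top_graph \<Rightarrow> 'b top_graph \<Rightarrow> ('a \<Rightarrow> 'b) \<Rightarrow> bool" where
  "top_graph_iso \<Gamma> \<Delta> f \<longleftrightarrow> graph_map \<Gamma> \<Delta> f \<and> bij_betw f (gset \<Gamma>) (gset \<Delta>) \<and>
     homeomorphic_map (gtop \<Gamma>) (gtop \<Delta>) f"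

definition finite_discrete_graph :: "'a top_graph \<Rightarrow> bool" where
  "finite_discrete_graph \<Gamma> \<longleftrightarrow> is_graph \<Gamma> \<and> finite (gset \<Gamma>) \<and>
     gtop \<Gamma> = discrete_topology (gset \<Gamma>)"

definition directed_set :: "'i set \<Rightarrow> ('i \<Rightarrow> 'i \<Rightarrow> bool) \<Rightarrow> bool" where
  "directed_set I prec \<longleftrightarrow> I \<noteq> {} \<and> (\<forall>i\<in>I. prec i i) \<and>
     (\<forall>i\<in>I. \<forall>j\<in>I. \<forall>k\<in>I. prec i j \<and> prec j k \<longrightarrow> prec i k) \<and>
     (\<forall>i\<in>I. \<forall>j\<in>I. \<exists>k\<in>I. prec i k \<and> prec j k)"

definition inverse_system ::
  "'i set \<Rightarrow> ('i \<Rightarrow> 'i \<Rightarrow> bool) \<Rightarrow> ('i \<Rightarrow> 'a top_graph) \<Rightarrow> ('i \<Rightarrow> 'i \<Rightarrow> 'a \<Rightarrow> 'a) \<Rightarrow> bool" where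
  "inverse_system I prec X \<phi> \<longleftrightarrow>
     (\<forall>i\<in>I. \<forall>j\<in>I. prec i j \<longrightarrow> cont_graph_map (X j) (X i) (\<phi> i j)) \<and>
     (\<forall>i\<in>I. \<forall>x\<in>gset (X i). \<phi> i i x = x) \<and>
     (\<forall>i\<in>I. \<forall>j\<in>I. \<forall>k\<in>I. prec i j \<and> prec j k \<longrightarrow> (\<forall>x\<in>gset (X k). \<phi> i j (\<phi> j k x) = \<phi> i k x))"

definition inverse_system_maps ::
  "'i set \<Rightarrow> ('i \<Rightarrow> 'i \<Rightarrow> bool) \<Rightarrow> ('i \<Rightarrow> 'a top_graph) \<Rightarrow> ('i \<Rightarrow> 'i \<Rightarrow> 'a \<Rightarrow> 'a) \<Rightarrow>
   ('i \<Rightarrow> 'b top_graph) \<Rightarrow> ('i \<Rightarrow> 'i \<Rightarrow> 'b \<Rightarrow> 'b) \<Rightarrow> ('i \<Rightarrow> 'a \<Rightarrow> 'b) \<Rightarrow> bool" where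
  "inverse_system_maps I prec X \<phi> Y \<psi> F \<longleftrightarrow> directed_set I prec \<and>
     inverse_system I prec X \<phi> \<and> inverse_system I prec Y \<psi> \<and>
     (\<forall>i\<in>I. cont_graph_map (X i) (Y i) (F i)) \<and>
     (\<forall>i\<in>I. \<forall>j\<in>I. prec i j \<longrightarrow> (\<forall>x\<in>gset (X j). F i (\<phi> i j x) = \<psi> i j (F j x)))"

definition threads ::
  "'i set \<Rightarrow> ('i \<Rightarrow> 'i \<Rightarrow> bool) \<Rightarrow> ('i \<Rightarrow> 'a set) \<Rightarrow> ('i \<Rightarrow> 'i \<Rightarrow> 'a \<Rightarrow> 'a) \<Rightarrow> ('i \<Rightarrow> 'a) set" where
  "threads I prec S \<phi> = {x \<in> Pi\<^sub>E I S. \<forall>i\<in>I. \<forall>j\<in>I. prec i j \<longrightarrow> \<phi> i j (x j) = x i}"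

definition inverse_limit ::
  "'i set \<Rightarrow> ('i \<Rightarrow> 'i \<Rightarrow> bool) \<Rightarrow> ('i \<Rightarrow> 'a top_graph) \<Rightarrow> ('i \<Rightarrow> 'i \<Rightarrow> 'a \<Rightarrow> 'a) \<Rightarrow>
   ('i \<Rightarrow> 'a) top_graph" where
  "inverse_limit I prec X \<phi> = \<lparr>
     verts = threads I prec (\<lambda>i. verts (X i)) \<phi>, edges = threads I prec (\<lambda>i. edges (X i)) \<phi>,
     src = (\<lambda>e. \<lambda>i\<in>I. src (X i) (e i)), tgt = (\<lambda>e. \<lambda>i\<in>I. tgt (X i) (e i)),
     bar = (\<lambda>e. \<lambda>i\<in>I. bar (X i) (e i)),
     gtop = subtopology (product_topology (\<lambda>i. gtop (X i)) I)
       (threads I prec (\<lambda>i. verts (X i)) \<phi> \<union> threads I prec (\<lambda>i. edges (X i)) \<phi>)\<rparr>"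

definition is_inverse_limit_map ::
  "'i set \<Rightarrow> ('i \<Rightarrow> 'i \<Rightarrow> bool) \<Rightarrow> ('i \<Rightarrow> 'c top_graph) \<Rightarrow> ('i \<Rightarrow> 'i \<Rightarrow> 'c \<Rightarrow> 'c) \<Rightarrow>
   ('i \<Rightarrow> 'd top_graph) \<Rightarrow> ('i \<Rightarrow> 'i \<Rightarrow> 'd \<Rightarrow> 'd) \<Rightarrow> ('i \<Rightarrow> 'c \<Rightarrow> 'd) \<Rightarrow>
   'a top_graph \<Rightarrow> 'b top_graph \<Rightarrow> ('a \<Rightarrow> 'b) \<Rightarrow> bool" where
  "is_inverse_limit_map I prec X \<phi> Y \<psi> F \<Gamma> \<Delta> f \<longleftrightarrow>
     (\<exists>a b. top_graph_iso \<Gamma> (inverse_limit I prec X \<phi>) a \<and>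
        top_graph_iso \<Delta> (inverse_limit I prec Y \<psi>) b \<and>
        (\<forall>x\<in>gset \<Gamma>. b (f x) = (\<lambda>i\<in>I. F i (a x i))))"

text \<open>Every finite graph is isomorphic to one whose elements are natural numbers, so the finite
  graphs of the inverse systems are taken over \<open>nat\<close>. Directed sets of arbitrary size have no
  single home type, so the type \<open>'i\<close> of indices is a parameter of the two notions of covering.\<close>

definition covering :: "'i itself \<Rightarrow> 'a top_graph \<Rightarrow> 'b top_graph \<Rightarrow> ('a \<Rightarrow> 'b) \<Rightarrow> bool" where
  "covering (_ :: 'i itself) \<Gamma> \<Delta> f \<longleftrightarrow>
     profinite_graph \<Gamma> \<and> profinite_graph \<Delta> \<and> cont_graph_map \<Gamma> \<Delta> f \<and>
     (\<exists>(I :: 'i set) prec (X :: 'i \<Rightarrow> nat top_graph) \<phi> (Y :: 'i \<Rightarrow> nat top_graph) \<psi> F.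
        inverse_system_maps I prec X \<phi> Y \<psi> F \<and>
        (\<forall>i\<in>I. finite_discrete_graph (X i) \<and> finite_discrete_graph (Y i) \<and>
           locally_bijective (X i) (Y i) (F i)) \<and>
        is_inverse_limit_map I prec X \<phi> Y \<psi> F \<Gamma> \<Delta> f)"

definition regular_covering ::
  "'i itself \<Rightarrow> 'a top_graph \<Rightarrow> 'b top_graph \<Rightarrow> ('a \<Rightarrow> 'b) \<Rightarrow> bool" where
  "regular_covering (_ :: 'i itself) \<Gamma> \<Delta> f \<longleftrightarrow>
     profinite_graph \<Gamma> \<and> profinite_graph \<Delta> \<and> cont_graph_map \<Gamma> \<Delta> f \<and>
     (\<exists>(I :: 'i set) prec (X :: 'i \<Rightarrow> nat top_graph) \<phi> (Y :: 'i \<Rightarrow> nat top_graph) \<psi> F.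
        inverse_system_maps I prec X \<phi> Y \<psi> F \<and>
        (\<forall>i\<in>I. finite_discrete_graph (X i) \<and> finite_discrete_graph (Y i) \<and>
           finite_regular_covering (X i) (Y i) (F i)) \<and>
        is_inverse_limit_map I prec X \<phi> Y \<psi> F \<Gamma> \<Delta> f)"


section \<open>Automorphisms over a map\<close>

text \<open>As in \<^const>\<open>BijGroup\<close>, automorphisms are extensional functions on the underlying set.\<close>

definition Aut :: "'a top_graph \<Rightarrow> ('a \<Rightarrow> 'b) \<Rightarrow> ('a \<Rightarrow> 'a) monoid" where
  "Aut \<Gamma> f = BijGroup (gset \<Gamma>) \<lparr>carrier :=
     {\<alpha> \<in> Bij (gset \<Gamma>). graph_map \<Gamma> \<Gamma> \<alpha> \<and> homeomorphic_map (gtop \<Gamma>) (gtop \<Gamma>) \<alpha> \<and>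
        (\<forall>x\<in>gset \<Gamma>. f (\<alpha> x) = f x)}\<rparr>"

definition invariant_entourages :: "'a top_graph \<Rightarrow> ('a \<Rightarrow> 'b) \<Rightarrow> 'a rel set" where
  "invariant_entourages \<Gamma> f =
     {R \<in> cofinite_entourages \<Gamma>. \<forall>g\<in>carrier (Aut \<Gamma> f). map_prod g g ` R = R}"

definition congruence_subgroup :: "'a top_graph \<Rightarrow> ('a \<Rightarrow> 'b) \<Rightarrow> 'a rel \<Rightarrow> ('a \<Rightarrow> 'a) set" where
  "congruence_subgroup \<Gamma> f R = {g \<in> carrier (Aut \<Gamma> f). \<forall>x\<in>gset \<Gamma>. (g x, x) \<in> R}"

text \<open>The invariant compatible cofinite entourages are closed under intersection, so the cosets of
  their congruence subgroups form a base of the topology that they generate.\<close>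

definition Aut_topology :: "'a top_graph \<Rightarrow> ('a \<Rightarrow> 'b) \<Rightarrow> ('a \<Rightarrow> 'a) topology" where
  "Aut_topology \<Gamma> f = topology_generated_by
     {g <#\<^bsub>Aut \<Gamma> f\<^esub> congruence_subgroup \<Gamma> f R | g R.
        g \<in> carrier (Aut \<Gamma> f) \<and> R \<in> invariant_entourages \<Gamma> f}"


section \<open>Orbit graphs\<close>

definition quotient_topology :: "'a topology \<Rightarrow> ('a \<Rightarrow> 'b) \<Rightarrow> 'b topology" where
  "quotient_topology T q =
     topology (\<lambda>U. U \<subseteq> q ` topspace T \<and> openin T {x \<in> topspace T. q x \<in> U})"

lemma openin_quotient_topology:
  "openin (quotient_topology T q) U \<longleftrightarrow>
     U \<subseteq> q ` topspace T \<and> openin T {x \<in> topspace T. q x \<in> U}"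
proof -
  have "istopology (\<lambda>U. U \<subseteq> q ` topspace T \<and> openin T {x \<in> topspace T. q x \<in> U})"
    unfolding istopology_def
  proof (intro conjI allI impI)
    fix S U
    assume "S \<subseteq> q ` topspace T \<and> openin T {x \<in> topspace T. q x \<in> S}"
      and "U \<subseteq> q ` topspace T \<and> openin T {x \<in> topspace T. q x \<in> U}"
    then have "openin T ({x \<in> topspace T. q x \<in> S} \<inter> {x \<in> topspace T. q x \<in> U})" by blast
    then show "openin T {x \<in> topspace T. q x \<in> S \<inter> U}" by (rule back_subst) blast
  next
    fix \<K>
    assume "\<forall>K\<in>\<K>. K \<subseteq> q ` topspace T \<and> openin T {x \<in> topspace T. q x \<in> K}"
    then have "openin T (\<Union>K\<in>\<K>. {x \<in> topspace T. q x \<in> K})" by blast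
    then show "openin T {x \<in> topspace T. q x \<in> \<Union>\<K>}" by (rule back_subst) blast
  qed blast+
  then show ?thesis
    by (simp add: quotient_topology_def topology_inverse')
qed

definition orbit_rel :: "'a top_graph \<Rightarrow> ('a \<Rightarrow> 'a) set \<Rightarrow> 'a rel" where
  "orbit_rel \<Gamma> H = {(x, g x) | x g. x \<in> gset \<Gamma> \<and> g \<in> H}"

definition orbit_map :: "'a top_graph \<Rightarrow> ('a \<Rightarrow> 'a) set \<Rightarrow> 'a \<Rightarrow> 'a set" where
  "orbit_map \<Gamma> H x = orbit_rel \<Gamma> H `` {x}"

definition orbit_graph :: "'a top_graph \<Rightarrow> ('a \<Rightarrow> 'a) set \<Rightarrow> 'a set top_graph" where
  "orbit_graph \<Gamma> H = graph.extend (quotient_graph \<Gamma> (orbit_rel \<Gamma> H))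
     \<lparr>gtop = quotient_topology (gtop \<Gamma>) (orbit_map \<Gamma> H)\<rparr>"

text \<open>For \<open>f\<close> constant on orbits, \<open>f ` A\<close> is a singleton for each orbit \<open>A\<close>.\<close>

definition induced_map :: "('a \<Rightarrow> 'b) \<Rightarrow> 'a set \<Rightarrow> 'b" where
  "induced_map f A = the_elem (f ` A)"

end

(* Write X_i -> Y_i for the finite regular coverings whose limit is f. Normality makes the deck group
   of X_i -> Y_i transitive on fibers, and unique lifting along the connected graphs X_j and \<Gamma> shows
   that every element of G descends to a deck transformation of each X_i. Hence G acts freely on
   every X_i, compatibly with the bonding maps, and is transitive on the fibers of f. A closed
   subgroup H is the limit of its images H_i, and a compactness argument gives \<Gamma>/H = lim X_i/H_i.
   For closed H \<subseteq> K the map \<Gamma>/H -> \<Gamma>/K is therefore the limit of the coverings X_i/H_i -> X_i/K_i,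
   which are regular if K normalizes H. The claims are the cases 1 \<subseteq> H and H \<subseteq> G, with \<Delta> = \<Gamma>/G.
   The system X_i/G_i replaces Y_i because G need not map onto the deck group of X_i -> Y_i, so that
   H_i could fail to be normal there. *)

theory Submission
  imports Defs
begin

section \<open>Edge paths and fundamental groups\<close>

text \<open>Neither the projections from \<Gamma> to the levels nor the bonding maps are assumed
  surjective, so an automorphism cannot be pushed to a level by choosing preimages. Instead a deck
  map of the level is prescribed at one vertex, and its agreement with the automorphism is spread
  over \<Gamma> by connectedness. The same uniqueness makes the action on each level free up to its
  kernel, and freeness is what makes the quotient maps injective on stars. Closedness of H and
  compactness have separate tasks: closedness makes the coordinates separate the points of the orbit
  graph, and compactness lifts every thread of orbits to a thread of points. Normality in the
  fundamental group enters only through its equivalence with transitivity of deck maps on fibers: it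
  is converted into transitivity at the levels of f and recovered from transitivity at the quotient
  levels. \<Delta> is not compared with the orbit graph of G by an explicit isomorphism. Any
  quotient map whose fibers are the orbits is accepted as an orbit map, so \<Gamma>, \<Gamma>/H and
  \<Delta> share the same lemmas.\<close>

lemma is_graphD:
  assumes "is_graph \<Gamma>"
  shows "v \<in> verts \<Gamma> \<Longrightarrow> v \<notin> edges \<Gamma>" "e \<in> edges \<Gamma> \<Longrightarrow> src \<Gamma> e \<in> verts \<Gamma>"
    "e \<in> edges \<Gamma> \<Longrightarrow> tgt \<Gamma> e \<in> verts \<Gamma>" "e \<in> edges \<Gamma> \<Longrightarrow> bar \<Gamma> e \<in> edges \<Gamma>"
    "e \<in> edges \<Gamma> \<Longrightarrow> bar \<Gamma> (bar \<Gamma> e) = e" "e \<in> edges \<Gamma> \<Longrightarrow> bar \<Gamma> e \<noteq> e"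
    "e \<in> edges \<Gamma> \<Longrightarrow> src \<Gamma> (bar \<Gamma> e) = tgt \<Gamma> e" "e \<in> edges \<Gamma> \<Longrightarrow> tgt \<Gamma> (bar \<Gamma> e) = src \<Gamma> e"
  using assms unfolding is_graph_def by auto

lemma graph_mapD:
  assumes "graph_map \<Gamma> \<Delta> f"
  shows "v \<in> verts \<Gamma> \<Longrightarrow> f v \<in> verts \<Delta>" "e \<in> edges \<Gamma> \<Longrightarrow> f e \<in> edges \<Delta>"
    "e \<in> edges \<Gamma> \<Longrightarrow> f (src \<Gamma> e) = src \<Delta> (f e)" "e \<in> edges \<Gamma> \<Longrightarrow> f (tgt \<Gamma> e) = tgt \<Delta> (f e)"
    "e \<in> edges \<Gamma> \<Longrightarrow> f (bar \<Gamma> e) = bar \<Delta> (f e)" "x \<in> gset \<Gamma> \<Longrightarrow> f x \<in> gset \<Delta>"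
  using assms unfolding graph_map_def gset_def by auto

lemma graph_mapI:
  assumes "\<And>v. v \<in> verts \<Gamma> \<Longrightarrow> f v \<in> verts \<Delta>" "\<And>e. e \<in> edges \<Gamma> \<Longrightarrow> f e \<in> edges \<Delta>"
    "\<And>e. e \<in> edges \<Gamma> \<Longrightarrow> f (src \<Gamma> e) = src \<Delta> (f e)"
    "\<And>e. e \<in> edges \<Gamma> \<Longrightarrow> f (tgt \<Gamma> e) = tgt \<Delta> (f e)"
    "\<And>e. e \<in> edges \<Gamma> \<Longrightarrow> f (bar \<Gamma> e) = bar \<Delta> (f e)"
  shows "graph_map \<Gamma> \<Delta> f"
  using assms unfolding graph_map_def by auto

lemma graph_map_comp:
  assumes "graph_map \<Gamma> \<Delta> f" "graph_map \<Delta> \<Theta> g"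
  shows "graph_map \<Gamma> \<Theta> (\<lambda>x. g (f x))"
  by (rule graph_mapI) (simp_all add: graph_mapD[OF assms(1)] graph_mapD[OF assms(2)])

lemma gsetI: "v \<in> verts \<Gamma> \<Longrightarrow> v \<in> gset \<Gamma>" "v \<in> edges \<Gamma> \<Longrightarrow> v \<in> gset \<Gamma>"
  by (auto simp: gset_def)

lemma edge_path_ends:
  assumes "is_graph \<Gamma>" "edge_path \<Gamma> v p w"
  shows "v \<in> verts \<Gamma>" "w \<in> verts \<Gamma>" "set p \<subseteq> edges \<Gamma>"
  using assms(2) by (induction p arbitrary: v) (auto simp: is_graphD[OF assms(1)])

lemma edge_path_append:
  assumes "is_graph \<Gamma>"
  shows "edge_path \<Gamma> v (p @ q) w \<longleftrightarrow> (\<exists>u. edge_path \<Gamma> v p u \<and> edge_path \<Gamma> u q w)"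
  by (induction p arbitrary: v) (auto dest: edge_path_ends(1)[OF assms])

lemma edge_path_end_unique: "edge_path \<Gamma> v p w \<Longrightarrow> edge_path \<Gamma> v p w' \<Longrightarrow> w = w'"
  by (induction p arbitrary: v) auto

lemma edge_path_map:
  assumes "graph_map X Y q" "edge_path X x p w"
  shows "edge_path Y (q x) (map q p) (q w)"
  using assms(2)
  by (induction p arbitrary: x) (auto simp: graph_mapD[OF assms(1)] simp flip: graph_mapD(3,4)[OF assms(1)])

definition rev_path :: "('a, 'm) graph_scheme \<Rightarrow> 'a list \<Rightarrow> 'a list" where
  "rev_path \<Gamma> p = rev (map (bar \<Gamma>) p)"

lemma edge_path_rev:
  assumes "is_graph \<Gamma>" "edge_path \<Gamma> v p w"
  shows "edge_path \<Gamma> w (rev_path \<Gamma> p) v"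
  using assms(2)
proof (induction p arbitrary: v)
  case (Cons e p)
  then show ?case
    by (auto simp: rev_path_def edge_path_append[OF assms(1)] is_graphD[OF assms(1)])
qed (simp add: rev_path_def)

lemma rev_rev_path:
  assumes "is_graph \<Gamma>" "set p \<subseteq> edges \<Gamma>"
  shows "rev_path \<Gamma> (rev_path \<Gamma> p) = p"
  using assms(2) by (induction p) (auto simp: rev_path_def is_graphD[OF assms(1)])

lemma map_rev_path:
  assumes "graph_map X Y q" "set p \<subseteq> edges X"
  shows "map q (rev_path X p) = rev_path Y (map q p)"
  using assms(2) by (induction p) (auto simp: rev_path_def graph_mapD[OF assms(1)])

section \<open>Homotopy classes of edge loops as a group\<close>

text \<open>The carrier is \<open>UNIV\<close> because a reflexive closure also relates each list
  that is not a loop at \<open>x\<close>, though only to itself.\<close>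

lemma equiv_loop_homotopy: "equiv UNIV (loop_homotopy \<Gamma> x)"
proof -
  have "sym ((backtracks \<Gamma> \<union> (backtracks \<Gamma>)\<inverse>) \<inter> (loops \<Gamma> x \<times> loops \<Gamma> x))"
    by (auto simp: sym_def)
  then show ?thesis
    unfolding loop_homotopy_def by (auto simp: equiv_def refl_rtrancl sym_rtrancl trans_rtrancl)
qed

lemma loop_homotopy_class_eq:
  "loop_homotopy \<Gamma> x `` {p} = loop_homotopy \<Gamma> x `` {p'} \<longleftrightarrow> (p, p') \<in> loop_homotopy \<Gamma> x"
  by (simp add: eq_equiv_class_iff[OF equiv_loop_homotopy])

lemma loop_homotopy_refl: "(p, p) \<in> loop_homotopy \<Gamma> x"
  by (simp add: loop_homotopy_def)

lemma loop_homotopy_trans: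
  "(p, p') \<in> loop_homotopy \<Gamma> x \<Longrightarrow> (p', p'') \<in> loop_homotopy \<Gamma> x \<Longrightarrow> (p, p'') \<in> loop_homotopy \<Gamma> x"
  unfolding loop_homotopy_def by (rule rtrancl_trans)

lemma loop_homotopy_loops:
  assumes "(p, p') \<in> loop_homotopy \<Gamma> x" "p \<in> loops \<Gamma> x"
  shows "p' \<in> loops \<Gamma> x"
  using assms unfolding loop_homotopy_def by (induction) auto

lemma backtracks_cong:
  assumes "(p, p') \<in> backtracks \<Gamma>"
  shows "(a @ p @ b, a @ p' @ b) \<in> backtracks \<Gamma>"
proof -
  obtain u e v where "p = u @ e # bar \<Gamma> e # v" "p' = u @ v" "e \<in> edges \<Gamma>"
    using assms by (auto simp: backtracks_def)
  then have "a @ p @ b = (a @ u) @ e # bar \<Gamma> e # (v @ b)" "a @ p' @ b = (a @ u) @ (v @ b)"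
    by auto
  with \<open>e \<in> edges \<Gamma>\<close> show ?thesis unfolding backtracks_def by blast
qed

text \<open>A homotopy step counts only between loops at \<open>x\<close>; the flanking words
  \<open>a\<close> and \<open>b\<close> are loops so that every intermediate word is one
  again.\<close>

lemma loop_homotopy_cong:
  assumes "is_graph \<Gamma>" "a \<in> loops \<Gamma> x" "b \<in> loops \<Gamma> x" "p \<in> loops \<Gamma> x"
    "(p, p') \<in> loop_homotopy \<Gamma> x"
  shows "(a @ p @ b, a @ p' @ b) \<in> loop_homotopy \<Gamma> x"
  using assms(5) unfolding loop_homotopy_def
proof (induction)
  case (step y z)
  have L: "a @ y @ b \<in> loops \<Gamma> x" "a @ z @ b \<in> loops \<Gamma> x"
    using step(2) assms by (auto simp: loops_def edge_path_append)
  show ?case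
    by (rule rtrancl_into_rtrancl[OF step(3)]) (use L step(2) backtracks_cong in blast)
qed simp

lemma loop_homotopy_mult:
  assumes "is_graph \<Gamma>" "p \<in> loops \<Gamma> x" "r \<in> loops \<Gamma> x"
    "(p, p') \<in> loop_homotopy \<Gamma> x" "(r, r') \<in> loop_homotopy \<Gamma> x"
  shows "(p @ r, p' @ r') \<in> loop_homotopy \<Gamma> x"
proof -
  have x: "[] \<in> loops \<Gamma> x" using edge_path_ends(1)[OF assms(1), of x p x] assms(2) by (simp add: loops_def)
  have "p' \<in> loops \<Gamma> x" using loop_homotopy_loops[OF assms(4,2)] .
  then show ?thesis
    using loop_homotopy_trans[OF loop_homotopy_cong[OF assms(1) x assms(3) assms(2,4), simplified]
      loop_homotopy_cong[OF assms(1) _ x assms(3,5), of p', simplified]] by simp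
qed

text \<open>Cancellation runs from the inside out: the induction moves the first edge
  \<open>e\<close> into \<open>a\<close> and its reverse into \<open>b\<close>, cancels the rest of
  \<open>p\<close>, and only then do the two meet as a backtrack. Hence the flanking paths are
  arbitrary rather than loops.\<close>

lemma rev_path_homotopy:
  assumes \<Gamma>: "is_graph \<Gamma>"
    and "edge_path \<Gamma> x a v" "edge_path \<Gamma> v p w" "edge_path \<Gamma> v b x"
  shows "(a @ p @ rev_path \<Gamma> p @ b, a @ b) \<in> loop_homotopy \<Gamma> x"
  using assms(2-4)
proof (induction p arbitrary: a b v)
  case Nil
  then show ?case by (simp add: rev_path_def loop_homotopy_refl)
next
  case (Cons e p)
  have e: "e \<in> edges \<Gamma>" "src \<Gamma> e = v" and p: "edge_path \<Gamma> (tgt \<Gamma> e) p w"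
    using Cons.prems by auto
  have 1: "edge_path \<Gamma> x (a @ [e]) (tgt \<Gamma> e)" "edge_path \<Gamma> (tgt \<Gamma> e) (bar \<Gamma> e # b) x"
    using Cons.prems e is_graphD[OF \<Gamma>] by (auto simp: edge_path_append[OF \<Gamma>])
  have "((a @ [e]) @ p @ rev_path \<Gamma> p @ (bar \<Gamma> e # b), (a @ [e]) @ bar \<Gamma> e # b) \<in> loop_homotopy \<Gamma> x"
    using Cons.IH[OF 1(1) p 1(2)] .
  moreover have "((a @ [e]) @ bar \<Gamma> e # b, a @ b) \<in> loop_homotopy \<Gamma> x"
  proof -
    have "(a @ e # bar \<Gamma> e # b, a @ b) \<in> backtracks \<Gamma>" using e by (auto simp: backtracks_def)
    moreover have "(a @ [e]) @ bar \<Gamma> e # b \<in> loops \<Gamma> x" "a @ b \<in> loops \<Gamma> x"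
      using 1 Cons.prems edge_path_append[OF \<Gamma>] unfolding loops_def by blast+
    ultimately show ?thesis unfolding loop_homotopy_def by (intro r_into_rtrancl) auto
  qed
  ultimately show ?case using loop_homotopy_trans by (fastforce simp: rev_path_def)
qed

lemma rev_path_loops: "is_graph \<Gamma> \<Longrightarrow> p \<in> loops \<Gamma> x \<Longrightarrow> rev_path \<Gamma> p \<in> loops \<Gamma> x"
  by (simp add: loops_def edge_path_rev)

lemma append_loops: "is_graph \<Gamma> \<Longrightarrow> p \<in> loops \<Gamma> x \<Longrightarrow> r \<in> loops \<Gamma> x \<Longrightarrow> p @ r \<in> loops \<Gamma> x"
  by (auto simp: loops_def edge_path_append)

lemma pi1_carrierE:
  assumes "A \<in> carrier (pi1 \<Gamma> x)"
  obtains p where "p \<in> loops \<Gamma> x" "A = loop_homotopy \<Gamma> x `` {p}"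
  using assms by (auto simp: pi1_def quotient_def)

lemma pi1_carrierI: "p \<in> loops \<Gamma> x \<Longrightarrow> loop_homotopy \<Gamma> x `` {p} \<in> carrier (pi1 \<Gamma> x)"
  by (auto simp: pi1_def quotient_def)

lemma pi1_mult:
  assumes "is_graph \<Gamma>" "p \<in> loops \<Gamma> x" "r \<in> loops \<Gamma> x"
  shows "loop_homotopy \<Gamma> x `` {p} \<otimes>\<^bsub>pi1 \<Gamma> x\<^esub> loop_homotopy \<Gamma> x `` {r} = loop_homotopy \<Gamma> x `` {p @ r}"
proof -
  let ?R = "loop_homotopy \<Gamma> x"
  have "?R `` {p' @ r' | p' r'. p' \<in> ?R `` {p} \<and> r' \<in> ?R `` {r}} = ?R `` {p @ r}"
  proof safe
    fix s p' r' assume "(p, p') \<in> ?R" "(r, r') \<in> ?R" "(p' @ r', s) \<in> ?R"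
    then show "(p @ r, s) \<in> ?R" using loop_homotopy_trans[OF loop_homotopy_mult[OF assms]] by simp
  next
    fix s assume "(p @ r, s) \<in> ?R"
    moreover have "p @ r \<in> {p' @ r' | p' r'. p' \<in> ?R `` {p} \<and> r' \<in> ?R `` {r}}"
      using loop_homotopy_refl[of p] loop_homotopy_refl[of r] by fast
    ultimately show "s \<in> ?R `` {p' @ r' | p' r'. p' \<in> ?R `` {p} \<and> r' \<in> ?R `` {r}}"
      by (rule ImageI)
  qed
  then show ?thesis by (simp add: pi1_def)
qed

lemma pi1_one: "\<one>\<^bsub>pi1 \<Gamma> x\<^esub> = loop_homotopy \<Gamma> x `` {[]}"
  by (simp add: pi1_def)

lemma pi1_group:
  assumes \<Gamma>: "is_graph \<Gamma>" and x: "x \<in> verts \<Gamma>"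
  shows "group (pi1 \<Gamma> x)"
proof (rule groupI)
  have N: "[] \<in> loops \<Gamma> x" using x by (simp add: loops_def)
  show "\<one>\<^bsub>pi1 \<Gamma> x\<^esub> \<in> carrier (pi1 \<Gamma> x)" using pi1_carrierI[OF N] by (simp add: pi1_one)
  fix A assume "A \<in> carrier (pi1 \<Gamma> x)"
  then obtain p where p: "p \<in> loops \<Gamma> x" "A = loop_homotopy \<Gamma> x `` {p}" by (rule pi1_carrierE)
  show "\<one>\<^bsub>pi1 \<Gamma> x\<^esub> \<otimes>\<^bsub>pi1 \<Gamma> x\<^esub> A = A" using pi1_mult[OF \<Gamma> N p(1)] by (simp add: pi1_one p)
  have rp: "rev_path \<Gamma> p \<in> loops \<Gamma> x" using rev_path_loops[OF \<Gamma> p(1)] .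
  \<comment> \<open>\<open>groupI\<close> asks for a left inverse; this is the cancellation of
    \<open>rev_path \<Gamma> p\<close> against its own reverse, which is \<open>p\<close>.\<close>
  have "(rev_path \<Gamma> p @ p, []) \<in> loop_homotopy \<Gamma> x"
    using rev_path_homotopy[OF \<Gamma>, of x "[]" x "rev_path \<Gamma> p" x "[]"] rp x p(1)
      rev_rev_path[OF \<Gamma>, of p] edge_path_ends(3)[OF \<Gamma>, of x p x]
    by (simp add: loops_def)
  then have "loop_homotopy \<Gamma> x `` {rev_path \<Gamma> p} \<otimes>\<^bsub>pi1 \<Gamma> x\<^esub> A = \<one>\<^bsub>pi1 \<Gamma> x\<^esub>"
    using pi1_mult[OF \<Gamma> rp p(1)] by (simp add: pi1_one p loop_homotopy_class_eq)
  then show "\<exists>B\<in>carrier (pi1 \<Gamma> x). B \<otimes>\<^bsub>pi1 \<Gamma> x\<^esub> A = \<one>\<^bsub>pi1 \<Gamma> x\<^esub>"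
    using pi1_carrierI[OF rp] by blast
  fix B assume "B \<in> carrier (pi1 \<Gamma> x)"
  then obtain r where r: "r \<in> loops \<Gamma> x" "B = loop_homotopy \<Gamma> x `` {r}" by (rule pi1_carrierE)
  show "A \<otimes>\<^bsub>pi1 \<Gamma> x\<^esub> B \<in> carrier (pi1 \<Gamma> x)"
    using pi1_mult[OF \<Gamma> p(1) r(1)] pi1_carrierI[OF append_loops[OF \<Gamma> p(1) r(1)]] p r by simp
  fix C assume "C \<in> carrier (pi1 \<Gamma> x)"
  then obtain s where s: "s \<in> loops \<Gamma> x" "C = loop_homotopy \<Gamma> x `` {s}" by (rule pi1_carrierE)
  show "A \<otimes>\<^bsub>pi1 \<Gamma> x\<^esub> B \<otimes>\<^bsub>pi1 \<Gamma> x\<^esub> C = A \<otimes>\<^bsub>pi1 \<Gamma> x\<^esub> (B \<otimes>\<^bsub>pi1 \<Gamma> x\<^esub> C)"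
    using p r s append_loops[OF \<Gamma>] by (simp add: pi1_mult[OF \<Gamma>])
qed

lemma pi1_inv:
  assumes \<Gamma>: "is_graph \<Gamma>" and p: "p \<in> loops \<Gamma> x"
  shows "inv\<^bsub>pi1 \<Gamma> x\<^esub> (loop_homotopy \<Gamma> x `` {p}) = loop_homotopy \<Gamma> x `` {rev_path \<Gamma> p}"
proof -
  have x: "x \<in> verts \<Gamma>" using p edge_path_ends(1)[OF \<Gamma>] by (auto simp: loops_def)
  interpret group "pi1 \<Gamma> x" using pi1_group[OF \<Gamma> x] .
  have "(p @ rev_path \<Gamma> p, []) \<in> loop_homotopy \<Gamma> x"
    using rev_path_homotopy[OF \<Gamma>, of x "[]" x p x "[]"] p x by (simp add: loops_def)
  then have "loop_homotopy \<Gamma> x `` {p} \<otimes>\<^bsub>pi1 \<Gamma> x\<^esub> loop_homotopy \<Gamma> x `` {rev_path \<Gamma> p} = \<one>\<^bsub>pi1 \<Gamma> x\<^esub>"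
    using pi1_mult[OF \<Gamma> p rev_path_loops[OF \<Gamma> p]] by (simp add: pi1_one loop_homotopy_class_eq)
  then have "loop_homotopy \<Gamma> x `` {rev_path \<Gamma> p} \<otimes>\<^bsub>pi1 \<Gamma> x\<^esub> loop_homotopy \<Gamma> x `` {p} = \<one>\<^bsub>pi1 \<Gamma> x\<^esub>"
    by (rule inv_comm) (use p rev_path_loops[OF \<Gamma> p] in \<open>simp_all add: pi1_carrierI\<close>)
  then show ?thesis
    by (rule inv_equality) (use p rev_path_loops[OF \<Gamma> p] in \<open>simp_all add: pi1_carrierI\<close>)
qed

section \<open>Coverings of graphs\<close>

locale graph_covering =
  fixes X :: "('a, 'm) graph_scheme" and Y :: "('b, 'n) graph_scheme" and q :: "'a \<Rightarrow> 'b"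
  assumes X: "is_graph X" and Y: "is_graph Y" and lb: "locally_bijective X Y q"
begin

lemma q_map: "graph_map X Y q"
  using lb by (simp add: locally_bijective_def)

lemma edge_unique:
  assumes "e \<in> edges X" "e' \<in> edges X" "src X e = src X e'" "q e = q e'"
  shows "e = e'"
proof -
  have "inj_on q {e'' \<in> edges X. src X e'' = src X e}"
    using lb assms(1) is_graphD(2)[OF X] by (auto simp: locally_bijective_def bij_betw_def)
  then show ?thesis using assms by (auto simp: inj_on_def)
qed

lemma edge_lift:
  assumes "v \<in> verts X" "e' \<in> edges Y" "src Y e' = q v"
  obtains e where "e \<in> edges X" "src X e = v" "q e = e'"
proof -
  have "e' \<in> q ` {e \<in> edges X. src X e = v}"
    using lb assms by (auto simp: locally_bijective_def bij_betw_def)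
  then show ?thesis using that by auto
qed

section \<open>Path lifting and monodromy\<close>

lemma lift_unique:
  assumes "edge_path X x p w" "edge_path X x p' w'" "map q p = map q p'"
  shows "p = p'" "w = w'"
proof -
  show "p = p'"
    using assms
  proof (induction p arbitrary: x p')
    case (Cons e p)
    then obtain e' r where p': "p' = e' # r" by (cases p') auto
    then have "e = e'" using Cons.prems edge_unique[of e e'] by auto
    then show ?case using Cons p' by auto
  qed simp
  then show "w = w'" using assms edge_path_end_unique by metis
qed

lemma lift_exists:
  assumes "x \<in> verts X" "edge_path Y (q x) c y"
  shows "\<exists>p w. edge_path X x p w \<and> map q p = c"
  using assms
proof (induction c arbitrary: x)
  case Nil
  then show ?case by (intro exI[of _ "[]"]) auto
next
  case (Cons e c)
  then obtain e' where e': "e' \<in> edges X" "src X e' = x" "q e' = e"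
    using edge_lift[of x e] by auto
  then have "q (tgt X e') = tgt Y e" using graph_mapD(4)[OF q_map] by auto
  then obtain p w where "edge_path X (tgt X e') p w" "map q p = c"
    using Cons.IH[of "tgt X e'"] Cons.prems(2) is_graphD(3)[OF X e'(1)] by auto
  then show ?case using e' by (intro exI[of _ "e' # p"]) auto
qed

text \<open>The monodromy of the covering: \<open>c\<close> carries \<open>x\<close> to the end of
  its lift at \<open>x\<close>. It is a relation since \<open>c\<close> need not be a path from
  \<open>q x\<close>.\<close>

definition lifts :: "'a \<Rightarrow> 'b list \<Rightarrow> 'a \<Rightarrow> bool" where
  "lifts x c w \<longleftrightarrow> (\<exists>p. edge_path X x p w \<and> map q p = c)"

lemma lifts_unique: "lifts x c w \<Longrightarrow> lifts x c w' \<Longrightarrow> w = w'"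
  unfolding lifts_def using lift_unique(2) by metis

lemma lifts_exists: "x \<in> verts X \<Longrightarrow> edge_path Y (q x) c y \<Longrightarrow> \<exists>w. lifts x c w"
  unfolding lifts_def using lift_exists by metis

lemma lifts_path: "lifts x c w \<Longrightarrow> edge_path Y (q x) c (q w)"
  unfolding lifts_def using edge_path_map[OF q_map] by metis

lemma lifts_verts: "lifts x c w \<Longrightarrow> x \<in> verts X" "lifts x c w \<Longrightarrow> w \<in> verts X"
  unfolding lifts_def using edge_path_ends[OF X] by blast+

lemma lifts_append: "lifts x (c @ d) w \<longleftrightarrow> (\<exists>u. lifts x c u \<and> lifts u d w)"
proof
  assume "lifts x (c @ d) w"
  then obtain p where p: "edge_path X x p w" "map q p = c @ d" by (auto simp: lifts_def)
  then obtain p1 p2 where "p = p1 @ p2" "map q p1 = c" "map q p2 = d"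
    by (auto simp: map_eq_append_conv)
  with p show "\<exists>u. lifts x c u \<and> lifts u d w"
    unfolding lifts_def using edge_path_append[OF X] by metis
next
  assume "\<exists>u. lifts x c u \<and> lifts u d w"
  then show "lifts x (c @ d) w"
    unfolding lifts_def edge_path_append[OF X]
    by (elim exE conjE) (rule_tac x = "p @ pa" in exI, auto simp: edge_path_append[OF X])
qed

lemma lifts_rev: "lifts x c w \<Longrightarrow> lifts w (rev_path Y c) x"
  unfolding lifts_def
  using edge_path_rev[OF X] edge_path_ends(3)[OF X] map_rev_path[OF q_map] by metis

text \<open>A lift of \<open>e\<close> followed by \<open>bar Y e\<close> runs out along one edge
  and back along its reverse, so it returns to its start. That \<open>c\<close> is a path in
  \<open>Y\<close> gives \<open>src Y e = q u\<close>, which is what allows the backtrack to be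
  inserted into a lift of \<open>c'\<close>.\<close>

lemma lifts_backtrack:
  assumes "(c, c') \<in> backtracks Y" "edge_path Y (q x) c y"
  shows "lifts x c w \<longleftrightarrow> lifts x c' w"
proof -
  obtain a e b where c: "c = a @ [e, bar Y e] @ b" "c' = a @ b" and e: "e \<in> edges Y"
    using assms(1) by (auto simp: backtracks_def)
  have be: "bar Y e \<in> edges Y" using is_graphD(4)[OF Y e] .
  have "lifts u [e, bar Y e] v \<longleftrightarrow> u = v" if u: "u \<in> verts X" "src Y e = q u" for u v
  proof -
    obtain e1 where e1: "e1 \<in> edges X" "src X e1 = u" "q e1 = e" using edge_lift[OF u(1) e u(2)] .
    have L: "lifts u [e, bar Y e] u"
      unfolding lifts_def using e1 graph_mapD(5)[OF q_map e1(1)] u(1)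
      by (intro exI[of _ "[e1, bar X e1]"]) (simp add: is_graphD[OF X])
    then show ?thesis using lifts_unique by blast
  qed
  moreover have "src Y e = q u" if "lifts x a u" for u
  proof -
    obtain y' where "edge_path Y (q x) a y'" "src Y e = y'"
      using assms(2) c edge_path_append[OF Y] by auto
    then show ?thesis using lifts_path[OF that] edge_path_end_unique by metis
  qed
  ultimately show ?thesis unfolding c lifts_append using lifts_verts by metis
qed

lemma lifts_homotopy:
  assumes "(c, c') \<in> loop_homotopy Y (q x)"
  shows "lifts x c w \<longleftrightarrow> lifts x c' w"
  using assms unfolding loop_homotopy_def
proof (induction)
  case (step y z)
  then have "edge_path Y (q x) y (q x)" "edge_path Y (q x) z (q x)" by (auto simp: loops_def)
  then show ?case using step lifts_backtrack by blast
qed simp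

lemma map_homotopy:
  assumes "(p, p') \<in> loop_homotopy X x"
  shows "(map q p, map q p') \<in> loop_homotopy Y (q x)"
proof -
  have L: "map q p \<in> loops Y (q x)" if "p \<in> loops X x" for p
    using that edge_path_map[OF q_map] by (auto simp: loops_def)
  have B: "(map q p, map q p') \<in> backtracks Y" if pp: "(p, p') \<in> backtracks X" for p p'
  proof -
    obtain a e b where "p = a @ e # bar X e # b" "p' = a @ b" "e \<in> edges X"
      using pp unfolding backtracks_def by blast
    then have "map q p = map q a @ q e # bar Y (q e) # map q b" "map q p' = map q a @ map q b"
      "q e \<in> edges Y" using graph_mapD[OF q_map] by auto
    then show ?thesis unfolding backtracks_def by blast
  qed
  show ?thesis
    using assms unfolding loop_homotopy_def
  proof (induction)
    case (step y z)
    then have "(map q y, map q z) \<in> (backtracks Y \<union> (backtracks Y)\<inverse>) \<inter> (loops Y (q x) \<times> loops Y (q x))"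
      using L B by auto
    with step(3) show ?case by (rule rtrancl_into_rtrancl)
  qed simp
qed

lemma pi1_map_class:
  "pi1_map Y q x (loop_homotopy X x `` {p}) = loop_homotopy Y (q x) `` {map q p}"
proof -
  have "loop_homotopy Y (q x) `` (map q ` loop_homotopy X x `` {p}) = loop_homotopy Y (q x) `` {map q p}"
  proof (intro equalityI subsetI)
    fix s assume "s \<in> loop_homotopy Y (q x) `` (map q ` loop_homotopy X x `` {p})"
    then obtain p' where "(p, p') \<in> loop_homotopy X x" "(map q p', s) \<in> loop_homotopy Y (q x)"
      by auto
    then show "s \<in> loop_homotopy Y (q x) `` {map q p}"
      using loop_homotopy_trans[OF map_homotopy] by simp
  next
    fix s assume "s \<in> loop_homotopy Y (q x) `` {map q p}"
    then show "s \<in> loop_homotopy Y (q x) `` (map q ` loop_homotopy X x `` {p})"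
      using loop_homotopy_refl[of p X x] by (intro ImageI[of "map q p"]) auto
  qed
  then show ?thesis by (simp add: pi1_map_def)
qed

text \<open>The image of the fundamental group is the stabilizer of \<open>x\<close> under
  monodromy: whether a lift closes up depends only on the homotopy class of the loop.\<close>

lemma pi1_image_iff:
  assumes "c \<in> loops Y (q x)"
  shows "loop_homotopy Y (q x) `` {c} \<in> pi1_map Y q x ` carrier (pi1 X x) \<longleftrightarrow> lifts x c x"
proof
    assume "loop_homotopy Y (q x) `` {c} \<in> pi1_map Y q x ` carrier (pi1 X x)"
    then obtain p where p: "p \<in> loops X x"
      "loop_homotopy Y (q x) `` {c} = loop_homotopy Y (q x) `` {map q p}"
      using pi1_map_class pi1_carrierE by (metis (no_types, lifting) imageE)
    then have "(c, map q p) \<in> loop_homotopy Y (q x)" by (simp add: loop_homotopy_class_eq)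
    moreover have "lifts x (map q p) x" using p(1) by (auto simp: lifts_def loops_def)
    ultimately show "lifts x c x" using lifts_homotopy by simp
  next
    assume "lifts x c x"
    then obtain p where "p \<in> loops X x" "map q p = c" by (auto simp: lifts_def loops_def)
    then show "loop_homotopy Y (q x) `` {c} \<in> pi1_map Y q x ` carrier (pi1 X x)"
      using pi1_map_class pi1_carrierI by (metis imageI)
qed

lemma pi1_image_subset:
  assumes "A \<in> pi1_map Y q x ` carrier (pi1 X x)"
  obtains c where "c \<in> loops Y (q x)" "lifts x c x" "A = loop_homotopy Y (q x) `` {c}"
proof -
  obtain B where B: "B \<in> carrier (pi1 X x)" "A = pi1_map Y q x B" using assms by auto
  obtain p where p: "p \<in> loops X x" "B = loop_homotopy X x `` {p}" using pi1_carrierE[OF B(1)] .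
  have c: "map q p \<in> loops Y (q x)" using p edge_path_map[OF q_map] by (auto simp: loops_def)
  have l: "lifts x (map q p) x" using p(1) by (auto simp: lifts_def loops_def)
  have "A = loop_homotopy Y (q x) `` {map q p}" using B(2) p(2) pi1_map_class by simp
  then show ?thesis using that c l by blast
qed

text \<open>An edge is determined by its source and its image in \<open>Y\<close>, so two lifts of the same map that
  agree somewhere agree along every edge path.\<close>

lemma lifting_unique:
  assumes W: "is_graph W" "graph_path_connected W"
    and p: "graph_map W X p" and p': "graph_map W X p'"
    and eq: "\<And>z. z \<in> gset W \<Longrightarrow> q (p z) = q (p' z)"
    and z0: "z0 \<in> gset W" "p z0 = p' z0" and z: "z \<in> gset W"
  shows "p z = p' z"
proof -
  have E: "p e = p' e" if "e \<in> edges W" "p (src W e) = p' (src W e)" for e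
    using that edge_unique[of "p e" "p' e"] graph_mapD[OF p] graph_mapD[OF p'] eq gsetI by metis
  obtain v0 where v0: "v0 \<in> verts W" "p v0 = p' v0"
  proof (cases "z0 \<in> verts W")
    case False
    then have "z0 \<in> edges W" using z0(1) by (auto simp: gset_def)
    then show ?thesis
      using that[of "src W z0"] z0(2) graph_mapD(3)[OF p] graph_mapD(3)[OF p'] is_graphD(2)[OF W(1)]
      by metis
  qed (use that z0 in blast)
  have path: "p v = p' v \<Longrightarrow> edge_path W v r w \<Longrightarrow> p w = p' w" for v r w
  proof (induction r arbitrary: v)
    case (Cons e r)
    then have "e \<in> edges W" "p e = p' e" using E[of e] by auto
    then have "p (tgt W e) = p' (tgt W e)" using graph_mapD(4)[OF p] graph_mapD(4)[OF p'] by metis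
    then show ?case using Cons by auto
  qed simp
  have V: "p v = p' v" if "v \<in> verts W" for v
    using W(2) v0 that path unfolding graph_path_connected_def by metis
  show ?thesis
    using z V E is_graphD(2)[OF W(1)] by (auto simp: gset_def)
qed

section \<open>Deck maps and normality\<close>

text \<open>The image of \<open>z\<close> is found by running a path from \<open>x\<close> to
  \<open>z\<close>, projecting it, and lifting the projection at \<open>x'\<close>. The assumption
  on loops makes the result independent of the path.\<close>

lemma deck_of_lifting_loops:
  assumes conn: "graph_path_connected X" and x: "x \<in> verts X" "x' \<in> verts X" "q x' = q x"
    and loops: "\<And>c. lifts x c x \<Longrightarrow> lifts x' c x'"
  shows "\<exists>g. graph_map X X g \<and> (\<forall>z\<in>gset X. q (g z) = q z) \<and> g x = x'"
proof -
  define rel where "rel z z' \<longleftrightarrow> (\<exists>c. lifts x c z \<and> lifts x' c z')" for z z'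
  have rel_fun: "z' = z''" if zz: "rel z z'" "rel z z''" for z z' z''
  proof -
    obtain c d where cd: "lifts x c z" "lifts x' c z'" "lifts x d z" "lifts x' d z''"
      using zz unfolding rel_def by blast
    \<comment> \<open>Two paths to the same \<open>z\<close> differ by a loop that closes up at
      \<open>x\<close>, hence also at \<open>x'\<close>.\<close>
    have "lifts x (c @ rev_path Y d) x" using cd lifts_rev[OF cd(3)] by (auto simp: lifts_append)
    then have "lifts x' (c @ rev_path Y d) x'" by (rule loops)
    then have "lifts z' (rev_path Y d) x'" using lifts_unique[OF cd(2)] by (auto simp: lifts_append)
    then have "lifts x' (rev_path Y (rev_path Y d)) z'" by (rule lifts_rev)
    moreover have "set d \<subseteq> edges Y" using lifts_path[OF cd(3)] edge_path_ends(3)[OF Y] by blast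
    ultimately show ?thesis using rev_rev_path[OF Y] cd(4) lifts_unique by metis
  qed
  have total: "\<exists>z'. rel z z'" if "z \<in> verts X" for z
  proof -
    obtain p where "edge_path X x p z" using conn x(1) \<open>z \<in> verts X\<close> by (auto simp: graph_path_connected_def)
    then have l: "lifts x (map q p) z" by (auto simp: lifts_def)
    then have "edge_path Y (q x') (map q p) (q z)" using lifts_path x(3) by metis
    then show ?thesis unfolding rel_def using lifts_exists[OF x(2)] l by blast
  qed
  define g0 where "g0 z = (THE z'. rel z z')" for z
  have g0: "rel z (g0 z)" if "z \<in> verts X" for z
    unfolding g0_def using theI'[of "rel z"] total[OF that] rel_fun by blast
  have g0_eq: "g0 z = z'" if "rel z z'" for z z'
    unfolding g0_def using that rel_fun by blast
  have g0V: "g0 z \<in> verts X" "q (g0 z) = q z" if z: "z \<in> verts X" for z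
  proof -
    obtain c where c: "lifts x c z" "lifts x' c (g0 z)" using g0[OF z] by (auto simp: rel_def)
    show "g0 z \<in> verts X" using lifts_verts(2)[OF c(2)] .
    show "q (g0 z) = q z" using lifts_path[OF c(1)] lifts_path[OF c(2)] x(3) edge_path_end_unique by metis
  qed
  \<comment> \<open>On an edge there is no freedom: its image must start at the image of its source
    and lie over the same edge of \<open>Y\<close>.\<close>
  define g where "g z = (if z \<in> edges X then (THE e. e \<in> edges X \<and> src X e = g0 (src X z) \<and> q e = q z)
      else g0 z)" for z
  have gV: "g z = g0 z" if "z \<in> verts X" for z
    using that is_graphD(1)[OF X that] by (simp add: g_def)
  have gE: "g e \<in> edges X \<and> src X (g e) = g0 (src X e) \<and> q (g e) = q e" if e: "e \<in> edges X" for e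
  proof -
    have "src Y (q e) = q (g0 (src X e))"
      using graph_mapD(3)[OF q_map e] g0V(2)[OF is_graphD(2)[OF X e]] by simp
    then have "\<exists>e'. e' \<in> edges X \<and> src X e' = g0 (src X e) \<and> q e' = q e"
      using edge_lift[OF g0V(1)[OF is_graphD(2)[OF X e]] graph_mapD(2)[OF q_map e]] by metis
    then have "\<exists>!e'. e' \<in> edges X \<and> src X e' = g0 (src X e) \<and> q e' = q e"
      using edge_unique by metis
    then show ?thesis using e theI' by (simp add: g_def) (rule theI')
  qed
  have gt: "tgt X (g e) = g0 (tgt X e)" if e: "e \<in> edges X" for e
  proof -
    obtain c where c: "lifts x c (src X e)" "lifts x' c (g0 (src X e))"
      using g0[OF is_graphD(2)[OF X e]] unfolding rel_def by blast
    have "lifts (src X e) [q e] (tgt X e)" "lifts (g0 (src X e)) [q e] (tgt X (g e))"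
      unfolding lifts_def using e gE[OF e] is_graphD(3)[OF X]
      by (intro exI[of _ "[e]"] exI[of _ "[g e]"], simp)+
    then have "rel (tgt X e) (tgt X (g e))" unfolding rel_def using c by (intro exI[of _ "c @ [q e]"]) (auto simp: lifts_append)
    then show ?thesis using g0_eq by simp
  qed
  \<comment> \<open>Both edges start at the image of the target of \<open>e\<close> and lie over
    \<open>bar Y (q e)\<close>.\<close>
  have gb: "bar X (g e) = g (bar X e)" if e: "e \<in> edges X" for e
  proof (rule edge_unique)
    have be: "bar X e \<in> edges X" using is_graphD(4)[OF X e] .
    show "bar X (g e) \<in> edges X" using gE[OF e] is_graphD(4)[OF X] by blast
    show "g (bar X e) \<in> edges X" using gE[OF be] by blast
    show "src X (bar X (g e)) = src X (g (bar X e))"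
      using gE[OF e] gE[OF be] gt[OF e] is_graphD(7)[OF X] e by simp
    show "q (bar X (g e)) = q (g (bar X e))"
      using gE[OF e] gE[OF be] graph_mapD(5)[OF q_map] e by simp
  qed
  have "graph_map X X g"
    by (rule graph_mapI) (use gE gV gt gb g0V(1) is_graphD(2,3)[OF X] in \<open>auto\<close>)
  moreover have "q (g z) = q z" if "z \<in> gset X" for z
    using that gV gE g0V(2) by (auto simp: gset_def)
  moreover have "rel x x'" unfolding rel_def lifts_def using x by (intro exI[of _ "[]"]) auto
  then have "g x = x'" using gV[OF x(1)] g0_eq by simp
  ultimately show ?thesis by blast
qed

text \<open>The monodromy stabilizers of two vertices in one fiber are conjugate by the projection
  of a path between them, so normality makes them equal and \<open>deck_of_lifting_loops\<close>
  applies at the base vertex \<open>x\<close>. Other vertices are carried back to the fiber of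
  \<open>x\<close> along a path, and edges follow their sources.\<close>

lemma deck_of_normal:
  assumes conn: "graph_path_connected X" and x: "x \<in> verts X"
    and N: "pi1_map Y q x ` carrier (pi1 X x) \<lhd> pi1 Y (q x)"
    and z: "z \<in> gset X" "z' \<in> gset X" "q z' = q z"
  shows "\<exists>g. graph_map X X g \<and> (\<forall>z\<in>gset X. q (g z) = q z) \<and> g z = z'"
proof -
  interpret N: normal "pi1_map Y q x ` carrier (pi1 X x)" "pi1 Y (q x)" using N .
  have base: "\<exists>g. graph_map X X g \<and> (\<forall>z\<in>gset X. q (g z) = q z) \<and> g x = x'"
    if x': "x' \<in> verts X" "q x' = q x" for x'
  proof (rule deck_of_lifting_loops[OF conn x x'])
    fix c assume c: "lifts x c x"
    obtain p where "edge_path X x p x'" using conn x x'(1) by (auto simp: graph_path_connected_def)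
    then have d: "lifts x (map q p) x'" by (auto simp: lifts_def)
    have cl: "c \<in> loops Y (q x)" using lifts_path[OF c] by (simp add: loops_def)
    have dl: "map q p \<in> loops Y (q x)" using lifts_path[OF d] x'(2) by (simp add: loops_def)
    have rl: "rev_path Y (map q p) \<in> loops Y (q x)" using rev_path_loops[OF Y dl] .
    \<comment> \<open>The conjugate of \<open>c\<close> by the loop \<open>map q p\<close> closes up
      at \<open>x\<close>. Its lift first reaches \<open>x'\<close>, so its middle part is the lift
      of \<open>c\<close> at \<open>x'\<close>, and this has to end where the reversed tail starts,
      which is \<open>x'\<close> again.\<close>
    have "loop_homotopy Y (q x) `` {map q p} \<otimes>\<^bsub>pi1 Y (q x)\<^esub> loop_homotopy Y (q x) `` {c}
        \<otimes>\<^bsub>pi1 Y (q x)\<^esub> inv\<^bsub>pi1 Y (q x)\<^esub> (loop_homotopy Y (q x) `` {map q p})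
      \<in> pi1_map Y q x ` carrier (pi1 X x)"
      using N.inv_op_closed2[OF pi1_carrierI[OF dl]] c pi1_image_iff[OF cl] by blast
    then have "lifts x ((map q p @ c) @ rev_path Y (map q p)) x"
      using pi1_image_iff append_loops[OF Y] cl dl rl
      by (simp add: pi1_inv[OF Y dl] pi1_mult[OF Y])
    then obtain u where u: "lifts x' c u" "lifts u (rev_path Y (map q p)) x"
      using lifts_unique[OF d] by (auto simp: lifts_append)
    have "lifts x (rev_path Y (rev_path Y (map q p))) u" using lifts_rev[OF u(2)] .
    moreover have "set (map q p) \<subseteq> edges Y" using lifts_path[OF d] edge_path_ends(3)[OF Y] by blast
    ultimately have "lifts x (map q p) u" using rev_rev_path[OF Y] by metis
    then have "u = x'" using d lifts_unique by blast
    then show "lifts x' c x'" using u(1) by simp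
  qed
  have vert: "\<exists>g. graph_map X X g \<and> (\<forall>z\<in>gset X. q (g z) = q z) \<and> g y = y'"
    if y: "y \<in> verts X" "y' \<in> verts X" "q y' = q y" for y y'
  proof -
    obtain p where p: "edge_path X x p y" using conn x y(1) by (auto simp: graph_path_connected_def)
    then have c: "lifts x (map q p) y" by (auto simp: lifts_def)
    \<comment> \<open>\<open>x'\<close> is the vertex over \<open>q x\<close> from which the
      projected path from \<open>x\<close> to \<open>y\<close> lifts to a path ending at
      \<open>y'\<close>. The deck map taking \<open>x\<close> to \<open>x'\<close> then takes
      \<open>y\<close> to \<open>y'\<close> by uniqueness of lifts.\<close>
    have "edge_path Y (q y') (rev_path Y (map q p)) (q x)"
      using lifts_path[OF lifts_rev[OF c]] y(3) by simp
    then obtain x' where x': "lifts y' (rev_path Y (map q p)) x'" using lifts_exists y(2) by blast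
    have "set (map q p) \<subseteq> edges Y" using lifts_path[OF c] edge_path_ends(3)[OF Y] by blast
    then have x'y': "lifts x' (map q p) y'" using lifts_rev[OF x'] rev_rev_path[OF Y] by metis
    have "x' \<in> verts X" "q x' = q x"
      using lifts_verts(2)[OF x'] lifts_path[OF x'] lifts_path[OF lifts_rev[OF c]] y(3)
        edge_path_end_unique by metis+
    then obtain g where g: "graph_map X X g" "\<forall>z\<in>gset X. q (g z) = q z" "g x = x'"
      using base by blast
    have "edge_path X x' (map g p) (g y)" using edge_path_map[OF g(1) p] g(3) by simp
    moreover have "map q (map g p) = map q p"
      using edge_path_ends(3)[OF X p] g(2) by (fastforce simp: gset_def)
    ultimately have "lifts x' (map q p) (g y)" unfolding lifts_def by blast
    then have "g y = y'" using x'y' lifts_unique by blast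
    then show ?thesis using g by blast
  qed
  show ?thesis
  proof (cases "z \<in> verts X")
    case True
    then have "z' \<in> verts X"
      using z graph_mapD(1,2)[OF q_map] is_graphD(1)[OF Y] unfolding gset_def by (metis UnE)
    then show ?thesis using vert True z by blast
  next
    case False
    then have e: "z \<in> edges X" using z by (auto simp: gset_def)
    then have e': "z' \<in> edges X"
      using z graph_mapD(1,2)[OF q_map] is_graphD(1)[OF Y] unfolding gset_def by (metis UnE)
    have "q (src X z') = q (src X z)" using e e' z(3) graph_mapD(3)[OF q_map] by simp
    then obtain g where g: "graph_map X X g" "\<forall>z\<in>gset X. q (g z) = q z" "g (src X z) = src X z'"
      using vert[OF is_graphD(2)[OF X e] is_graphD(2)[OF X e']] by blast
    have "g z = z'"
    proof (rule edge_unique)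
      show "g z \<in> edges X" using graph_mapD(2)[OF g(1) e] .
      show "src X (g z) = src X z'" using graph_mapD(3)[OF g(1) e] g(3) by simp
      show "q (g z) = q z'" using g(2) z(1,3) by simp
    qed (rule e')
    then show ?thesis using g by blast
  qed
qed

text \<open>A deck map taking \<open>x\<close> to the end of the lift of \<open>d\<close> carries
  the closed lift of \<open>c\<close> at \<open>x\<close> to a closed lift there. So the conjugate
  of \<open>c\<close> by \<open>d\<close> closes up at \<open>x\<close>.\<close>

lemma normal_of_transitive:
  assumes x: "x \<in> verts X"
    and tr: "\<And>x'. x' \<in> verts X \<Longrightarrow> q x' = q x \<Longrightarrow>
      \<exists>g. graph_map X X g \<and> (\<forall>z\<in>gset X. q (g z) = q z) \<and> g x = x'"
  shows "pi1_map Y q x ` carrier (pi1 X x) \<lhd> pi1 Y (q x)" (is "?N \<lhd> ?P")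
proof -
  have qx: "q x \<in> verts Y" using graph_mapD(1)[OF q_map x] .
  interpret P: group ?P using pi1_group[OF Y qx] .
  have N: "[] \<in> loops Y (q x)" "lifts x [] x" using qx x by (auto simp: loops_def lifts_def)
  have "subgroup ?N ?P"
  proof (rule P.subgroupI)
    show "?N \<subseteq> carrier ?P"
    proof
      fix A assume "A \<in> ?N"
      then show "A \<in> carrier ?P" by (rule pi1_image_subset) (simp add: pi1_carrierI)
    qed
    have "loop_homotopy Y (q x) `` {[]} \<in> ?N" using pi1_image_iff N by blast
    then show "?N \<noteq> {}" by blast
  next
    fix A assume "A \<in> ?N"
    then obtain c where c: "c \<in> loops Y (q x)" "lifts x c x" "A = loop_homotopy Y (q x) `` {c}"
      by (rule pi1_image_subset)
    then show "inv\<^bsub>?P\<^esub> A \<in> ?N"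
      using pi1_inv[OF Y c(1)] pi1_image_iff[OF rev_path_loops[OF Y c(1)]] lifts_rev[OF c(2)] by simp
    fix B assume "B \<in> ?N"
    then obtain d where d: "d \<in> loops Y (q x)" "lifts x d x" "B = loop_homotopy Y (q x) `` {d}"
      by (rule pi1_image_subset)
    then show "A \<otimes>\<^bsub>?P\<^esub> B \<in> ?N"
      using pi1_mult[OF Y c(1) d(1)] pi1_image_iff[OF append_loops[OF Y c(1) d(1)]] lifts_append c
      by auto
  qed
  moreover have "A \<otimes>\<^bsub>?P\<^esub> B \<otimes>\<^bsub>?P\<^esub> inv\<^bsub>?P\<^esub> A \<in> ?N" if A: "A \<in> carrier ?P" and B: "B \<in> ?N" for A B
  proof -
    obtain c where c: "c \<in> loops Y (q x)" "lifts x c x" "B = loop_homotopy Y (q x) `` {c}"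
      using B by (rule pi1_image_subset)
    obtain d where d: "d \<in> loops Y (q x)" "A = loop_homotopy Y (q x) `` {d}"
      using A by (rule pi1_carrierE)
    obtain x' where x': "lifts x d x'" using lifts_exists[OF x] d(1) by (auto simp: loops_def)
    have "x' \<in> verts X" "q x' = q x"
      using lifts_verts(2)[OF x'] lifts_path[OF x'] d(1) edge_path_end_unique
      by (auto simp: loops_def)
    then obtain g where g: "graph_map X X g" "\<forall>z\<in>gset X. q (g z) = q z" "g x = x'"
      using tr by blast
    obtain p where p: "edge_path X x p x" "map q p = c" using c(2) by (auto simp: lifts_def)
    have "edge_path X x' (map g p) x'" using edge_path_map[OF g(1) p(1)] g(3) by simp
    moreover have "map q (map g p) = c"
      using edge_path_ends(3)[OF X p(1)] g(2) p(2) by (fastforce simp: gset_def)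
    ultimately have "lifts x' c x'" unfolding lifts_def by blast
    then have "lifts x ((d @ c) @ rev_path Y d) x" using x' lifts_rev[OF x'] by (auto simp: lifts_append)
    then show ?thesis
      using pi1_image_iff append_loops[OF Y] c d rev_path_loops[OF Y d(1)]
      by (simp add: pi1_inv[OF Y d(1)] pi1_mult[OF Y])
  qed
  ultimately show ?thesis unfolding P.normal_inv_iff by simp
qed

end

section \<open>Quotients of finite graphs by free actions\<close>

lemma graph_path_connected_image:
  assumes "graph_path_connected X" "graph_map X Y f" "verts Y \<subseteq> f ` verts X"
  shows "graph_path_connected Y"
proof -
  have "gset Y \<noteq> {}" using assms(1) graph_mapD(6)[OF assms(2)] by (auto simp: graph_path_connected_def)
  moreover have "\<exists>p. edge_path Y v p w" if vw: "v \<in> verts Y" "w \<in> verts Y" for v w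
  proof -
    obtain v' w' where "v' \<in> verts X" "w' \<in> verts X" "v = f v'" "w = f w'" using vw assms(3) by blast
    then show ?thesis
      using assms(1) edge_path_map[OF assms(2)] unfolding graph_path_connected_def by blast
  qed
  ultimately show ?thesis unfolding graph_path_connected_def by blast
qed

text \<open>Freeness is relative to the kernel: elements may act trivially on the finite graph
  \<open>X\<close>, but one with a fixed point fixes everything. \<open>D_bar\<close> forbids
  inversions, which would make an edge of the quotient its own reverse.\<close>

locale free_graph_action =
  fixes G :: "('g, 'k) monoid_scheme" (structure) and X :: "nat top_graph" and D :: "'g \<Rightarrow> nat \<Rightarrow> nat"
  assumes G: "group G" and X: "is_graph X" and fin: "finite (gset X)" and conn: "graph_path_connected X"
    and D_map: "g \<in> carrier G \<Longrightarrow> graph_map X X (D g)"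
    and D_mult: "g \<in> carrier G \<Longrightarrow> h \<in> carrier G \<Longrightarrow> x \<in> gset X \<Longrightarrow> D (g \<otimes>\<^bsub>G\<^esub> h) x = D g (D h x)"
    and D_one: "x \<in> gset X \<Longrightarrow> D \<one>\<^bsub>G\<^esub> x = x"
    and D_free: "g \<in> carrier G \<Longrightarrow> x \<in> gset X \<Longrightarrow> D g x = x \<Longrightarrow> y \<in> gset X \<Longrightarrow> D g y = y"
    and D_bar: "g \<in> carrier G \<Longrightarrow> e \<in> edges X \<Longrightarrow> D g e \<noteq> bar X e"
begin

sublocale group G by (rule G)

text \<open>An orbit is represented by its least element, so that the quotient is again a graph on
  natural numbers.\<close>

definition rep :: "'g set \<Rightarrow> nat \<Rightarrow> nat" where
  "rep H x = Min ((\<lambda>h. D h x) ` H)"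

definition quot :: "'g set \<Rightarrow> nat top_graph" where
  "quot H = \<lparr>verts = rep H ` verts X, edges = rep H ` edges X,
     src = (\<lambda>e. rep H (src X e)), tgt = (\<lambda>e. rep H (tgt X e)), bar = (\<lambda>e. rep H (bar X e)),
     gtop = discrete_topology (rep H ` gset X)\<rparr>"

lemma D_inv:
  assumes "g \<in> carrier G" "x \<in> gset X"
  shows "D (inv g) (D g x) = x" "D g (D (inv g) x) = x"
  using D_mult[of "inv g" g x] D_mult[of g "inv g" x] assms D_one by auto

lemma gset_quot: "gset (quot H) = rep H ` gset X"
  by (auto simp: quot_def gset_def)

lemma subgroupD:
  assumes "subgroup H G"
  shows "h \<in> H \<Longrightarrow> h \<in> carrier G" "\<one> \<in> H" "h \<in> H \<Longrightarrow> inv h \<in> H" "h \<in> H \<Longrightarrow> k \<in> H \<Longrightarrow> h \<otimes> k \<in> H"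
  using assms subgroup.mem_carrier subgroup.one_closed subgroup.m_inv_closed subgroup.m_closed by metis+

context
  fixes H assumes H: "subgroup H G"
begin

lemmas H_simps = subgroupD[OF H]

lemma rep_orbit:
  assumes "x \<in> gset X"
  shows "\<exists>h\<in>H. rep H x = D h x"
proof -
  \<comment> \<open>\<open>H\<close> may be infinite, but its orbits lie in the finite set
    \<open>gset X\<close>, so \<open>Min\<close> is attained.\<close>
  have "(\<lambda>h. D h x) ` H \<subseteq> gset X" using graph_mapD(6)[OF D_map] H_simps(1) assms by blast
  then have "finite ((\<lambda>h. D h x) ` H)" using fin finite_subset by blast
  then have "rep H x \<in> (\<lambda>h. D h x) ` H" unfolding rep_def using H_simps(2) by (intro Min_in) auto
  then show ?thesis by auto
qed

lemma rep_D:
  assumes "x \<in> gset X" "h \<in> H"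
  shows "rep H (D h x) = rep H x"
proof -
  have "(\<lambda>k. D k (D h x)) ` H = (\<lambda>k. D k x) ` H"
  proof safe
    fix k assume k: "k \<in> H"
    have "D k (D h x) = D (k \<otimes> h) x" using D_mult assms k H_simps(1) by simp
    then show "D k (D h x) \<in> (\<lambda>k. D k x) ` H" using H_simps(4) k assms by blast
    have "D k x = D (k \<otimes> inv h) (D h x)"
      using D_mult[of "k \<otimes> inv h" h x] assms k H_simps(1) by (simp add: m_assoc)
    then show "D k x \<in> (\<lambda>k. D k (D h x)) ` H" using H_simps(3,4) k assms by blast
  qed
  then show ?thesis by (simp add: rep_def)
qed

lemma rep_eq_iff:
  assumes "x \<in> gset X" "y \<in> gset X"
  shows "rep H x = rep H y \<longleftrightarrow> (\<exists>h\<in>H. y = D h x)"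
proof
  assume eq: "rep H x = rep H y"
  obtain h k where hk: "h \<in> H" "k \<in> H" "rep H x = D h x" "rep H y = D k y"
    using rep_orbit assms by metis
  then have "D (inv k \<otimes> h) x = D (inv k) (D k y)" using D_mult eq assms H_simps(1) by simp
  then have "y = D (inv k \<otimes> h) x" using D_inv hk H_simps(1) assms by simp
  then show "\<exists>h\<in>H. y = D h x" using hk H_simps(3,4) by blast
qed (use rep_D assms in auto)

lemma rep_verts: "v \<in> verts X \<Longrightarrow> rep H v \<in> verts X"
  using rep_orbit[of v] graph_mapD(1)[OF D_map] H_simps(1) gsetI(1) by metis

lemma rep_edges: "e \<in> edges X \<Longrightarrow> rep H e \<in> edges X"
  using rep_orbit[of e] graph_mapD(2)[OF D_map] H_simps(1) gsetI(2) by metis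

lemma rep_gset: "x \<in> gset X \<Longrightarrow> rep H x \<in> gset X"
  using rep_verts rep_edges by (auto simp: gset_def)

lemma rep_rep: "x \<in> gset X \<Longrightarrow> rep H (rep H x) = rep H x"
  using rep_orbit[of x] rep_D[of x] by auto

text \<open>Edges of \<open>quot H\<close> are edges of \<open>X\<close>, so \<open>quot_def\<close>
  can feed them to the structure maps of \<open>X\<close>. Passing to the representative moves an
  edge and its ends by the same \<open>h\<close>, which the outer \<open>rep H\<close>
  absorbs.\<close>

lemma rep_ends:
  assumes "e \<in> edges X"
  shows "rep H (src X (rep H e)) = rep H (src X e)" "rep H (tgt X (rep H e)) = rep H (tgt X e)"
    "rep H (bar X (rep H e)) = rep H (bar X e)"
proof -
  obtain h where h: "h \<in> H" "rep H e = D h e" using rep_orbit gsetI(2) assms by metis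
  note m = graph_mapD[OF D_map[OF H_simps(1)[OF h(1)]]]
  show "rep H (src X (rep H e)) = rep H (src X e)" "rep H (tgt X (rep H e)) = rep H (tgt X e)"
    "rep H (bar X (rep H e)) = rep H (bar X e)"
    unfolding h(2) m(3-5)[OF assms, symmetric]
    using is_graphD(2-4)[OF X assms] h(1) by (simp_all add: rep_D gsetI)
qed

lemma is_graph_quot: "is_graph (quot H)"
proof -
  have "rep H ` verts X \<subseteq> verts X" "rep H ` edges X \<subseteq> edges X"
    using rep_verts rep_edges by blast+
  then have "verts (quot H) \<inter> edges (quot H) = {}"
    using is_graphD(1)[OF X] unfolding quot_def by auto
  moreover have "src (quot H) e \<in> verts (quot H) \<and> tgt (quot H) e \<in> verts (quot H) \<and>
      bar (quot H) e \<in> edges (quot H) \<and> bar (quot H) (bar (quot H) e) = e \<and> bar (quot H) e \<noteq> e \<and>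
      src (quot H) (bar (quot H) e) = tgt (quot H) e \<and> tgt (quot H) (bar (quot H) e) = src (quot H) e"
    if eq: "e \<in> edges (quot H)" for e
  proof -
    obtain e0 where "e0 \<in> edges X" "e = rep H e0" using eq by (auto simp: quot_def)
    then have e: "e \<in> edges X" "rep H e = e" using rep_edges rep_rep by (auto simp: gset_def)
    have be: "bar X e \<in> edges X" using is_graphD(4)[OF X e(1)] .
    have "rep H (bar X e) \<noteq> rep H e"
      using rep_eq_iff[of e "bar X e"] e be D_bar H_simps(1) gsetI(2) by metis
    then show ?thesis
      using rep_ends[OF be] is_graphD[OF X] e by (auto simp: quot_def)
  qed
  ultimately show ?thesis unfolding is_graph_def by blast
qed

lemma rep_map: "graph_map X (quot H) (rep H)"
  by (rule graph_mapI) (auto simp: quot_def rep_ends)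

lemma quot_finite_discrete: "finite_discrete_graph (quot H)"
proof -
  have "gtop (quot H) = discrete_topology (gset (quot H))" by (simp only: gset_quot) (simp add: quot_def)
  then show ?thesis
    unfolding finite_discrete_graph_def using is_graph_quot fin by (simp add: gset_quot)
qed

lemma quot_path_connected: "graph_path_connected (quot H)"
  by (rule graph_path_connected_image[OF conn rep_map]) (simp add: quot_def)

end

section \<open>Maps between quotients by nested subgroups\<close>

context
  fixes H K assumes H: "subgroup H G" and K: "subgroup K G" and HK: "H \<subseteq> K"
begin

lemma rep_rep_le: "x \<in> gset X \<Longrightarrow> rep K (rep H x) = rep K x"
  using rep_orbit[OF H, of x] rep_D[OF K, of x] HK by auto

lemma quot_le_map: "graph_map (quot H) (quot K) (rep K)"
proof (rule graph_mapI)
  fix e assume "e \<in> edges (quot H)"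
  then have e: "e \<in> edges X" using rep_edges[OF H] by (auto simp: quot_def)
  show "rep K e \<in> edges (quot K)" using e by (auto simp: quot_def)
  show "rep K (src (quot H) e) = src (quot K) (rep K e)" "rep K (tgt (quot H) e) = tgt (quot K) (rep K e)"
    "rep K (bar (quot H) e) = bar (quot K) (rep K e)"
    using e rep_ends[OF K e] rep_rep_le is_graphD(2-4)[OF X e] gsetI[of _ X] by (auto simp: quot_def)
qed (use rep_verts[OF H] in \<open>auto simp: quot_def\<close>)

text \<open>Both stars are images of the star of \<open>v\<close> in \<open>X\<close>, since an edge
  that starts in the orbit of \<open>v\<close> can be translated to start at \<open>v\<close>. If
  \<open>k\<close> carries one edge of that star to another, it fixes \<open>v\<close> and so, by
  freeness, the edge.\<close>

lemma quot_locally_bijective: "locally_bijective (quot H) (quot K) (rep K)"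
  unfolding locally_bijective_def
proof (intro conjI ballI)
  fix v assume "v \<in> verts (quot H)"
  then have v: "v \<in> verts X" "rep H v = v"
    using rep_verts[OF H] rep_rep[OF H] by (auto simp: quot_def gset_def)
  have E: "{e \<in> edges (quot H). src (quot H) e = v} = rep H ` {e \<in> edges X. src X e = v}"
  proof safe
    fix e assume "e \<in> edges (quot H)" and s: "v = src (quot H) e"
    then obtain e0 where "e0 \<in> edges X" "e = rep H e0" by (auto simp: quot_def)
    then have e: "e \<in> edges X" "rep H e = e" using rep_edges[OF H] rep_rep[OF H] by (auto simp: gset_def)
    have "rep H (src X e) = rep H v" using s v by (simp add: quot_def)
    then obtain h where h: "h \<in> H" "v = D h (src X e)"
      using rep_eq_iff[OF H] v(1) is_graphD(2)[OF X e(1)] gsetI(1) by metis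
    note m = graph_mapD[OF D_map[OF subgroupD(1)[OF H h(1)]]]
    have "D h e \<in> {e \<in> edges X. src X e = v}" using m(2,3)[OF e(1)] h by auto
    moreover have "e = rep H (D h e)" using rep_D[OF H gsetI(2) h(1)] e by simp
    ultimately have "e \<in> rep H ` {e \<in> edges X. src X e = v}" by (rule rev_image_eqI)
    then show "e \<in> rep H ` {e' \<in> edges X. src X e' = src (quot H) e}" using s by simp
  qed (use v in \<open>auto simp: quot_def rep_ends[OF H]\<close>)
  have F: "{e' \<in> edges (quot K). src (quot K) e' = rep K v} = rep K ` {e \<in> edges X. src X e = v}"
  proof safe
    fix e assume "e \<in> edges (quot K)" and s: "src (quot K) e = rep K v"
    then obtain e0 where "e0 \<in> edges X" "e = rep K e0" by (auto simp: quot_def)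
    then have e: "e \<in> edges X" "rep K e = e" using rep_edges[OF K] rep_rep[OF K] by (auto simp: gset_def)
    have "rep K (src X e) = rep K v" using s v by (simp add: quot_def)
    then obtain h where h: "h \<in> K" "v = D h (src X e)"
      using rep_eq_iff[OF K] v(1) is_graphD(2)[OF X e(1)] gsetI(1) by metis
    note m = graph_mapD[OF D_map[OF subgroupD(1)[OF K h(1)]]]
    have "D h e \<in> {e \<in> edges X. src X e = v}" using m(2,3)[OF e(1)] h by auto
    moreover have "e = rep K (D h e)" using rep_D[OF K gsetI(2) h(1)] e by simp
    ultimately show "e \<in> rep K ` {e \<in> edges X. src X e = v}" by blast
  qed (auto simp: quot_def rep_ends[OF K])
  have "inj_on (rep K) {e \<in> edges X. src X e = v}"
  proof (rule inj_onI; clarify)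
    fix e e' assume e: "e \<in> edges X" "e' \<in> edges X" "src X e' = src X e" "rep K e = rep K e'"
    then obtain k where k: "k \<in> K" "e' = D k e" using rep_eq_iff[OF K] gsetI(2) by metis
    have kG: "k \<in> carrier G" using subgroupD(1)[OF K k(1)] .
    have "D k (src X e) = src X e" using graph_mapD(3)[OF D_map[OF kG] e(1)] k e(3) by simp
    then show "e = e'"
      using D_free[OF kG gsetI(1) _ gsetI(2)[OF e(1)]] is_graphD(2)[OF X e(1)] k by simp
  qed
  \<comment> \<open>\<open>rep K\<close> factors through \<open>rep H\<close>, so injectivity on the
    star in \<open>X\<close> passes to the star in \<open>quot H\<close>.\<close>
  then have "inj_on (\<lambda>e. rep K (rep H e)) {e \<in> edges X. src X e = v}"
    by (rule subst[OF inj_on_cong, rotated]) (simp add: rep_rep_le gsetI(2))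
  then have "inj_on (rep K) (rep H ` {e \<in> edges X. src X e = v})"
    by (auto simp: inj_on_def)
  moreover have "rep K ` rep H ` {e \<in> edges X. src X e = v} = rep K ` {e \<in> edges X. src X e = v}"
    unfolding image_image by (rule image_cong) (auto simp: rep_rep_le gsetI(2))
  ultimately show "bij_betw (rep K) {e \<in> edges (quot H). src (quot H) e = v}
      {e' \<in> edges (quot K). src (quot K) e' = rep K v}"
    unfolding E F by (simp add: bij_betw_def)
qed (rule quot_le_map)

text \<open>An element of \<open>K\<close> acts on \<open>H\<close>-orbits because it normalizes
  \<open>H\<close>, and the induced maps already reach every vertex of \<open>quot H\<close> in a
  given fiber over \<open>quot K\<close>. So \<open>normal_of_transitive\<close> applies.\<close>

lemma quot_regular:
  assumes N: "\<And>k h. k \<in> K \<Longrightarrow> h \<in> H \<Longrightarrow> k \<otimes> h \<otimes> inv k \<in> H"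
  shows "finite_regular_covering (quot H) (quot K) (rep K)"
proof -
  interpret C: graph_covering "quot H" "quot K" "rep K"
    by unfold_locales (rule is_graph_quot[OF H] is_graph_quot[OF K] quot_locally_bijective)+
  obtain e where "e \<in> gset X" using conn by (auto simp: graph_path_connected_def)
  then have "verts X \<noteq> {}" using is_graphD(2)[OF X] by (auto simp: gset_def)
  then obtain x where x: "x \<in> verts (quot H)" by (auto simp: quot_def)
  have DH: "rep H (D k (rep H y)) = rep H (D k y)" if k: "k \<in> K" and y: "y \<in> gset X" for k y
  proof -
    obtain h where h: "h \<in> H" "rep H y = D h y" using rep_orbit[OF H y] by blast
    have kG: "k \<in> carrier G" "h \<in> carrier G" using subgroupD(1) K H k h by blast+
    \<comment> \<open>Rewriting k h as (k h k^-1) k moves the element of \<open>H\<close> to the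
      left, where \<open>rep H\<close> absorbs it.\<close>
    have "D k (D h y) = D (k \<otimes> h \<otimes> inv k) (D k y)"
      using D_mult[of "k \<otimes> h \<otimes> inv k" k y] D_mult[of k h y] kG y by (simp add: m_assoc)
    then show ?thesis
      using h rep_D[OF H graph_mapD(6)[OF D_map[OF kG(1)] y] N[OF k h(1)]] by simp
  qed
  have tr: "\<exists>g. graph_map (quot H) (quot H) g \<and> (\<forall>z\<in>gset (quot H). rep K (g z) = rep K z) \<and> g x = x'"
    if x': "x' \<in> verts (quot H)" "rep K x' = rep K x" for x'
  proof -
    have xx: "x \<in> gset X" "x' \<in> gset X" "rep H x' = x'"
      using x x'(1) rep_verts[OF H] rep_rep[OF H] by (auto simp: quot_def gset_def)
    obtain k where k: "k \<in> K" "x' = D k x" using rep_eq_iff[OF K xx(1,2)] x'(2) by auto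
    have kG: "k \<in> carrier G" using subgroupD(1)[OF K k(1)] .
    note m = graph_mapD[OF D_map[OF kG]]
    have "graph_map (quot H) (quot H) (\<lambda>z. rep H (D k z))"
    proof (rule graph_mapI)
      fix e assume "e \<in> edges (quot H)"
      then have e: "e \<in> edges X" using rep_edges[OF H] by (auto simp: quot_def)
      show "rep H (D k e) \<in> edges (quot H)" using m(2)[OF e] by (auto simp: quot_def)
      show "rep H (D k (src (quot H) e)) = src (quot H) (rep H (D k e))"
        "rep H (D k (tgt (quot H) e)) = tgt (quot H) (rep H (D k e))"
        "rep H (D k (bar (quot H) e)) = bar (quot H) (rep H (D k e))"
        using DH[OF k(1)] is_graphD(2-4)[OF X e] m(2-5)[OF e] rep_ends[OF H]
        by (simp_all add: quot_def gsetI)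
    qed (use m(1) rep_verts[OF H] in \<open>auto simp: quot_def\<close>)
    moreover have "rep K (rep H (D k z)) = rep K z" if "z \<in> gset (quot H)" for z
    proof -
      have "z \<in> gset X" using that rep_gset[OF H] by (auto simp: gset_quot)
      then show ?thesis using rep_rep_le m(6) rep_D[OF K _ k(1)] by simp
    qed
    ultimately show ?thesis using k xx by (intro exI[of _ "\<lambda>z. rep H (D k z)"]) auto
  qed
  have "finite (gset (quot H))" "finite (gset (quot K))" using fin by (simp_all add: gset_quot)
  then show ?thesis
    unfolding finite_regular_covering_def
    using C.normal_of_transitive[OF x tr] x C.X C.Y C.lb quot_path_connected[OF H] quot_path_connected[OF K]
    by blast
qed

end

end

section \<open>Cofinite entourages\<close>

text \<open>The kernel relation of \<open>a\<close> on \<open>S\<close>; for the coordinates of an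
  inverse limit of finite graphs these kernels are the basic entourages.\<close>

definition fiber_rel :: "'a set \<Rightarrow> ('a \<Rightarrow> 'b) \<Rightarrow> 'a rel" where
  "fiber_rel S a = {(x, y). x \<in> S \<and> y \<in> S \<and> a x = a y}"

lemma equiv_fiber_rel: "equiv S (fiber_rel S a)"
  by (auto simp: equiv_def refl_on_def sym_def trans_def fiber_rel_def)

lemma finite_quotient_fiber_rel:
  assumes "finite (a ` S)"
  shows "finite (S // fiber_rel S a)"
proof -
  have "S // fiber_rel S a \<subseteq> (\<lambda>c. {y \<in> S. a y = c}) ` (a ` S)"
  proof
    fix A assume "A \<in> S // fiber_rel S a"
    then obtain x where "x \<in> S" "A = fiber_rel S a `` {x}" by (rule quotientE)
    then have "A = {y \<in> S. a y = a x}" by (auto simp: fiber_rel_def)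
    then show "A \<in> (\<lambda>c. {y \<in> S. a y = c}) ` (a ` S)" using \<open>x \<in> S\<close> by blast
  qed
  then show ?thesis by (rule finite_subset) (use assms in simp)
qed

lemma compatible_fiber_rel:
  assumes "is_graph \<Gamma>" "is_graph X" "graph_map \<Gamma> X a"
  shows "compatible \<Gamma> (fiber_rel (gset \<Gamma>) a)"
proof -
  note m = graph_mapD[OF assms(3)] and g = is_graphD[OF assms(1)] and x = is_graphD[OF assms(2)]
  have "(v, e) \<notin> fiber_rel (gset \<Gamma>) a" if "v \<in> verts \<Gamma>" "e \<in> edges \<Gamma>" for v e
    using m(1)[OF that(1)] m(2)[OF that(2)] x(1)[of "a v"] by (auto simp: fiber_rel_def)
  moreover have "(e, bar \<Gamma> e) \<notin> fiber_rel (gset \<Gamma>) a" if "e \<in> edges \<Gamma>" for e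
    using m(2,5)[OF that] x(6)[OF m(2)[OF that]] by (auto simp: fiber_rel_def)
  moreover have "(src \<Gamma> e, src \<Gamma> e') \<in> fiber_rel (gset \<Gamma>) a \<and> (tgt \<Gamma> e, tgt \<Gamma> e') \<in> fiber_rel (gset \<Gamma>) a \<and>
      (bar \<Gamma> e, bar \<Gamma> e') \<in> fiber_rel (gset \<Gamma>) a"
    if "e \<in> edges \<Gamma>" "e' \<in> edges \<Gamma>" "(e, e') \<in> fiber_rel (gset \<Gamma>) a" for e e'
    using that g(2-4) m(3-5)[OF that(1)] m(3-5)[OF that(2)] by (simp add: fiber_rel_def gset_def)
  ultimately show ?thesis unfolding compatible_def by (simp add: equiv_fiber_rel)
qed

lemma compatible_Int:
  assumes "compatible \<Gamma> R" "compatible \<Gamma> S"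
  shows "compatible \<Gamma> (R \<inter> S)"
proof -
  have "equiv (gset \<Gamma>) (R \<inter> S)"
    using assms by (auto simp: compatible_def equiv_def refl_on_def sym_def intro: trans_Int)
  then show ?thesis using assms unfolding compatible_def by blast
qed

text \<open>\<open>quotient_graph\<close> applies a structure map to a whole class and saturates.
  The class of an edge consists of edges, and compatibility sends them all into one class, so any
  representative computes the value.\<close>

lemma quotient_graph_class:
  assumes R: "compatible \<Gamma> R" and \<Gamma>: "is_graph \<Gamma>" and e: "e \<in> edges \<Gamma>"
  shows "src (quotient_graph \<Gamma> R) (R `` {e}) = R `` {src \<Gamma> e}"
    "tgt (quotient_graph \<Gamma> R) (R `` {e}) = R `` {tgt \<Gamma> e}"
    "bar (quotient_graph \<Gamma> R) (R `` {e}) = R `` {bar \<Gamma> e}"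
proof -
  have eq: "equiv (gset \<Gamma>) R" using R by (simp add: compatible_def)
  have E: "e' \<in> edges \<Gamma>" if "(e, e') \<in> R" for e'
  proof -
    have "(e', e) \<in> R" "e' \<in> gset \<Gamma>"
      using that eq by (auto simp: equiv_def sym_def refl_on_def)
    then show ?thesis using R e unfolding compatible_def gset_def by blast
  qed
  have ee: "(e, e) \<in> R" using eq e by (auto simp: equiv_def refl_on_def gset_def)
  have "R `` (m ` (R `` {e})) = R `` {m e}" if m: "\<And>e'. (e, e') \<in> R \<Longrightarrow> (m e, m e') \<in> R" for m
  proof -
    have "R `` {m e'} = R `` {m e}" if "(e, e') \<in> R" for e'
      using equiv_class_eq[OF eq m[OF that]] by simp
    then show ?thesis using ee by blast
  qed
  then show "src (quotient_graph \<Gamma> R) (R `` {e}) = R `` {src \<Gamma> e}"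
    "tgt (quotient_graph \<Gamma> R) (R `` {e}) = R `` {tgt \<Gamma> e}"
    "bar (quotient_graph \<Gamma> R) (R `` {e}) = R `` {bar \<Gamma> e}"
    using R E e unfolding compatible_def quotient_graph_def by simp_all
qed

lemma gset_quotient_graph: "gset (quotient_graph \<Gamma> R) = gset \<Gamma> // R"
  by (auto simp: gset_def quotient_graph_def quotient_def)

lemma graph_map_quotient_graph:
  assumes "compatible \<Gamma> R" "is_graph \<Gamma>"
  shows "graph_map \<Gamma> (quotient_graph \<Gamma> R) (\<lambda>x. R `` {x})"
  by (rule graph_mapI) (auto simp: quotient_graph_class[OF assms], auto simp: quotient_graph_def quotient_def)

lemma is_graph_quotient_graph:
  assumes R: "compatible \<Gamma> R" and \<Gamma>: "is_graph \<Gamma>"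
  shows "is_graph (quotient_graph \<Gamma> R)"
proof -
  have eq: "equiv (gset \<Gamma>) R" using R by (simp add: compatible_def)
  have ceq: "R `` {x} = R `` {y} \<longleftrightarrow> (x, y) \<in> R" if "x \<in> gset \<Gamma>" "y \<in> gset \<Gamma>" for x y
    using eq_equiv_class_iff[OF eq that] .
  note m = graph_mapD[OF graph_map_quotient_graph[OF assms]]
  have "verts (quotient_graph \<Gamma> R) \<inter> edges (quotient_graph \<Gamma> R) = {}"
  proof -
    have "R `` {v} \<noteq> R `` {e}" if "v \<in> verts \<Gamma>" "e \<in> edges \<Gamma>" for v e
      using that R ceq[OF gsetI(1) gsetI(2)] by (auto simp: compatible_def)
    then show ?thesis by (auto simp: quotient_graph_def quotient_def)
  qed
  moreover have "src (quotient_graph \<Gamma> R) A \<in> verts (quotient_graph \<Gamma> R) \<and>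
      tgt (quotient_graph \<Gamma> R) A \<in> verts (quotient_graph \<Gamma> R) \<and>
      bar (quotient_graph \<Gamma> R) A \<in> edges (quotient_graph \<Gamma> R) \<and>
      bar (quotient_graph \<Gamma> R) (bar (quotient_graph \<Gamma> R) A) = A \<and> bar (quotient_graph \<Gamma> R) A \<noteq> A \<and>
      src (quotient_graph \<Gamma> R) (bar (quotient_graph \<Gamma> R) A) = tgt (quotient_graph \<Gamma> R) A \<and>
      tgt (quotient_graph \<Gamma> R) (bar (quotient_graph \<Gamma> R) A) = src (quotient_graph \<Gamma> R) A"
    if A: "A \<in> edges (quotient_graph \<Gamma> R)" for A
  proof -
    obtain e where e: "e \<in> edges \<Gamma>" "A = R `` {e}" using A by (auto simp: quotient_graph_def quotient_def)
    note be = is_graphD(4)[OF \<Gamma> e(1)]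
    have "R `` {bar \<Gamma> e} \<noteq> R `` {e}"
      using ceq[OF gsetI(2)[OF e(1)] gsetI(2)[OF be]] R e(1) by (auto simp: compatible_def)
    then show ?thesis
      unfolding e(2) quotient_graph_class[OF assms e(1)] quotient_graph_class[OF assms be]
        is_graphD(5,7,8)[OF \<Gamma> e(1)]
      using m(1,2) is_graphD(2-4)[OF \<Gamma> e(1)] by simp
  qed
  ultimately show ?thesis unfolding is_graph_def by blast
qed

lemma profinite_graphD:
  assumes "profinite_graph \<Gamma>"
  shows "is_graph \<Gamma>" "compact_space (gtop \<Gamma>)" "Hausdorff_space (gtop \<Gamma>)"
    "topspace (gtop \<Gamma>) = gset \<Gamma>" "uniformity_on (gset \<Gamma>) (entourages \<Gamma>)"
proof -
  note c = profinite_graph_entourages[OF assms]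
  show "is_graph \<Gamma>" "compact_space (gtop \<Gamma>)" "Hausdorff_space (gtop \<Gamma>)"
    "uniformity_on (gset \<Gamma>) (entourages \<Gamma>)"
    using c assms by (auto simp: cofinite_graph_def profinite_graph_def)
  then show "topspace (gtop \<Gamma>) = gset \<Gamma>" using topspace_uniform_topology c(2) by metis
qed

text \<open>In a compact space the entourages are exactly the neighbourhoods of the diagonal
  (\<open>compact_uniformity\<close>), and the kernel of a continuous map to a finite discrete graph
  is a union of open squares that cover the diagonal.\<close>

lemma fiber_rel_cofinite_entourage:
  assumes \<Gamma>: "profinite_graph \<Gamma>" and X: "finite_discrete_graph X" and a: "cont_graph_map \<Gamma> X a"
  shows "fiber_rel (gset \<Gamma>) a \<in> cofinite_entourages \<Gamma>"
proof -
  note p = profinite_graphD[OF \<Gamma>] profinite_graph_entourages[OF \<Gamma>]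
  have am: "graph_map \<Gamma> X a" and ac: "continuous_map (gtop \<Gamma>) (discrete_topology (gset X)) a"
    using a X by (auto simp: cont_graph_map_def finite_discrete_graph_def)
  let ?U = "\<lambda>c. {x \<in> gset \<Gamma>. a x \<in> {c}}"
  have "openin (gtop \<Gamma>) (?U c)" if "c \<in> gset X" for c
    using openin_continuous_map_preimage[OF ac, of "{c}"] that p(4) by simp
  then have "openin (prod_topology (gtop \<Gamma>) (gtop \<Gamma>)) (\<Union>c\<in>gset X. ?U c \<times> ?U c)"
    by (intro openin_Union) (auto simp: openin_prod_Times_iff)
  moreover have "(\<Union>c\<in>gset X. ?U c \<times> ?U c) = fiber_rel (gset \<Gamma>) a"
    using graph_mapD(6)[OF am] by (auto simp: fiber_rel_def)
  ultimately have "openin (prod_topology (gtop \<Gamma>) (gtop \<Gamma>)) (fiber_rel (gset \<Gamma>) a)" by simp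
  moreover have "Id_on (gset \<Gamma>) \<subseteq> fiber_rel (gset \<Gamma>) a" "fiber_rel (gset \<Gamma>) a \<subseteq> gset \<Gamma> \<times> gset \<Gamma>"
    by (auto simp: fiber_rel_def)
  moreover have "compact_space (uniform_topology (gset \<Gamma>) (entourages \<Gamma>))" using p(2,7) by simp
  ultimately have "fiber_rel (gset \<Gamma>) a \<in> entourages \<Gamma>"
    using compact_uniformity[OF p(5)] p(7) by auto
  moreover have "finite (a ` gset \<Gamma>)"
    by (rule finite_subset[of _ "gset X"]) (use graph_mapD(6)[OF am] X in \<open>auto simp: finite_discrete_graph_def\<close>)
  ultimately show ?thesis
    using finite_quotient_fiber_rel[of a "gset \<Gamma>"] compatible_fiber_rel[OF p(1) _ am] X
    by (simp add: finite_discrete_graph_def cofinite_entourages_def)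
qed

lemma cofinite_entourages_Int:
  assumes \<Gamma>: "profinite_graph \<Gamma>" and R: "R \<in> cofinite_entourages \<Gamma>" and S: "S \<in> cofinite_entourages \<Gamma>"
  shows "R \<inter> S \<in> cofinite_entourages \<Gamma>"
proof -
  have "R \<inter> S \<in> entourages \<Gamma>"
    using profinite_graphD(5)[OF \<Gamma>] R S by (simp add: uniformity_on_def cofinite_entourages_def)
  moreover have "gset \<Gamma> // (R \<inter> S) \<subseteq> (\<lambda>(A, B). A \<inter> B) ` ((gset \<Gamma> // R) \<times> (gset \<Gamma> // S))"
  proof
    fix A assume "A \<in> gset \<Gamma> // (R \<inter> S)"
    then obtain x where x: "x \<in> gset \<Gamma>" "A = (R \<inter> S) `` {x}" by (rule quotientE)
    then have "A = (\<lambda>(A, B). A \<inter> B) (R `` {x}, S `` {x})" by auto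
    moreover have "(R `` {x}, S `` {x}) \<in> (gset \<Gamma> // R) \<times> (gset \<Gamma> // S)"
      using x(1) by (simp add: quotientI)
    ultimately show "A \<in> (\<lambda>(A, B). A \<inter> B) ` ((gset \<Gamma> // R) \<times> (gset \<Gamma> // S))" by (rule image_eqI)
  qed
  then have "finite (gset \<Gamma> // (R \<inter> S))"
    by (rule finite_subset) (use R S in \<open>simp add: cofinite_entourages_def\<close>)
  ultimately show ?thesis
    using R S compatible_Int by (auto simp: cofinite_entourages_def)
qed

text \<open>Connectedness of a profinite graph is path connectedness of its finite quotients, so it
  supports induction along edges for properties that factor through such a quotient.\<close>

lemma connected_profinite_induct:
  assumes \<Gamma>: "connected_profinite_graph \<Gamma>" and R: "R \<in> cofinite_entourages \<Gamma>"
    and inv: "\<And>v w. v \<in> verts \<Gamma> \<Longrightarrow> w \<in> verts \<Gamma> \<Longrightarrow> (v, w) \<in> R \<Longrightarrow> P v \<Longrightarrow> P w"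
    and step: "\<And>e. e \<in> edges \<Gamma> \<Longrightarrow> P (src \<Gamma> e) \<Longrightarrow> P (tgt \<Gamma> e)"
    and v: "v \<in> verts \<Gamma>" "P v" and w: "w \<in> verts \<Gamma>"
  shows "P w"
proof -
  have g: "is_graph \<Gamma>" using \<Gamma> profinite_graphD(1) by (auto simp: connected_profinite_graph_def)
  have Rc: "compatible \<Gamma> R" using R by (simp add: cofinite_entourages_def)
  then have eq: "equiv (gset \<Gamma>) R" by (simp add: compatible_def)
  note c = quotient_graph_class[OF Rc g] and m = graph_mapD[OF graph_map_quotient_graph[OF Rc g]]
  have path: "P w" if "edge_path (quotient_graph \<Gamma> R) (R `` {v}) p (R `` {w})" "v \<in> verts \<Gamma>" "P v" for v p
    using that
  proof (induction p arbitrary: v)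
    case Nil
    then have "(v, w) \<in> R" using eq_equiv_class_iff[OF eq gsetI(1) gsetI(1)] w by auto
    then show ?case using inv Nil w by blast
  next
    case (Cons A p)
    then obtain e where e: "e \<in> edges \<Gamma>" "A = R `` {e}" by (auto simp: quotient_graph_def quotient_def)
    \<comment> \<open>The chosen edge starts at a vertex equivalent to \<open>v\<close>, possibly
      not at \<open>v\<close>; \<open>inv\<close> transfers \<open>P\<close> there before
      \<open>step\<close> crosses the edge.\<close>
    have "R `` {src \<Gamma> e} = R `` {v}" using Cons.prems e c(1) by simp
    then have "(v, src \<Gamma> e) \<in> R"
      using eq_equiv_class_iff[OF eq gsetI(1)[OF Cons.prems(2)] gsetI(1)[OF is_graphD(2)[OF g e(1)]]] by simp
    then have "P (tgt \<Gamma> e)" using inv[OF Cons.prems(2) is_graphD(2)[OF g e(1)]] step[OF e(1)] Cons.prems(3) by blast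
    then show ?case using Cons.IH[of "tgt \<Gamma> e"] Cons.prems(1) e c(2) is_graphD(3)[OF g] by simp
  qed
  have "graph_path_connected (quotient_graph \<Gamma> R)" using \<Gamma> R by (simp add: connected_profinite_graph_def)
  then show ?thesis using m(1) v w path unfolding graph_path_connected_def by blast
qed

text \<open>A uniformity is nonempty, so there is a cofinite entourage, and the path connected
  quotient by it is nonempty.\<close>

lemma connected_profinite_vertex:
  assumes "connected_profinite_graph \<Gamma>"
  shows "verts \<Gamma> \<noteq> {}"
proof -
  have p: "profinite_graph \<Gamma>" using assms by (simp add: connected_profinite_graph_def)
  note c = profinite_graph_entourages(1)[OF p] and g = profinite_graphD[OF p]
  obtain W where "W \<in> entourages \<Gamma>" using g(5) by (auto simp: uniformity_on_def)
  then obtain R where "R \<in> cofinite_entourages \<Gamma>"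
    using c unfolding cofinite_graph_def cofinite_entourages_def by blast
  then have "gset (quotient_graph \<Gamma> R) \<noteq> {}"
    using assms by (simp add: connected_profinite_graph_def graph_path_connected_def)
  then have "gset \<Gamma> \<noteq> {}" by (auto simp: gset_quotient_graph)
  then show ?thesis using is_graphD(2)[OF g(1)] by (auto simp: gset_def)
qed

text \<open>The composite of \<open>q\<close> with the projection to
  \<open>quotient_graph Z R\<close> has a cofinite entourage of \<Gamma> as its kernel, so
  reachability in that quotient can be propagated along the edges of \<Gamma>.\<close>

lemma connected_profinite_image:
  assumes \<Gamma>: "connected_profinite_graph \<Gamma>" and Z: "profinite_graph Z"
    and q: "cont_graph_map \<Gamma> Z q" and surj: "verts Z \<subseteq> q ` verts \<Gamma>"
  shows "connected_profinite_graph Z"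
  unfolding connected_profinite_graph_def
proof (intro conjI ballI Z)
  fix R assume R: "R \<in> cofinite_entourages Z"
  note z = profinite_graphD[OF Z] profinite_graph_entourages[OF Z]
  have \<Gamma>p: "profinite_graph \<Gamma>" using \<Gamma> by (simp add: connected_profinite_graph_def)
  have Rc: "compatible Z R" and Re: "R \<in> entourages Z" and Rf: "finite (gset Z // R)"
    using R by (simp_all add: cofinite_entourages_def)
  have eq: "equiv (gset Z) R" using Rc by (simp add: compatible_def)
  let ?Q = "quotient_graph Z R"
  \<comment> \<open>The finite quotient is given the discrete topology so that it counts as a finite
    discrete graph and \<open>fiber_rel_cofinite_entourage\<close> applies.\<close>
  define Q where "Q = graph.extend ?Q \<lparr>gtop = discrete_topology (gset ?Q)\<rparr>"
  have Qs: "verts Q = verts ?Q" "edges Q = edges ?Q" "src Q = src ?Q" "tgt Q = tgt ?Q" "bar Q = bar ?Q"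
    "gtop Q = discrete_topology (gset ?Q)" "gset Q = gset ?Q"
    by (simp_all add: Q_def graph.defs gset_def)
  have Qf: "finite_discrete_graph Q"
    using is_graph_quotient_graph[OF Rc z(1)] Rf
    by (simp add: finite_discrete_graph_def Qs is_graph_def gset_quotient_graph)
  have m: "graph_map \<Gamma> ?Q (\<lambda>x. R `` {q x})"
    by (rule graph_map_comp[OF _ graph_map_quotient_graph[OF Rc z(1)]])
      (use q in \<open>simp add: cont_graph_map_def\<close>)
  have "continuous_map (gtop Z) (gtop Q) (\<lambda>x. R `` {x})"
    unfolding continuous_map_def
  proof (intro conjI allI impI)
    show "(\<lambda>x. R `` {x}) \<in> topspace (gtop Z) \<rightarrow> topspace (gtop Q)"
      by (auto simp: Qs z(4) gset_quotient_graph quotientI)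
    fix U
    have "openin (uniform_topology (gset Z) (entourages Z)) {x \<in> topspace (gtop Z). R `` {x} \<in> U}"
      unfolding openin_uniform_topology[OF z(5)]
    proof (intro conjI ballI)
      fix x assume "x \<in> {x \<in> topspace (gtop Z). R `` {x} \<in> U}"
      then have "R `` {x} \<subseteq> {x \<in> topspace (gtop Z). R `` {x} \<in> U}"
        using equiv_class_eq[OF eq] z(4) eq by (auto simp: equiv_def refl_on_def)
      then show "\<exists>W\<in>entourages Z. W `` {x} \<subseteq> {x \<in> topspace (gtop Z). R `` {x} \<in> U}" using Re by blast
    qed (simp add: z(4))
    then show "openin (gtop Z) {x \<in> topspace (gtop Z). R `` {x} \<in> U}" using z(7) by simp
  qed
  then have "continuous_map (gtop \<Gamma>) (gtop Q) (\<lambda>x. R `` {q x})"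
    using q continuous_map_compose[of "gtop \<Gamma>" "gtop Z" q "gtop Q" "\<lambda>x. R `` {x}"] by (simp add: cont_graph_map_def o_def)
  then have "cont_graph_map \<Gamma> Q (\<lambda>x. R `` {q x})"
    using m by (simp add: cont_graph_map_def graph_map_def Qs)
  then have F: "fiber_rel (gset \<Gamma>) (\<lambda>x. R `` {q x}) \<in> cofinite_entourages \<Gamma>"
    by (rule fiber_rel_cofinite_entourage[OF \<Gamma>p Qf])
  note m' = graph_mapD[OF m]
  have "\<exists>p. edge_path ?Q v p w" if vw: "v \<in> verts ?Q" "w \<in> verts ?Q" for v w
  proof -
    obtain v0 where v0: "v0 \<in> verts \<Gamma>" "v = R `` {q v0}"
      using vw(1) surj by (auto simp: quotient_graph_def quotient_def)
    obtain w0 where w0: "w0 \<in> verts \<Gamma>" "w = R `` {q w0}"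
      using vw(2) surj by (auto simp: quotient_graph_def quotient_def)
    have "\<exists>p. edge_path ?Q v p (R `` {q w0})"
    proof (rule connected_profinite_induct[OF \<Gamma> F _ _ v0(1) _ w0(1)])
      fix e assume e: "e \<in> edges \<Gamma>" "\<exists>p. edge_path ?Q v p (R `` {q (src \<Gamma> e)})"
      then obtain p where "edge_path ?Q v p (R `` {q (src \<Gamma> e)})" by blast
      moreover have "edge_path ?Q (R `` {q (src \<Gamma> e)}) [R `` {q e}] (R `` {q (tgt \<Gamma> e)})"
        using m'(2-4)[OF e(1)] m'(1)[OF is_graphD(3)[OF profinite_graphD(1)[OF \<Gamma>p] e(1)]] by simp
      ultimately show "\<exists>p. edge_path ?Q v p (R `` {q (tgt \<Gamma> e)})"
        using edge_path_append[OF is_graph_quotient_graph[OF Rc z(1)]] by blast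
    next
      show "\<exists>p. edge_path ?Q v p (R `` {q v0})" using vw(1) v0 by (intro exI[of _ "[]"]) simp
    qed (simp add: fiber_rel_def)
    then show ?thesis using w0 by simp
  qed
  moreover have "gset ?Q \<noteq> {}"
    using connected_profinite_vertex[OF \<Gamma>] m'(6) gsetI(1) by (metis ex_in_conv)
  ultimately show "graph_path_connected ?Q" unfolding graph_path_connected_def by blast
qed

section \<open>Inverse limits\<close>

text \<open>Directedness supplies the finite intersection property: below finitely many members lies
  a single one, which is nonempty.\<close>

lemma compact_directed_Inter:
  assumes "compact_space T" "I \<noteq> {}"
    and C: "\<And>i. i \<in> I \<Longrightarrow> closedin T (C i)" "\<And>i. i \<in> I \<Longrightarrow> C i \<noteq> {}"
    and dir: "\<And>i j. i \<in> I \<Longrightarrow> j \<in> I \<Longrightarrow> \<exists>k\<in>I. C k \<subseteq> C i \<inter> C j"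
  shows "(\<Inter>i\<in>I. C i) \<noteq> {}"
proof -
  have below: "\<exists>k\<in>I. C k \<subseteq> \<Inter>(C ` F)" if "finite F" "F \<subseteq> I" for F
    using that
  proof (induction F)
    case (insert i F)
    then obtain k where k: "k \<in> I" "C k \<subseteq> \<Inter>(C ` F)" by blast
    obtain l where "l \<in> I" "C l \<subseteq> C i \<inter> C k" using dir[of i k] insert.prems k(1) by blast
    then show ?case using k(2) by (intro bexI[of _ l]) auto
  qed (use \<open>I \<noteq> {}\<close> in auto)
  have "\<Inter>\<F> \<noteq> {}" if \<F>: "finite \<F>" "\<F> \<subseteq> C ` I" for \<F>
  proof -
    obtain F where "F \<subseteq> I" "finite F" "\<F> = C ` F" using finite_subset_image[OF \<F>] by blast
    then show ?thesis using below C(2) by (metis subset_empty)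
  qed
  moreover have "\<forall>D\<in>C ` I. closedin T D" using C(1) by blast
  ultimately show ?thesis using assms(1)[unfolded compact_space_fip, rule_format, of "C ` I"] by simp
qed

text \<open>The families that are coherent below a fixed index \<open>j\<close> form a closed
  nonempty subset of a compact product, and these subsets shrink as \<open>j\<close> grows; a point
  common to all of them is a thread.\<close>

lemma threads_nonempty:
  assumes dir: "directed_set I prec"
    and S: "\<And>i. i \<in> I \<Longrightarrow> finite (S i)" "\<And>i. i \<in> I \<Longrightarrow> S i \<noteq> {}"
    and \<phi>: "\<And>i j x. i \<in> I \<Longrightarrow> j \<in> I \<Longrightarrow> prec i j \<Longrightarrow> x \<in> S j \<Longrightarrow> \<phi> i j x \<in> S i"
    and \<phi>_comp: "\<And>i j k x. i \<in> I \<Longrightarrow> j \<in> I \<Longrightarrow> k \<in> I \<Longrightarrow> prec i j \<Longrightarrow> prec j k \<Longrightarrow> x \<in> S k \<Longrightarrow>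
      \<phi> i j (\<phi> j k x) = \<phi> i k x"
    and \<phi>_id: "\<And>i x. i \<in> I \<Longrightarrow> x \<in> S i \<Longrightarrow> \<phi> i i x = x"
  shows "threads I prec S \<phi> \<noteq> {}"
proof -
  note d = dir[unfolded directed_set_def]
  let ?T = "product_topology (\<lambda>i. discrete_topology (S i)) I"
  let ?C = "\<lambda>j. {x \<in> Pi\<^sub>E I S. \<forall>i\<in>I. prec i j \<longrightarrow> \<phi> i j (x j) = x i}"
  have "compact_space ?T"
    unfolding compact_space_product_topology using S(1) by (simp add: compact_space_discrete_topology)
  moreover have "I \<noteq> {}" using d by simp
  moreover have "closedin ?T (?C j)" if j: "j \<in> I" for j
  proof -
    have "closedin ?T {x \<in> topspace ?T. \<phi> i j (x j) = x i}" if i: "i \<in> I" "prec i j" for i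
    proof (rule closedin_continuous_maps_eq)
      show "Hausdorff_space (discrete_topology (S i))" by simp
      show "continuous_map ?T (discrete_topology (S i)) (\<lambda>x. x i)"
        by (rule continuous_map_product_projection[OF i(1)])
      have "continuous_map (discrete_topology (S j)) (discrete_topology (S i)) (\<phi> i j)"
        using \<phi>[OF i(1) j i(2)] by auto
      then show "continuous_map ?T (discrete_topology (S i)) (\<lambda>x. \<phi> i j (x j))"
        using continuous_map_compose[OF continuous_map_product_projection[OF j, of "\<lambda>i. discrete_topology (S i)"]]
        unfolding o_def by blast
    qed
    moreover have ne: "{i \<in> I. prec i j} \<noteq> {}" using d j by blast
    ultimately have "closedin ?T (\<Inter>i\<in>{i \<in> I. prec i j}. {x \<in> topspace ?T. \<phi> i j (x j) = x i})"
      by (intro closedin_INT) simp_all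
    also have "(\<Inter>i\<in>{i \<in> I. prec i j}. {x \<in> topspace ?T. \<phi> i j (x j) = x i}) = ?C j"
      using ne by auto
    finally show ?thesis .
  qed
  moreover have "?C j \<noteq> {}" if j: "j \<in> I" for j
  proof -
    obtain y where y: "y \<in> S j" using S(2)[OF j] by blast
    \<comment> \<open>One point \<open>y\<close> at index \<open>j\<close> determines all
      coordinates below \<open>j\<close>; the remaining ones are arbitrary.\<close>
    let ?x = "\<lambda>i\<in>I. if prec i j then \<phi> i j y else (SOME z. z \<in> S i)"
    have "?x \<in> Pi\<^sub>E I S" using \<phi>[OF _ j _ y] S(2) by (auto simp: some_in_eq)
    moreover have "prec j j" using d j by blast
    ultimately have "?x \<in> ?C j" using \<phi>_id[OF j y] j by auto
    then show ?thesis by blast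
  qed
  moreover have "\<exists>k\<in>I. ?C k \<subseteq> ?C i \<inter> ?C j" if ij: "i \<in> I" "j \<in> I" for i j
  proof -
    obtain k where k: "k \<in> I" "prec i k" "prec j k" using d ij by blast
    have "?C k \<subseteq> ?C l" if l: "l \<in> I" "prec l k" for l
    proof
      fix x assume x: "x \<in> ?C k"
      have "\<phi> i l (x l) = x i" if i: "i \<in> I" "prec i l" for i
      proof -
        have "prec i k" using d i l k(1) by blast
        then have "x i = \<phi> i k (x k)" "x l = \<phi> l k (x k)" using x l i by auto
        then show ?thesis using \<phi>_comp[OF i(1) l(1) k(1) i(2) l(2)] x k(1) by auto
      qed
      then show "x \<in> ?C l" using x by blast
    qed
    then show ?thesis using k ij by (intro bexI[of _ k]) blast+
  qed
  ultimately have "(\<Inter>j\<in>I. ?C j) \<noteq> {}" by (rule compact_directed_Inter)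
  then obtain x where "x \<in> (\<Inter>j\<in>I. ?C j)" by blast
  then have "x \<in> threads I prec S \<phi>" using \<open>I \<noteq> {}\<close> by (auto simp: threads_def)
  then show ?thesis by blast
qed

section \<open>Recognizing profinite graphs and inverse limits\<close>

text \<open>A criterion for being profinite in terms of maps to finite discrete graphs. Directedness
  is asked of the kernels rather than of an order on \<open>I\<close>, and the Hausdorff property
  follows from separation.\<close>

locale separating_family =
  fixes \<Gamma> :: "'a top_graph" and I :: "'i set" and X :: "'i \<Rightarrow> 'c top_graph" and a :: "'i \<Rightarrow> 'a \<Rightarrow> 'c"
  assumes graph: "is_graph \<Gamma>" and topspace: "topspace (gtop \<Gamma>) = gset \<Gamma>"
    and compact: "compact_space (gtop \<Gamma>)" and I_nonempty: "I \<noteq> {}"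
    and X: "i \<in> I \<Longrightarrow> finite_discrete_graph (X i)"
    and a: "i \<in> I \<Longrightarrow> cont_graph_map \<Gamma> (X i) (a i)"
    and directed: "i \<in> I \<Longrightarrow> j \<in> I \<Longrightarrow>
      \<exists>k\<in>I. fiber_rel (gset \<Gamma>) (a k) \<subseteq> fiber_rel (gset \<Gamma>) (a i) \<inter> fiber_rel (gset \<Gamma>) (a j)"
    and separating: "x \<in> gset \<Gamma> \<Longrightarrow> y \<in> gset \<Gamma> \<Longrightarrow> (\<And>i. i \<in> I \<Longrightarrow> a i x = a i y) \<Longrightarrow> x = y"
begin

definition fiber_uniformity :: "'a rel set" where
  "fiber_uniformity = {W. W \<subseteq> gset \<Gamma> \<times> gset \<Gamma> \<and> (\<exists>i\<in>I. fiber_rel (gset \<Gamma>) (a i) \<subseteq> W)}"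

lemma fiber_rel_in: "i \<in> I \<Longrightarrow> fiber_rel (gset \<Gamma>) (a i) \<in> fiber_uniformity"
  by (auto simp: fiber_uniformity_def fiber_rel_def)

lemma a_map: "i \<in> I \<Longrightarrow> graph_map \<Gamma> (X i) (a i)"
  using a by (simp add: cont_graph_map_def)

lemma uniformity: "uniformity_on (gset \<Gamma>) fiber_uniformity"
proof -
  let ?F = "\<lambda>i. fiber_rel (gset \<Gamma>) (a i)"
  have sub: "Id_on (gset \<Gamma>) \<subseteq> ?F i" "?F i O ?F i \<subseteq> ?F i" "(?F i)\<inverse> = ?F i" "?F i \<subseteq> gset \<Gamma> \<times> gset \<Gamma>" for i
    by (auto simp: fiber_rel_def)
  show ?thesis
    unfolding uniformity_on_def
  proof (intro conjI ballI allI impI)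
    show "fiber_uniformity \<noteq> {}" using fiber_rel_in I_nonempty by blast
    fix W assume W: "W \<in> fiber_uniformity"
    then obtain i where i: "i \<in> I" "?F i \<subseteq> W" "W \<subseteq> gset \<Gamma> \<times> gset \<Gamma>" by (auto simp: fiber_uniformity_def)
    show "Id_on (gset \<Gamma>) \<subseteq> W" using sub(1)[of i] i(2) by (rule subset_trans)
    show "W \<subseteq> gset \<Gamma> \<times> gset \<Gamma>" by (rule i(3))
    have "(?F i)\<inverse> \<subseteq> W\<inverse>" using i(2) by (simp only: converse_mono)
    then have "?F i \<subseteq> W\<inverse>" by (simp only: sub(3))
    moreover have "W\<inverse> \<subseteq> gset \<Gamma> \<times> gset \<Gamma>" using i(3) by auto
    ultimately show "W\<inverse> \<in> fiber_uniformity" using i(1) by (auto simp: fiber_uniformity_def)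
    show "\<exists>W'\<in>fiber_uniformity. W' O W' \<subseteq> W"
      using fiber_rel_in[OF i(1)] subset_trans[OF sub(2) i(2)] by blast
    { fix W' assume "W \<subseteq> W' \<and> W' \<subseteq> gset \<Gamma> \<times> gset \<Gamma>"
      then show "W' \<in> fiber_uniformity" using i unfolding fiber_uniformity_def by blast }
    fix W' assume "W' \<in> fiber_uniformity"
    then obtain j where j: "j \<in> I" "?F j \<subseteq> W'" by (auto simp: fiber_uniformity_def)
    obtain k where k: "k \<in> I" "?F k \<subseteq> ?F i \<inter> ?F j" using directed[OF i(1) j(1)] by blast
    then have "?F k \<subseteq> W \<inter> W'" using i(2) j(2) by blast
    moreover have "W \<inter> W' \<subseteq> gset \<Gamma> \<times> gset \<Gamma>" using i(3) by blast
    ultimately show "W \<inter> W' \<in> fiber_uniformity" using k(1) unfolding fiber_uniformity_def by blast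
  qed
qed

lemma fiber_clopen:
  assumes i: "i \<in> I" and x: "x \<in> gset \<Gamma>"
  shows "openin (gtop \<Gamma>) {y \<in> gset \<Gamma>. a i y = a i x}" "closedin (gtop \<Gamma>) {y \<in> gset \<Gamma>. a i y = a i x}"
proof -
  have c: "continuous_map (gtop \<Gamma>) (discrete_topology (gset (X i))) (a i)"
    using a[OF i] X[OF i] by (simp add: cont_graph_map_def finite_discrete_graph_def)
  have m: "a i x \<in> gset (X i)" using graph_mapD(6)[OF a_map[OF i] x] .
  show "openin (gtop \<Gamma>) {y \<in> gset \<Gamma>. a i y = a i x}"
    using openin_continuous_map_preimage[OF c, of "{a i x}"] m topspace by simp
  show "closedin (gtop \<Gamma>) {y \<in> gset \<Gamma>. a i y = a i x}"
    using closedin_continuous_map_preimage[OF c, of "{a i x}"] m topspace by simp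
qed

lemma uniform_topology: "uniform_topology (gset \<Gamma>) fiber_uniformity = gtop \<Gamma>"
  unfolding topology_eq openin_uniform_topology[OF uniformity]
proof (intro allI iffI)
  fix S assume S: "S \<subseteq> gset \<Gamma> \<and> (\<forall>x\<in>S. \<exists>W\<in>fiber_uniformity. W `` {x} \<subseteq> S)"
  have "\<exists>U. openin (gtop \<Gamma>) U \<and> x \<in> U \<and> U \<subseteq> S" if x: "x \<in> S" for x
  proof -
    obtain i where i: "i \<in> I" "fiber_rel (gset \<Gamma>) (a i) `` {x} \<subseteq> S"
      using S x unfolding fiber_uniformity_def by blast
    have "{y \<in> gset \<Gamma>. a i y = a i x} \<subseteq> S" using i(2) S x by (auto simp: fiber_rel_def)
    then show ?thesis using fiber_clopen(1)[OF i(1)] S x by blast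
  qed
  then show "openin (gtop \<Gamma>) S" using openin_subopen by blast
next
  fix S assume S: "openin (gtop \<Gamma>) S"
  have sub: "S \<subseteq> gset \<Gamma>" using openin_subset[OF S] topspace by simp
  moreover have "\<exists>W\<in>fiber_uniformity. W `` {x} \<subseteq> S" if x: "x \<in> S" for x
  proof (rule ccontr)
    assume no: "\<not> ?thesis"
    \<comment> \<open>If no fiber through \<open>x\<close> fits inside \<open>S\<close>, the parts
      of these fibers outside \<open>S\<close> form a directed family of nonempty closed sets. A
      common point would share all coordinates with \<open>x\<close> and yet lie outside
      \<open>S\<close>.\<close>
    let ?C = "\<lambda>i. {y \<in> gset \<Gamma>. a i y = a i x} - S"
    have xg: "x \<in> gset \<Gamma>" using x sub by blast
    have "(\<Inter>i\<in>I. ?C i) \<noteq> {}"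
    proof (rule compact_directed_Inter[OF compact I_nonempty])
      fix i assume i: "i \<in> I"
      show "closedin (gtop \<Gamma>) (?C i)" by (rule closedin_diff[OF fiber_clopen(2)[OF i xg] S])
      have "\<not> fiber_rel (gset \<Gamma>) (a i) `` {x} \<subseteq> S" using no fiber_rel_in[OF i] by blast
      then show "?C i \<noteq> {}" by (auto simp: fiber_rel_def)
      fix j assume j: "j \<in> I"
      obtain k where "k \<in> I" "fiber_rel (gset \<Gamma>) (a k) \<subseteq> fiber_rel (gset \<Gamma>) (a i) \<inter> fiber_rel (gset \<Gamma>) (a j)"
        using directed[OF i j] by blast
      then show "\<exists>k\<in>I. ?C k \<subseteq> ?C i \<inter> ?C j" using xg by (intro bexI[of _ k]) (auto simp: fiber_rel_def)
    qed
    then obtain y where y: "\<And>i. i \<in> I \<Longrightarrow> y \<in> ?C i" by blast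
    then have "y \<in> gset \<Gamma>" "y \<notin> S" using I_nonempty by blast+
    moreover from this have "y = x" using separating xg y by blast
    ultimately show False using x by blast
  qed
  ultimately show "S \<subseteq> gset \<Gamma> \<and> (\<forall>x\<in>S. \<exists>W\<in>fiber_uniformity. W `` {x} \<subseteq> S)" by blast
qed

lemma profinite: "profinite_graph \<Gamma>"
proof -
  have "Hausdorff_space (gtop \<Gamma>)"
    unfolding Hausdorff_space_def
  proof (intro allI impI; elim conjE)
    fix x y assume xy: "x \<in> topspace (gtop \<Gamma>)" "y \<in> topspace (gtop \<Gamma>)" "x \<noteq> y"
    then obtain i where i: "i \<in> I" "a i x \<noteq> a i y" using separating topspace by blast
    have "disjnt {z \<in> gset \<Gamma>. a i z = a i x} {z \<in> gset \<Gamma>. a i z = a i y}"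
      using i(2) by (auto simp: disjnt_def)
    then show "\<exists>U V. openin (gtop \<Gamma>) U \<and> openin (gtop \<Gamma>) V \<and> x \<in> U \<and> y \<in> V \<and> disjnt U V"
      using fiber_clopen(1)[OF i(1)] xy topspace by blast
  qed
  moreover have "\<exists>R\<in>fiber_uniformity. R \<subseteq> W \<and> compatible \<Gamma> R \<and> finite (gset \<Gamma> // R)"
    if W: "W \<in> fiber_uniformity" for W
  proof -
    obtain i where i: "i \<in> I" "fiber_rel (gset \<Gamma>) (a i) \<subseteq> W" using W by (auto simp: fiber_uniformity_def)
    have Xi: "is_graph (X i)" "finite (gset (X i))" using X[OF i(1)] by (simp_all add: finite_discrete_graph_def)
    have "finite (a i ` gset \<Gamma>)"
      by (rule finite_subset[OF _ Xi(2)]) (use graph_mapD(6)[OF a_map[OF i(1)]] in auto)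
    then show ?thesis
      using finite_quotient_fiber_rel compatible_fiber_rel[OF graph Xi(1) a_map[OF i(1)]] i fiber_rel_in
      by blast
  qed
  ultimately show ?thesis
    unfolding profinite_graph_def cofinite_graph_def
    using graph uniformity uniform_topology compact by metis
qed

lemma entourages: "entourages \<Gamma> = fiber_uniformity"
  by (rule entourages_eq[OF compact uniformity uniform_topology])

end

lemma gset_inverse_limit:
  "gset (inverse_limit I prec X \<phi>) =
    threads I prec (\<lambda>i. verts (X i)) \<phi> \<union> threads I prec (\<lambda>i. edges (X i)) \<phi>"
  by (simp add: gset_def inverse_limit_def)

lemma topspace_inverse_limit:
  assumes "\<And>i. i \<in> I \<Longrightarrow> topspace (gtop (X i)) = gset (X i)"
  shows "topspace (gtop (inverse_limit I prec X \<phi>)) = gset (inverse_limit I prec X \<phi>)"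
proof -
  have "threads I prec (\<lambda>i. verts (X i)) \<phi> \<union> threads I prec (\<lambda>i. edges (X i)) \<phi> \<subseteq> Pi\<^sub>E I (\<lambda>i. gset (X i))"
    by (auto simp: threads_def gset_def PiE_def Pi_def)
  also have "\<dots> = topspace (product_topology (\<lambda>i. gtop (X i)) I)"
    using assms by (auto intro!: PiE_cong)
  finally show ?thesis
    unfolding gset_inverse_limit by (simp add: inverse_limit_def Int_absorb1)
qed

text \<open>A continuous bijection from a compact space to a Hausdorff space is a homeomorphism, so
  it suffices that the coordinates separate points and that every thread of vertices or of edges is
  hit.\<close>

lemma top_graph_iso_inverse_limit:
  assumes Z: "is_graph Z" "compact_space (gtop Z)" "topspace (gtop Z) = gset Z"
    and Y: "\<And>i. i \<in> I \<Longrightarrow> finite_discrete_graph (Y i)"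
    and c: "\<And>i. i \<in> I \<Longrightarrow> cont_graph_map Z (Y i) (c i)"
    and comm: "\<And>i j z. i \<in> I \<Longrightarrow> j \<in> I \<Longrightarrow> prec i j \<Longrightarrow> z \<in> gset Z \<Longrightarrow> \<psi> i j (c j z) = c i z"
    and sep: "\<And>x y. x \<in> gset Z \<Longrightarrow> y \<in> gset Z \<Longrightarrow> (\<And>i. i \<in> I \<Longrightarrow> c i x = c i y) \<Longrightarrow> x = y"
    and V: "\<And>t. t \<in> threads I prec (\<lambda>i. verts (Y i)) \<psi> \<Longrightarrow> \<exists>z\<in>verts Z. \<forall>i\<in>I. c i z = t i"
    and E: "\<And>t. t \<in> threads I prec (\<lambda>i. edges (Y i)) \<psi> \<Longrightarrow> \<exists>z\<in>edges Z. \<forall>i\<in>I. c i z = t i"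
  shows "top_graph_iso Z (inverse_limit I prec Y \<psi>) (\<lambda>z. \<lambda>i\<in>I. c i z)"
proof -
  let ?L = "inverse_limit I prec Y \<psi>" and ?c = "\<lambda>z. \<lambda>i\<in>I. c i z"
  have cm: "graph_map Z (Y i) (c i)" if "i \<in> I" for i using c[OF that] by (simp add: cont_graph_map_def)
  have cV: "?c z \<in> threads I prec (\<lambda>i. verts (Y i)) \<psi>" if "z \<in> verts Z" for z
    using that comm gsetI(1)[OF that] graph_mapD(1)[OF cm] by (auto simp: threads_def)
  have cE: "?c z \<in> threads I prec (\<lambda>i. edges (Y i)) \<psi>" if "z \<in> edges Z" for z
    using that comm gsetI(2)[OF that] graph_mapD(2)[OF cm] by (auto simp: threads_def)
  have m: "graph_map Z ?L ?c"
    by (rule graph_mapI)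
      (use cV cE graph_mapD(3-5)[OF cm] in \<open>auto simp: inverse_limit_def intro!: restrict_ext\<close>)
  have ext: "t = ?c z" if "t \<in> threads I prec S \<psi>" "\<forall>i\<in>I. c i z = t i" for t z S
    using that by (auto simp: threads_def PiE_def extensional_def fun_eq_iff)
  have surj: "gset ?L \<subseteq> ?c ` gset Z"
  proof
    fix t assume "t \<in> gset ?L"
    then consider "t \<in> threads I prec (\<lambda>i. verts (Y i)) \<psi>" | "t \<in> threads I prec (\<lambda>i. edges (Y i)) \<psi>"
      unfolding gset_inverse_limit by blast
    then show "t \<in> ?c ` gset Z"
    proof cases
      case 1
      then obtain z where "z \<in> verts Z" "\<forall>i\<in>I. c i z = t i" using V by blast
      then show ?thesis using ext[OF 1, of z] gsetI(1)[of z Z] by (intro image_eqI[of t ?c z]) auto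
    next
      case 2
      then obtain z where "z \<in> edges Z" "\<forall>i\<in>I. c i z = t i" using E by blast
      then show ?thesis using ext[OF 2, of z] gsetI(2)[of z Z] by (intro image_eqI[of t ?c z]) auto
    qed
  qed
  have im: "?c ` gset Z = gset ?L" using surj graph_mapD(6)[OF m] by blast
  have inj: "inj_on ?c (gset Z)"
  proof (rule inj_onI)
    fix x y assume xy: "x \<in> gset Z" "y \<in> gset Z" "?c x = ?c y"
    have "c i x = c i y" if "i \<in> I" for i using fun_cong[OF xy(3), of i] that by simp
    then show "x = y" using sep[OF xy(1,2)] by blast
  qed
  have tY: "topspace (gtop (Y i)) = gset (Y i)" if "i \<in> I" for i
    using Y[OF that] by (simp add: finite_discrete_graph_def)
  have gtopL: "gtop ?L = subtopology (product_topology (\<lambda>i. gtop (Y i)) I) (gset ?L)"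
    unfolding gset_inverse_limit by (simp add: inverse_limit_def)
  have "continuous_map (gtop Z) (product_topology (\<lambda>i. gtop (Y i)) I) ?c"
    unfolding continuous_map_componentwise using c by (auto simp: cont_graph_map_def)
  moreover have "?c \<in> topspace (gtop Z) \<rightarrow> gset ?L" using im Z(3) by blast
  ultimately have cont: "continuous_map (gtop Z) (gtop ?L) ?c"
    using gtopL by (simp add: continuous_map_in_subtopology)
  have "Hausdorff_space (product_topology (\<lambda>i. gtop (Y i)) I)"
    unfolding Hausdorff_space_product_topology using Y by (auto simp: finite_discrete_graph_def)
  then have "Hausdorff_space (gtop ?L)" by (simp add: inverse_limit_def Hausdorff_space_subtopology)
  then have "homeomorphic_map (gtop Z) (gtop ?L) ?c"
    using continuous_imp_homeomorphic_map[OF cont Z(2)] im inj Z(3)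
      topspace_inverse_limit[of I Y prec \<psi>, OF tY]
    by simp
  then show ?thesis using m im inj by (simp add: top_graph_iso_def bij_betw_def)
qed

lemma top_graph_iso_inverse_limitD:
  assumes iso: "top_graph_iso \<Gamma> (inverse_limit I prec X \<phi>) a"
    and X: "\<And>i. i \<in> I \<Longrightarrow> finite_discrete_graph (X i)" and I: "I \<noteq> {}"
  shows "i \<in> I \<Longrightarrow> cont_graph_map \<Gamma> (X i) (\<lambda>x. a x i)"
    and "i \<in> I \<Longrightarrow> j \<in> I \<Longrightarrow> prec i j \<Longrightarrow> x \<in> gset \<Gamma> \<Longrightarrow> \<phi> i j (a x j) = a x i"
    and "x \<in> gset \<Gamma> \<Longrightarrow> y \<in> gset \<Gamma> \<Longrightarrow> (\<And>i. i \<in> I \<Longrightarrow> a x i = a y i) \<Longrightarrow> x = y"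
    and "t \<in> threads I prec (\<lambda>i. verts (X i)) \<phi> \<Longrightarrow> \<exists>z\<in>verts \<Gamma>. a z = t"
    and "t \<in> threads I prec (\<lambda>i. edges (X i)) \<phi> \<Longrightarrow> \<exists>z\<in>edges \<Gamma>. a z = t"
proof -
  let ?L = "inverse_limit I prec X \<phi>"
  have m: "graph_map \<Gamma> ?L a" and bij: "bij_betw a (gset \<Gamma>) (gset ?L)"
    and hom: "homeomorphic_map (gtop \<Gamma>) (gtop ?L) a"
    using iso by (auto simp: top_graph_iso_def)
  note g = graph_mapD[OF m]
  have Vt: "a v \<in> threads I prec (\<lambda>i. verts (X i)) \<phi>" if "v \<in> verts \<Gamma>" for v
    using g(1)[OF that] by (simp add: inverse_limit_def)
  have Et: "a v \<in> threads I prec (\<lambda>i. edges (X i)) \<phi>" if "v \<in> edges \<Gamma>" for v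
    using g(2)[OF that] by (simp add: inverse_limit_def)
  have ext: "a x \<in> extensional I" if "x \<in> gset \<Gamma>" for x
    using that Vt Et by (auto simp: gset_def threads_def PiE_def)
  show "cont_graph_map \<Gamma> (X i) (\<lambda>x. a x i)" if i: "i \<in> I" for i
    unfolding cont_graph_map_def
  proof
    show "graph_map \<Gamma> (X i) (\<lambda>x. a x i)"
    proof (rule graph_mapI)
      fix v assume "v \<in> verts \<Gamma>"
      then show "a v i \<in> verts (X i)" using Vt i by (auto simp: threads_def)
    next
      fix e assume e: "e \<in> edges \<Gamma>"
      then show "a e i \<in> edges (X i)" using Et i by (auto simp: threads_def)
      show "a (src \<Gamma> e) i = src (X i) (a e i)" "a (tgt \<Gamma> e) i = tgt (X i) (a e i)"
        "a (bar \<Gamma> e) i = bar (X i) (a e i)"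
        using g(3-5)[OF e] i by (simp_all add: inverse_limit_def)
    qed
    have "continuous_map (gtop \<Gamma>) (product_topology (\<lambda>i. gtop (X i)) I) a"
      using homeomorphic_imp_continuous_map[OF hom]
      by (simp add: inverse_limit_def continuous_map_in_subtopology)
    then show "continuous_map (gtop \<Gamma>) (gtop (X i)) (\<lambda>x. a x i)"
      unfolding continuous_map_componentwise using i by blast
  qed
  show "\<phi> i j (a x j) = a x i" if "i \<in> I" "j \<in> I" "prec i j" "x \<in> gset \<Gamma>" for i j x
    using that Vt Et by (auto simp: gset_def threads_def)
  show "x = y" if xy: "x \<in> gset \<Gamma>" "y \<in> gset \<Gamma>" "\<And>i. i \<in> I \<Longrightarrow> a x i = a y i" for x y
  proof -
    have "a x = a y" using extensionalityI[OF ext[OF xy(1)] ext[OF xy(2)]] xy(3) by blast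
    then show ?thesis using bij xy(1,2) by (auto simp: bij_betw_def inj_on_def)
  qed
  \<comment> \<open>One coordinate already tells vertex threads from edge threads, so the preimage
    of a thread under the bijection is of the same kind as the thread.\<close>
  obtain i0 where i0: "i0 \<in> I" using I by blast
  have X0: "is_graph (X i0)" using X[OF i0] by (simp add: finite_discrete_graph_def)
  have disj: False
    if "t \<in> threads I prec (\<lambda>i. verts (X i)) \<phi>" "t \<in> threads I prec (\<lambda>i. edges (X i)) \<phi>" for t
    using that i0 is_graphD(1)[OF X0] by (auto simp: threads_def)
  show "\<exists>z\<in>verts \<Gamma>. a z = t" if t: "t \<in> threads I prec (\<lambda>i. verts (X i)) \<phi>"
  proof -
    obtain z where z: "z \<in> gset \<Gamma>" "t = a z"
      using t bij unfolding bij_betw_def gset_inverse_limit by blast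
    then have "z \<notin> edges \<Gamma>" using disj t Et by blast
    then show ?thesis using z by (auto simp: gset_def)
  qed
  show "\<exists>z\<in>edges \<Gamma>. a z = t" if t: "t \<in> threads I prec (\<lambda>i. edges (X i)) \<phi>"
  proof -
    obtain z where z: "z \<in> gset \<Gamma>" "t = a z"
      using t bij unfolding bij_betw_def gset_inverse_limit by blast
    then have "z \<notin> verts \<Gamma>" using disj t Vt by blast
    then show ?thesis using z by (auto simp: gset_def)
  qed
qed

section \<open>The automorphism group\<close>

lemma Aut_carrier:
  "\<alpha> \<in> carrier (Aut \<Gamma> f) \<longleftrightarrow> \<alpha> \<in> Bij (gset \<Gamma>) \<and> graph_map \<Gamma> \<Gamma> \<alpha> \<and>
    homeomorphic_map (gtop \<Gamma>) (gtop \<Gamma>) \<alpha> \<and> (\<forall>x\<in>gset \<Gamma>. f (\<alpha> x) = f x)"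
  by (auto simp: Aut_def BijGroup_def)

lemma Aut_mult:
  assumes "\<alpha> \<in> carrier (Aut \<Gamma> f)" "\<beta> \<in> carrier (Aut \<Gamma> f)"
  shows "\<alpha> \<otimes>\<^bsub>Aut \<Gamma> f\<^esub> \<beta> = compose (gset \<Gamma>) \<alpha> \<beta>"
  using assms by (simp add: Aut_def BijGroup_def)

lemma Aut_one: "\<one>\<^bsub>Aut \<Gamma> f\<^esub> = (\<lambda>x\<in>gset \<Gamma>. x)"
  by (simp add: Aut_def BijGroup_def)

lemma Bij_inverse_map:
  assumes "\<alpha> \<in> Bij S"
  shows "x \<in> S \<Longrightarrow> \<alpha> x \<in> S" "x \<in> S \<Longrightarrow> inv_into S \<alpha> x \<in> S"
    "x \<in> S \<Longrightarrow> \<alpha> (inv_into S \<alpha> x) = x" "x \<in> S \<Longrightarrow> inv_into S \<alpha> (\<alpha> x) = x"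
  using assms unfolding Bij_def bij_betw_def
  by (auto intro: inv_into_into f_inv_into_f inv_into_f_f)

text \<open>Realized as a subgroup of \<open>BijGroup (gset \<Gamma>)\<close>. The work is in the
  inverse, which must again be a graph map and a homeomorphism.\<close>

lemma group_Aut:
  assumes \<Gamma>: "is_graph \<Gamma>" and top: "topspace (gtop \<Gamma>) = gset \<Gamma>"
  shows "group (Aut \<Gamma> f)"
proof -
  let ?S = "gset \<Gamma>" and ?B = "BijGroup (gset \<Gamma>)" and ?A = "carrier (Aut \<Gamma> f)"
  interpret B: group ?B by (rule group_BijGroup)
  have BB: "carrier ?B = Bij ?S" "\<And>\<alpha> \<beta>. \<alpha> \<in> Bij ?S \<Longrightarrow> \<beta> \<in> Bij ?S \<Longrightarrow> \<alpha> \<otimes>\<^bsub>?B\<^esub> \<beta> = compose ?S \<alpha> \<beta>"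
    by (auto simp: BijGroup_def)
  have comp: "compose ?S \<alpha> \<beta> \<in> ?A" if \<alpha>: "\<alpha> \<in> ?A" and \<beta>: "\<beta> \<in> ?A" for \<alpha> \<beta>
  proof -
    note a = \<alpha>[unfolded Aut_carrier] and b = \<beta>[unfolded Aut_carrier]
    have "graph_map \<Gamma> \<Gamma> (compose ?S \<alpha> \<beta>)"
      using graph_map_comp[of \<Gamma> \<Gamma> \<beta> \<Gamma> \<alpha>] a b is_graphD(2-4)[OF \<Gamma>]
      by (auto simp: graph_map_def compose_def gset_def)
    moreover have "homeomorphic_map (gtop \<Gamma>) (gtop \<Gamma>) (compose ?S \<alpha> \<beta>)"
      by (rule homeomorphic_map_eq[OF homeomorphic_map_compose[of _ _ \<beta> _ \<alpha>]])
        (use a b top in \<open>auto simp: compose_def\<close>)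
    moreover have "f (compose ?S \<alpha> \<beta> x) = f x" if "x \<in> ?S" for x
      using a b that Bij_inverse_map(1)[of \<beta> ?S x] by (simp add: compose_def)
    ultimately show ?thesis using a b compose_Bij by (auto simp: Aut_carrier)
  qed
  have inv: "(\<lambda>x\<in>?S. inv_into ?S \<alpha> x) \<in> ?A" if \<alpha>: "\<alpha> \<in> ?A" for \<alpha>
  proof -
    note a = \<alpha>[unfolded Aut_carrier]
    let ?\<beta> = "\<lambda>x\<in>?S. inv_into ?S \<alpha> x"
    have \<alpha>B: "\<alpha> \<in> Bij ?S" and \<alpha>m: "graph_map \<Gamma> \<Gamma> \<alpha>" using a by blast+
    note i = Bij_inverse_map[OF \<alpha>B] and m = graph_mapD[OF \<alpha>m] and g = is_graphD[OF \<Gamma>]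
    \<comment> \<open>If the preimage of a vertex were an edge, \<alpha> would send that edge to a
      vertex, although it preserves edges.\<close>
    have iV: "inv_into ?S \<alpha> v \<in> verts \<Gamma>" if v: "v \<in> verts \<Gamma>" for v
    proof (rule ccontr)
      assume "inv_into ?S \<alpha> v \<notin> verts \<Gamma>"
      then have "inv_into ?S \<alpha> v \<in> edges \<Gamma>" using i(2)[OF gsetI(1)[OF v]] by (auto simp: gset_def)
      then have "v \<in> edges \<Gamma>" using m(2) i(3)[OF gsetI(1)[OF v]] by fastforce
      then show False using g(1)[OF v] by blast
    qed
    have iE: "inv_into ?S \<alpha> e \<in> edges \<Gamma>" if e: "e \<in> edges \<Gamma>" for e
    proof (rule ccontr)
      assume "inv_into ?S \<alpha> e \<notin> edges \<Gamma>"
      then have "inv_into ?S \<alpha> e \<in> verts \<Gamma>" using i(2)[OF gsetI(2)[OF e]] by (auto simp: gset_def)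
      then have "e \<in> verts \<Gamma>" using m(1) i(3)[OF gsetI(2)[OF e]] by fastforce
      then show False using g(1) e by blast
    qed
    have ends: "inv_into ?S \<alpha> (h e) = h (inv_into ?S \<alpha> e)"
      if e: "e \<in> edges \<Gamma>" and h: "\<And>e. e \<in> edges \<Gamma> \<Longrightarrow> \<alpha> (h e) = h (\<alpha> e)" "\<And>e. e \<in> edges \<Gamma> \<Longrightarrow> h e \<in> ?S" for h e
      using h(1)[OF iE[OF e]] i(3)[OF gsetI(2)[OF e]] i(4)[OF h(2)[OF iE[OF e]]] by simp
    have "graph_map \<Gamma> \<Gamma> ?\<beta>"
      by (rule graph_mapI) (use iV iE g(2-4) ends m(3-5) in \<open>auto simp: gset_def\<close>)
    moreover have "homeomorphic_map (gtop \<Gamma>) (gtop \<Gamma>) ?\<beta>"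
    proof -
      obtain \<gamma> where \<gamma>: "homeomorphic_maps (gtop \<Gamma>) (gtop \<Gamma>) \<alpha> \<gamma>" using a homeomorphic_map_maps by blast
      have "homeomorphic_map (gtop \<Gamma>) (gtop \<Gamma>) \<gamma>" using \<gamma> homeomorphic_maps_sym homeomorphic_map_maps by blast
      \<comment> \<open>The topological inverse \<gamma> is controlled only on the space itself;
        there it coincides with the extensional inverse used by \<open>BijGroup\<close>.\<close>
      moreover have "\<gamma> x = ?\<beta> x" if "x \<in> topspace (gtop \<Gamma>)" for x
      proof -
        have "\<alpha> (\<gamma> x) = x" "\<gamma> x \<in> ?S"
          using \<gamma> that top continuous_map_image_subset_topspace[of "gtop \<Gamma>" "gtop \<Gamma>" \<gamma>]
          by (auto simp: homeomorphic_maps_def)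
        then show ?thesis using i(4)[of "\<gamma> x"] that top by simp
      qed
      ultimately show ?thesis by (rule homeomorphic_map_eq)
    qed
    moreover have "f (?\<beta> x) = f x" if "x \<in> ?S" for x
    proof -
      have "f (\<alpha> (inv_into ?S \<alpha> x)) = f (inv_into ?S \<alpha> x)" using a i(2)[OF that] by blast
      then show ?thesis using i(3)[OF that] that by simp
    qed
    ultimately show ?thesis using restrict_inv_into_Bij[OF \<alpha>B] by (auto simp: Aut_carrier)
  qed
  have one: "(\<lambda>x\<in>?S. x) \<in> ?A"
  proof -
    have "graph_map \<Gamma> \<Gamma> (\<lambda>x\<in>?S. x)"
      by (rule graph_mapI) (use is_graphD(2-4)[OF \<Gamma>] in \<open>auto simp: gset_def\<close>)
    moreover have "homeomorphic_map (gtop \<Gamma>) (gtop \<Gamma>) (\<lambda>x\<in>?S. x)"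
      by (rule homeomorphic_map_eq[of _ _ id]) (auto simp: top)
    ultimately show ?thesis using id_Bij by (auto simp: Aut_carrier)
  qed
  have "subgroup ?A ?B"
  proof (rule B.subgroupI)
    show "?A \<subseteq> carrier ?B" by (auto simp: Aut_carrier BB(1))
    show "?A \<noteq> {}" using one by blast
  next
    fix \<alpha> assume \<alpha>: "\<alpha> \<in> ?A"
    then show "inv\<^bsub>?B\<^esub> \<alpha> \<in> ?A" using inv[OF \<alpha>] inv_BijGroup[of \<alpha> ?S] by (simp add: Aut_carrier)
    fix \<beta> assume \<beta>: "\<beta> \<in> ?A"
    then show "\<alpha> \<otimes>\<^bsub>?B\<^esub> \<beta> \<in> ?A" using comp[OF \<alpha> \<beta>] BB(2) \<alpha> by (simp add: Aut_carrier)
  qed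
  then have "group (?B\<lparr>carrier := ?A\<rparr>)" by (rule B.subgroup_imp_group)
  then show ?thesis by (simp add: Aut_def BijGroup_def)
qed

section \<open>Deck transformations of the finite levels\<close>

locale regular_covering_system =
  fixes \<Gamma> :: "'a top_graph" and \<Delta> :: "'b top_graph" and f :: "'a \<Rightarrow> 'b"
    and I :: "'i set" and prec :: "'i \<Rightarrow> 'i \<Rightarrow> bool"
    and X :: "'i \<Rightarrow> nat top_graph" and \<phi> :: "'i \<Rightarrow> 'i \<Rightarrow> nat \<Rightarrow> nat"
    and Y :: "'i \<Rightarrow> nat top_graph" and \<psi> :: "'i \<Rightarrow> 'i \<Rightarrow> nat \<Rightarrow> nat"
    and F :: "'i \<Rightarrow> nat \<Rightarrow> nat" and a :: "'a \<Rightarrow> 'i \<Rightarrow> nat" and b :: "'b \<Rightarrow> 'i \<Rightarrow> nat"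
  assumes \<Gamma>: "connected_profinite_graph \<Gamma>" and \<Delta>: "profinite_graph \<Delta>" and f: "cont_graph_map \<Gamma> \<Delta> f"
    and sys: "inverse_system_maps I prec X \<phi> Y \<psi> F"
    and XY: "\<forall>i\<in>I. finite_discrete_graph (X i) \<and> finite_discrete_graph (Y i) \<and>
      finite_regular_covering (X i) (Y i) (F i)"
    and a: "top_graph_iso \<Gamma> (inverse_limit I prec X \<phi>) a"
    and b: "top_graph_iso \<Delta> (inverse_limit I prec Y \<psi>) b"
    and ab: "\<forall>x\<in>gset \<Gamma>. b (f x) = (\<lambda>i\<in>I. F i (a x i))"
begin

abbreviation G where "G \<equiv> Aut \<Gamma> f"

lemma dir: "directed_set I prec" and X_sys: "inverse_system I prec X \<phi>"
  using sys by (simp_all add: inverse_system_maps_def)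

lemma I_nonempty: "I \<noteq> {}"
  and prec_directed: "i \<in> I \<Longrightarrow> j \<in> I \<Longrightarrow> \<exists>k\<in>I. prec i k \<and> prec j k"
  using dir unfolding directed_set_def by blast+

lemma \<Gamma>_profinite: "profinite_graph \<Gamma>"
  using \<Gamma> by (simp add: connected_profinite_graph_def)

lemmas \<Gamma>_simps = profinite_graphD(1-4)[OF \<Gamma>_profinite]
lemmas \<Delta>_simps = profinite_graphD(1-4)[OF \<Delta>]

lemma f_map: "graph_map \<Gamma> \<Delta> f" and f_cont: "continuous_map (gtop \<Gamma>) (gtop \<Delta>) f"
  using f by (simp_all add: cont_graph_map_def)

context
  fixes i assumes i: "i \<in> I"
begin

lemma X_graph: "is_graph (X i)" and X_fin: "finite (gset (X i))" and X_disc: "finite_discrete_graph (X i)"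
  and X_conn: "graph_path_connected (X i)"
  using XY i by (auto simp: finite_discrete_graph_def finite_regular_covering_def)

lemma Y_graph: "is_graph (Y i)" and Y_disc: "finite_discrete_graph (Y i)"
  and Y_conn: "graph_path_connected (Y i)"
  using XY i by (auto simp: finite_discrete_graph_def finite_regular_covering_def)

lemma F_cov: "graph_covering (X i) (Y i) (F i)"
  using XY i X_graph Y_graph by (simp add: graph_covering_def finite_regular_covering_def)

lemma F_map: "graph_map (X i) (Y i) (F i)"
  using graph_covering.q_map[OF F_cov] .

lemma F_deck:
  assumes "z \<in> gset (X i)" "z' \<in> gset (X i)" "F i z' = F i z"
  shows "\<exists>g. graph_map (X i) (X i) g \<and> (\<forall>z\<in>gset (X i). F i (g z) = F i z) \<and> g z = z'"
proof -
  obtain x where "x \<in> verts (X i)" "pi1_map (Y i) (F i) x ` carrier (pi1 (X i) x) \<lhd> pi1 (Y i) (F i x)"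
    using XY i unfolding finite_regular_covering_def by blast
  then show ?thesis using graph_covering.deck_of_normal[OF F_cov X_conn _ _ assms] by blast
qed

end

section \<open>Coordinates of \<Gamma> and \<Delta> at the finite levels\<close>

lemma a_cont: "i \<in> I \<Longrightarrow> cont_graph_map \<Gamma> (X i) (\<lambda>x. a x i)"
  by (rule top_graph_iso_inverse_limitD(1)[OF a X_disc I_nonempty])

lemma a_comm: "i \<in> I \<Longrightarrow> j \<in> I \<Longrightarrow> prec i j \<Longrightarrow> x \<in> gset \<Gamma> \<Longrightarrow> \<phi> i j (a x j) = a x i"
  by (rule top_graph_iso_inverse_limitD(2)[OF a X_disc I_nonempty])

lemma a_inj: "x \<in> gset \<Gamma> \<Longrightarrow> y \<in> gset \<Gamma> \<Longrightarrow> (\<And>i. i \<in> I \<Longrightarrow> a x i = a y i) \<Longrightarrow> x = y"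
  by (rule top_graph_iso_inverse_limitD(3)[OF a X_disc I_nonempty])

lemma b_inj: "x \<in> gset \<Delta> \<Longrightarrow> y \<in> gset \<Delta> \<Longrightarrow> (\<And>i. i \<in> I \<Longrightarrow> b x i = b y i) \<Longrightarrow> x = y"
  by (rule top_graph_iso_inverse_limitD(3)[OF b Y_disc I_nonempty])

lemma a_verts: "t \<in> threads I prec (\<lambda>i. verts (X i)) \<phi> \<Longrightarrow> \<exists>z\<in>verts \<Gamma>. a z = t"
  by (rule top_graph_iso_inverse_limitD(4)[OF a X_disc I_nonempty])

lemma a_edges: "t \<in> threads I prec (\<lambda>i. edges (X i)) \<phi> \<Longrightarrow> \<exists>z\<in>edges \<Gamma>. a z = t"
  by (rule top_graph_iso_inverse_limitD(5)[OF a X_disc I_nonempty])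

lemma a_map: "i \<in> I \<Longrightarrow> graph_map \<Gamma> (X i) (\<lambda>x. a x i)"
  using a_cont by (simp add: cont_graph_map_def)

lemma b_f: "i \<in> I \<Longrightarrow> x \<in> gset \<Gamma> \<Longrightarrow> b (f x) i = F i (a x i)"
  using ab by simp

lemma a_gset: "i \<in> I \<Longrightarrow> x \<in> gset \<Gamma> \<Longrightarrow> a x i \<in> gset (X i)"
  using graph_mapD(6)[OF a_map] .

lemma \<phi>_map: "i \<in> I \<Longrightarrow> j \<in> I \<Longrightarrow> prec i j \<Longrightarrow> graph_map (X j) (X i) (\<phi> i j)"
  and \<phi>_comp: "i \<in> I \<Longrightarrow> j \<in> I \<Longrightarrow> k \<in> I \<Longrightarrow> prec i j \<Longrightarrow> prec j k \<Longrightarrow> x \<in> gset (X k) \<Longrightarrow>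
    \<phi> i j (\<phi> j k x) = \<phi> i k x"
  and \<phi>_id: "i \<in> I \<Longrightarrow> x \<in> gset (X i) \<Longrightarrow> \<phi> i i x = x"
  using X_sys by (auto simp: inverse_system_def cont_graph_map_def)

lemma F_\<phi>: "i \<in> I \<Longrightarrow> j \<in> I \<Longrightarrow> prec i j \<Longrightarrow> x \<in> gset (X j) \<Longrightarrow> F i (\<phi> i j x) = \<psi> i j (F j x)"
  using sys by (auto simp: inverse_system_maps_def)

lemma fiber_directed:
  assumes "i \<in> I" "j \<in> I"
  shows "\<exists>k\<in>I. fiber_rel (gset \<Gamma>) (\<lambda>x. a x k) \<subseteq>
    fiber_rel (gset \<Gamma>) (\<lambda>x. a x i) \<inter> fiber_rel (gset \<Gamma>) (\<lambda>x. a x j)"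
proof -
  obtain k where k: "k \<in> I" "prec i k" "prec j k" using prec_directed assms by blast
  have "a x l = a y l" if "x \<in> gset \<Gamma>" "y \<in> gset \<Gamma>" "a x k = a y k" "l \<in> I" "prec l k" for x y l
    using a_comm[OF that(4) k(1) that(5,1)] a_comm[OF that(4) k(1) that(5,2)] that(3) by simp
  then show ?thesis using k assms by (intro bexI[of _ k]) (auto simp: fiber_rel_def)
qed

sublocale sep: separating_family \<Gamma> I X "\<lambda>i x. a x i"
  by unfold_locales
    (rule \<Gamma>_simps I_nonempty X_disc a_cont fiber_directed a_inj; assumption?)+

sublocale G: group G
  by (rule group_Aut) (rule \<Gamma>_simps)+

lemma G_D:
  assumes "\<alpha> \<in> carrier G"
  shows "graph_map \<Gamma> \<Gamma> \<alpha>" "continuous_map (gtop \<Gamma>) (gtop \<Gamma>) \<alpha>" "x \<in> gset \<Gamma> \<Longrightarrow> f (\<alpha> x) = f x"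
    "x \<in> gset \<Gamma> \<Longrightarrow> \<alpha> x \<in> gset \<Gamma>" "\<alpha> \<in> extensional (gset \<Gamma>)"
  using assms homeomorphic_imp_continuous_map
  by (auto simp: Aut_carrier Bij_inverse_map(1) Bij_imp_extensional)

lemma G_mult: "\<alpha> \<in> carrier G \<Longrightarrow> \<beta> \<in> carrier G \<Longrightarrow> x \<in> gset \<Gamma> \<Longrightarrow> (\<alpha> \<otimes>\<^bsub>G\<^esub> \<beta>) x = \<alpha> (\<beta> x)"
  by (simp add: Aut_mult compose_def)

lemma G_one: "x \<in> gset \<Gamma> \<Longrightarrow> \<one>\<^bsub>G\<^esub> x = x"
  by (simp add: Aut_one)

lemma G_eqI:
  assumes "\<alpha> \<in> carrier G" "\<beta> \<in> carrier G"
    "\<And>i x. i \<in> I \<Longrightarrow> x \<in> gset \<Gamma> \<Longrightarrow> a (\<alpha> x) i = a (\<beta> x) i"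
  shows "\<alpha> = \<beta>"
proof (rule extensionalityI)
  show "\<alpha> \<in> extensional (gset \<Gamma>)" "\<beta> \<in> extensional (gset \<Gamma>)" using G_D(5) assms(1,2) by blast+
  show "\<alpha> x = \<beta> x" if "x \<in> gset \<Gamma>" for x
    using a_inj[OF G_D(4)[OF assms(1) that] G_D(4)[OF assms(2) that]] assms(3)[OF _ that] by blast
qed

lemma F_a: "\<alpha> \<in> carrier G \<Longrightarrow> i \<in> I \<Longrightarrow> x \<in> gset \<Gamma> \<Longrightarrow> F i (a (\<alpha> x) i) = F i (a x i)"
  using b_f[of i x] b_f[of i "\<alpha> x"] G_D(3,4)[of \<alpha> x] by simp

section \<open>Deck maps of the levels and their coherence\<close>

text \<open>Invertibility comes later: an inverse is obtained as a second deck map, and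
  \<open>deck_unique\<close> shows that the two cancel.\<close>

definition deck :: "'i \<Rightarrow> (nat \<Rightarrow> nat) \<Rightarrow> bool" where
  "deck i g \<longleftrightarrow> graph_map (X i) (X i) g \<and> (\<forall>z\<in>gset (X i). F i (g z) = F i z)"

lemma deck_comp: "deck i g \<Longrightarrow> deck i h \<Longrightarrow> deck i (\<lambda>z. g (h z))"
  using graph_map_comp[of "X i" "X i" h "X i" g] graph_mapD(6)[of "X i" "X i" h] unfolding deck_def by simp

lemma deck_id: "deck i (\<lambda>z. z)"
  by (simp add: deck_def graph_map_def)

lemma deck_gset: "deck i g \<Longrightarrow> z \<in> gset (X i) \<Longrightarrow> g z \<in> gset (X i)"
  using graph_mapD(6) by (auto simp: deck_def)

lemma deck_unique:
  assumes "i \<in> I" "deck i g" "deck i h" "z \<in> gset (X i)" "g z = h z" "w \<in> gset (X i)"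
  shows "g w = h w"
  using graph_covering.lifting_unique[OF F_cov[OF assms(1)] X_graph[OF assms(1)] X_conn[OF assms(1)],
      of g h z w] assms by (simp add: deck_def)

text \<open>Both sides lift the same map from \<open>X j\<close> to \<open>Y i\<close>, because the
  bonding maps commute with \<open>F\<close> and deck maps lie over the base. They agree at
  \<open>z\<close>, and \<open>X j\<close> is connected.\<close>

lemma deck_\<phi>:
  assumes ij: "i \<in> I" "j \<in> I" "prec i j" and g: "deck j g" and h: "deck i h"
    and z: "z \<in> gset (X j)" "\<phi> i j (g z) = h (\<phi> i j z)" and w: "w \<in> gset (X j)"
  shows "\<phi> i j (g w) = h (\<phi> i j w)"
proof (rule graph_covering.lifting_unique[OF F_cov[OF ij(1)], where W = "X j" and ?z0.0 = z
      and p = "\<lambda>w. \<phi> i j (g w)" and p' = "\<lambda>w. h (\<phi> i j w)"])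
  show "is_graph (X j)" "graph_path_connected (X j)" using X_graph X_conn ij(2) by blast+
  show "graph_map (X j) (X i) (\<lambda>w. \<phi> i j (g w))"
    by (rule graph_map_comp[OF _ \<phi>_map[OF ij]]) (use g in \<open>simp add: deck_def\<close>)
  show "graph_map (X j) (X i) (\<lambda>w. h (\<phi> i j w))"
    by (rule graph_map_comp[OF \<phi>_map[OF ij]]) (use h in \<open>simp add: deck_def\<close>)
  fix u assume u: "u \<in> gset (X j)"
  then show "F i (\<phi> i j (g u)) = F i (h (\<phi> i j u))"
    using F_\<phi>[OF ij u] F_\<phi>[OF ij deck_gset[OF g u]] g h graph_mapD(6)[OF \<phi>_map[OF ij] u]
    by (simp add: deck_def)
qed (rule z w)+

text \<open>A coherent family acts on threads, hence on \<Gamma> through the isomorphism with the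
  inverse limit. The induced map preserves the kernel of every coordinate, and these kernels form a
  base of the uniformity, so it is continuous.\<close>

lemma lift_family:
  assumes g: "\<And>i. i \<in> I \<Longrightarrow> graph_map (X i) (X i) (g i)"
    and comm: "\<And>i j z. i \<in> I \<Longrightarrow> j \<in> I \<Longrightarrow> prec i j \<Longrightarrow> z \<in> gset (X j) \<Longrightarrow> \<phi> i j (g j z) = g i (\<phi> i j z)"
  shows "\<exists>\<alpha>. graph_map \<Gamma> \<Gamma> \<alpha> \<and> continuous_map (gtop \<Gamma>) (gtop \<Gamma>) \<alpha> \<and>
    (\<forall>x\<in>gset \<Gamma>. \<forall>i\<in>I. a (\<alpha> x) i = g i (a x i))"
proof -
  have V: "\<exists>y\<in>verts \<Gamma>. \<forall>i\<in>I. a y i = g i (a x i)" if x: "x \<in> verts \<Gamma>" for x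
  proof -
    have "(\<lambda>i\<in>I. g i (a x i)) \<in> threads I prec (\<lambda>i. verts (X i)) \<phi>"
      using graph_mapD(1)[OF g] graph_mapD(1)[OF a_map x] comm a_comm a_gset gsetI(1)[OF x]
      by (auto simp: threads_def)
    then obtain y where "y \<in> verts \<Gamma>" "a y = (\<lambda>i\<in>I. g i (a x i))" using a_verts[of "\<lambda>i\<in>I. g i (a x i)"] by blast
    then show ?thesis by (intro bexI[of _ y]) simp_all
  qed
  have E: "\<exists>y\<in>edges \<Gamma>. \<forall>i\<in>I. a y i = g i (a x i)" if x: "x \<in> edges \<Gamma>" for x
  proof -
    have "(\<lambda>i\<in>I. g i (a x i)) \<in> threads I prec (\<lambda>i. edges (X i)) \<phi>"
      using graph_mapD(2)[OF g] graph_mapD(2)[OF a_map x] comm a_comm a_gset gsetI(2)[OF x]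
      by (auto simp: threads_def)
    then obtain y where "y \<in> edges \<Gamma>" "a y = (\<lambda>i\<in>I. g i (a x i))" using a_edges[of "\<lambda>i\<in>I. g i (a x i)"] by blast
    then show ?thesis by (intro bexI[of _ y]) simp_all
  qed
  have "\<exists>y\<in>gset \<Gamma>. \<forall>i\<in>I. a y i = g i (a x i)" if "x \<in> gset \<Gamma>" for x
    using V E that unfolding gset_def by blast
  then obtain \<alpha> where \<alpha>: "\<forall>x\<in>gset \<Gamma>. \<alpha> x \<in> gset \<Gamma> \<and> (\<forall>i\<in>I. a (\<alpha> x) i = g i (a x i))"
    using bchoice[of "gset \<Gamma>" "\<lambda>x y. y \<in> gset \<Gamma> \<and> (\<forall>i\<in>I. a y i = g i (a x i))"] by blast
  have eq: "\<alpha> x = y" if "x \<in> gset \<Gamma>" "y \<in> gset \<Gamma>" "\<And>i. i \<in> I \<Longrightarrow> a y i = g i (a x i)" for x y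
    using a_inj[of "\<alpha> x" y] that \<alpha> by simp
  have \<alpha>V: "\<alpha> v \<in> verts \<Gamma>" if v: "v \<in> verts \<Gamma>" for v
  proof -
    obtain y where "y \<in> verts \<Gamma>" "\<forall>i\<in>I. a y i = g i (a v i)" using V[OF v] by blast
    then show ?thesis using eq[of v y] v gsetI(1) by metis
  qed
  have \<alpha>E: "\<alpha> v \<in> edges \<Gamma>" if v: "v \<in> edges \<Gamma>" for v
  proof -
    obtain y where "y \<in> edges \<Gamma>" "\<forall>i\<in>I. a y i = g i (a v i)" using E[OF v] by blast
    then show ?thesis using eq[of v y] v gsetI(2) by metis
  qed
  note gr = is_graphD[OF \<Gamma>_simps(1)]
  have m: "graph_map \<Gamma> \<Gamma> \<alpha>"
  proof (rule graph_mapI)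
    fix e assume e: "e \<in> edges \<Gamma>"
    have ae: "a (\<alpha> e) i = g i (a e i)" if "i \<in> I" for i using \<alpha> gsetI(2)[OF e] that by blast
    note s = graph_mapD(3-5)[OF a_map] graph_mapD(3-5)[OF g] graph_mapD(2)[OF a_map e]
    show "\<alpha> (src \<Gamma> e) = src \<Gamma> (\<alpha> e)"
      by (rule eq) (use gr(2)[OF e] gr(2)[OF \<alpha>E[OF e]] e \<alpha>E[OF e] s ae in \<open>auto simp: gset_def\<close>)
    show "\<alpha> (tgt \<Gamma> e) = tgt \<Gamma> (\<alpha> e)"
      by (rule eq) (use gr(3)[OF e] gr(3)[OF \<alpha>E[OF e]] e \<alpha>E[OF e] s ae in \<open>auto simp: gset_def\<close>)
    show "\<alpha> (bar \<Gamma> e) = bar \<Gamma> (\<alpha> e)"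
      by (rule eq) (use gr(4)[OF e] gr(4)[OF \<alpha>E[OF e]] e \<alpha>E[OF e] s ae in \<open>auto simp: gset_def\<close>)
  qed (use \<alpha>V \<alpha>E in auto)
  have "continuous_map (gtop \<Gamma>) (gtop \<Gamma>) \<alpha>"
    unfolding continuous_map_def
  proof (intro conjI allI impI)
    show "\<alpha> \<in> topspace (gtop \<Gamma>) \<rightarrow> topspace (gtop \<Gamma>)" using \<alpha> by (simp add: \<Gamma>_simps(4))
    fix U assume "openin (gtop \<Gamma>) U"
    then have U: "\<forall>x\<in>U. \<exists>W\<in>sep.fiber_uniformity. W `` {x} \<subseteq> U"
      using openin_uniform_topology[OF sep.uniformity, of U] sep.uniform_topology by simp
    have "openin (uniform_topology (gset \<Gamma>) sep.fiber_uniformity) {x \<in> topspace (gtop \<Gamma>). \<alpha> x \<in> U}"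
      unfolding openin_uniform_topology[OF sep.uniformity] \<Gamma>_simps(4)
    proof (intro conjI ballI)
      fix x assume x: "x \<in> {x \<in> gset \<Gamma>. \<alpha> x \<in> U}"
      then obtain W where "W \<in> sep.fiber_uniformity" "W `` {\<alpha> x} \<subseteq> U" using U by blast
      then obtain i where i: "i \<in> I" "fiber_rel (gset \<Gamma>) (\<lambda>x. a x i) `` {\<alpha> x} \<subseteq> U"
        unfolding sep.fiber_uniformity_def by blast
      have "fiber_rel (gset \<Gamma>) (\<lambda>x. a x i) `` {x} \<subseteq> {x \<in> gset \<Gamma>. \<alpha> x \<in> U}"
      proof
        fix y assume "y \<in> fiber_rel (gset \<Gamma>) (\<lambda>x. a x i) `` {x}"
        then have y: "y \<in> gset \<Gamma>" "a x i = a y i" by (auto simp: fiber_rel_def)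
        then have "\<alpha> y \<in> fiber_rel (gset \<Gamma>) (\<lambda>x. a x i) `` {\<alpha> x}" using \<alpha> x i(1) by (simp add: fiber_rel_def)
        then show "y \<in> {x \<in> gset \<Gamma>. \<alpha> x \<in> U}" using i(2) y(1) by blast
      qed
      then show "\<exists>W\<in>sep.fiber_uniformity. W `` {x} \<subseteq> {x \<in> gset \<Gamma>. \<alpha> x \<in> U}"
        using sep.fiber_rel_in[OF i(1)] by blast
    qed blast
    then show "openin (gtop \<Gamma>) {x \<in> topspace (gtop \<Gamma>). \<alpha> x \<in> U}" by (simp add: sep.uniform_topology)
  qed
  then show ?thesis using m \<alpha> by blast
qed

text \<open>Each level has a deck map taking the coordinate of \<open>x\<close> to that of
  \<open>y\<close>. These maps are coherent by \<open>deck_\<phi>\<close>, since they match at the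
  coordinates of \<open>x\<close>, and so they assemble to a self-map of \<Gamma>. Exchanging
  \<open>x\<close> and \<open>y\<close> yields its inverse.\<close>

lemma G_transitive:
  assumes x: "x \<in> gset \<Gamma>" and y: "y \<in> gset \<Gamma>" and xy: "f x = f y"
  shows "\<exists>\<alpha>\<in>carrier G. \<alpha> x = y"
proof -
  have ex: "\<exists>g \<alpha>. (\<forall>i\<in>I. deck i (g i) \<and> g i (a x i) = a y i) \<and> graph_map \<Gamma> \<Gamma> \<alpha> \<and>
      continuous_map (gtop \<Gamma>) (gtop \<Gamma>) \<alpha> \<and> (\<forall>z\<in>gset \<Gamma>. \<forall>i\<in>I. a (\<alpha> z) i = g i (a z i))"
    if xy: "x \<in> gset \<Gamma>" "y \<in> gset \<Gamma>" "f x = f y" for x y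
  proof -
    have "\<exists>g. deck i g \<and> g (a x i) = a y i" if i: "i \<in> I" for i
      using F_deck[OF i a_gset[OF i xy(1)] a_gset[OF i xy(2)]] b_f[OF i xy(1)] b_f[OF i xy(2)] xy(3)
      unfolding deck_def by auto
    then obtain g where g: "\<forall>i\<in>I. deck i (g i) \<and> g i (a x i) = a y i" by metis
    have "\<phi> i j (g j z) = g i (\<phi> i j z)" if ij: "i \<in> I" "j \<in> I" "prec i j" and z: "z \<in> gset (X j)" for i j z
    proof (rule deck_\<phi>[OF ij _ _ a_gset[OF ij(2) xy(1)] _ z])
      show "\<phi> i j (g j (a x j)) = g i (\<phi> i j (a x j))"
        using g ij a_comm[OF ij xy(1)] a_comm[OF ij xy(2)] by simp
    qed (use g ij in auto)
    then show ?thesis using lift_family[of g] g unfolding deck_def by blast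
  qed
  obtain g \<alpha> where g: "\<forall>i\<in>I. deck i (g i) \<and> g i (a x i) = a y i" and \<alpha>: "graph_map \<Gamma> \<Gamma> \<alpha>"
    "continuous_map (gtop \<Gamma>) (gtop \<Gamma>) \<alpha>" "\<forall>z\<in>gset \<Gamma>. \<forall>i\<in>I. a (\<alpha> z) i = g i (a z i)"
    using ex[OF x y xy] by blast
  obtain h \<beta> where h: "\<forall>i\<in>I. deck i (h i) \<and> h i (a y i) = a x i" and \<beta>: "graph_map \<Gamma> \<Gamma> \<beta>"
    "continuous_map (gtop \<Gamma>) (gtop \<Gamma>) \<beta>" "\<forall>z\<in>gset \<Gamma>. \<forall>i\<in>I. a (\<beta> z) i = h i (a z i)"
    using ex[OF y x xy[symmetric]] by blast
  \<comment> \<open>Each composite is a deck map that fixes the coordinate of \<open>x\<close> or of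
    \<open>y\<close>, hence agrees with the identity on the connected level.\<close>
  have hg: "h i (g i z) = z" "g i (h i z) = z" if i: "i \<in> I" and z: "z \<in> gset (X i)" for i z
  proof -
    have "deck i (g i)" "deck i (h i)" using g h i by auto
    note d = deck_comp[OF this] deck_comp[OF this(2,1)]
    show "h i (g i z) = z"
      by (rule deck_unique[OF i d(2) deck_id a_gset[OF i x] _ z]) (use g h i in auto)
    show "g i (h i z) = z"
      by (rule deck_unique[OF i d(1) deck_id a_gset[OF i y] _ z]) (use g h i in auto)
  qed
  have inv: "\<beta> (\<alpha> z) = z" "\<alpha> (\<beta> z) = z" if z: "z \<in> gset \<Gamma>" for z
  proof -
    have m: "\<alpha> z \<in> gset \<Gamma>" "\<beta> z \<in> gset \<Gamma>" using graph_mapD(6)[OF \<alpha>(1) z] graph_mapD(6)[OF \<beta>(1) z] .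
    show "\<beta> (\<alpha> z) = z"
      by (rule a_inj) (use graph_mapD(6)[OF \<beta>(1) m(1)] z \<alpha>(3) \<beta>(3) m hg a_gset[OF _ z] in auto)
    show "\<alpha> (\<beta> z) = z"
      by (rule a_inj) (use graph_mapD(6)[OF \<alpha>(1) m(2)] z \<alpha>(3) \<beta>(3) m hg a_gset[OF _ z] in auto)
  qed
  have over: "f (\<alpha> z) = f z" if z: "z \<in> gset \<Gamma>" for z
  proof (rule b_inj)
    have m: "\<alpha> z \<in> gset \<Gamma>" using graph_mapD(6)[OF \<alpha>(1) z] .
    show "f (\<alpha> z) \<in> gset \<Delta>" "f z \<in> gset \<Delta>" using graph_mapD(6)[OF f_map] m z by blast+
    fix i assume i: "i \<in> I"
    then show "b (f (\<alpha> z)) i = b (f z) i"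
      using b_f[OF i m] b_f[OF i z] \<alpha>(3) z g a_gset[OF i z] by (simp add: deck_def)
  qed
  let ?\<alpha> = "restrict \<alpha> (gset \<Gamma>)"
  have "graph_map \<Gamma> \<Gamma> ?\<alpha>"
    using \<alpha>(1) is_graphD(2-4)[OF \<Gamma>_simps(1)] by (auto simp: graph_map_def gset_def)
  moreover have "?\<alpha> \<in> Bij (gset \<Gamma>)"
  proof -
    have "bij_betw \<alpha> (gset \<Gamma>) (gset \<Gamma>)"
      by (rule bij_betw_byWitness[of _ \<beta>]) (use inv graph_mapD(6)[OF \<alpha>(1)] graph_mapD(6)[OF \<beta>(1)] in auto)
    then show ?thesis by (simp add: Bij_def)
  qed
  moreover have "homeomorphic_map (gtop \<Gamma>) (gtop \<Gamma>) ?\<alpha>"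
  proof -
    have "homeomorphic_maps (gtop \<Gamma>) (gtop \<Gamma>) \<alpha> \<beta>"
      using \<alpha>(2) \<beta>(2) inv by (simp add: homeomorphic_maps_def \<Gamma>_simps(4))
    then have "homeomorphic_map (gtop \<Gamma>) (gtop \<Gamma>) \<alpha>" using homeomorphic_map_maps by blast
    then show ?thesis by (rule homeomorphic_map_eq) (simp add: \<Gamma>_simps(4))
  qed
  ultimately have "?\<alpha> \<in> carrier G" using over by (simp add: Aut_carrier)
  moreover have "\<alpha> x = y"
    by (rule a_inj) (use graph_mapD(6)[OF \<alpha>(1) x] y \<alpha>(3) g x in auto)
  then have "?\<alpha> x = y" using x by simp
  ultimately show ?thesis by blast
qed

text \<open>Connectedness of \<open>\<Gamma>\<close> makes every automorphism over \<open>\<Delta>\<close> descend to each level \<open>X i\<close>, although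
  the projection of \<open>\<Gamma>\<close> to \<open>X i\<close> need not be surjective.\<close>

lemma G_descends:
  assumes \<alpha>: "\<alpha> \<in> carrier G" and i: "i \<in> I"
  shows "\<exists>g. deck i g \<and> (\<forall>x\<in>gset \<Gamma>. a (\<alpha> x) i = g (a x i))"
proof -
  obtain x0 where x0: "x0 \<in> verts \<Gamma>" using connected_profinite_vertex[OF \<Gamma>] by blast
  then have x0g: "x0 \<in> gset \<Gamma>" by (rule gsetI)
  note \<alpha>m = G_D[OF \<alpha>]
  obtain g where g: "deck i g" "g (a x0 i) = a (\<alpha> x0) i"
    using F_deck[OF i a_gset[OF i x0g] a_gset[OF i \<alpha>m(4)[OF x0g]] F_a[OF \<alpha> i x0g]]
    unfolding deck_def by blast
  have gm: "graph_map (X i) (X i) g" using g(1) by (simp add: deck_def)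
  have "cont_graph_map \<Gamma> (X i) (\<lambda>x. a (\<alpha> x) i)"
    using graph_map_comp[OF \<alpha>m(1) a_map[OF i]] continuous_map_compose[OF \<alpha>m(2), of "gtop (X i)" "\<lambda>x. a x i"]
      a_cont[OF i] by (simp add: cont_graph_map_def o_def)
  \<comment> \<open>Vertices related by this entourage have the same coordinate at \<open>i\<close>
    both before and after \<alpha>, so the identity \<open>a (\<alpha> v) i = g (a v i)\<close>
    passes from one to the other, as the induction along edges requires.\<close>
  then have R: "fiber_rel (gset \<Gamma>) (\<lambda>x. a x i) \<inter> fiber_rel (gset \<Gamma>) (\<lambda>x. a (\<alpha> x) i) \<in> cofinite_entourages \<Gamma>"
    using cofinite_entourages_Int[OF \<Gamma>_profinite] fiber_rel_cofinite_entourage[OF \<Gamma>_profinite X_disc[OF i]]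
      a_cont[OF i] by blast
  \<comment> \<open>The two edges have the same source and, as \<alpha> and \<open>g\<close> both
    lie over the base, the same image in \<open>Y i\<close>.\<close>
  have E: "a (\<alpha> e) i = g (a e i)" if e: "e \<in> edges \<Gamma>" and s: "a (\<alpha> (src \<Gamma> e)) i = g (a (src \<Gamma> e) i)" for e
  proof (rule graph_covering.edge_unique[OF F_cov[OF i]])
    note m = graph_mapD[OF a_map[OF i]]
    show "a (\<alpha> e) i \<in> edges (X i)" using m(2) graph_mapD(2)[OF \<alpha>m(1) e] .
    show "g (a e i) \<in> edges (X i)" using graph_mapD(2)[OF gm m(2)[OF e]] .
    show "src (X i) (a (\<alpha> e) i) = src (X i) (g (a e i))"
      using s m(3)[OF e] m(3)[OF graph_mapD(2)[OF \<alpha>m(1) e]] graph_mapD(3)[OF gm m(2)[OF e]]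
        graph_mapD(3)[OF \<alpha>m(1) e] by simp
    show "F i (a (\<alpha> e) i) = F i (g (a e i))"
      using F_a[OF \<alpha> i gsetI(2)[OF e]] g(1) a_gset[OF i gsetI(2)[OF e]] by (simp add: deck_def)
  qed
  have V: "a (\<alpha> v) i = g (a v i)" if v: "v \<in> verts \<Gamma>" for v
  proof (rule connected_profinite_induct[OF \<Gamma> R, where P = "\<lambda>v. a (\<alpha> v) i = g (a v i)" and v = x0])
    fix e assume e: "e \<in> edges \<Gamma>" and s: "a (\<alpha> (src \<Gamma> e)) i = g (a (src \<Gamma> e) i)"
    note m = graph_mapD[OF a_map[OF i]]
    show "a (\<alpha> (tgt \<Gamma> e)) i = g (a (tgt \<Gamma> e) i)"
      using E[OF e s] m(4)[OF e] m(4)[OF graph_mapD(2)[OF \<alpha>m(1) e]] graph_mapD(4)[OF gm m(2)[OF e]]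
        graph_mapD(4)[OF \<alpha>m(1) e] by simp
  qed (use x0 g(2) v in \<open>auto simp: fiber_rel_def\<close>)
  have "a (\<alpha> x) i = g (a x i)" if "x \<in> gset \<Gamma>" for x
    using that V E is_graphD(2)[OF \<Gamma>_simps(1)] by (auto simp: gset_def)
  then show ?thesis using g(1) by blast
qed

section \<open>The action of the automorphism group on each level\<close>

text \<open>The choice is harmless: on \<open>gset (X i)\<close> a deck map is determined by its
  value at the coordinate of one point of \<Gamma>, see \<open>D_eq\<close>.\<close>

definition D :: "'i \<Rightarrow> ('a \<Rightarrow> 'a) \<Rightarrow> nat \<Rightarrow> nat" where
  "D i \<alpha> = (SOME g. deck i g \<and> (\<forall>x\<in>gset \<Gamma>. a (\<alpha> x) i = g (a x i)))"

lemma D: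
  assumes "\<alpha> \<in> carrier G" "i \<in> I"
  shows D_deck: "deck i (D i \<alpha>)" and D_a: "x \<in> gset \<Gamma> \<Longrightarrow> a (\<alpha> x) i = D i \<alpha> (a x i)"
  using someI_ex[OF G_descends[OF assms]] unfolding D_def by blast+

lemma \<Gamma>_point: obtains x where "x \<in> gset \<Gamma>"
  using connected_profinite_vertex[OF \<Gamma>] unfolding gset_def by blast

lemma D_eq:
  assumes "\<alpha> \<in> carrier G" "i \<in> I" "deck i g" "x \<in> gset \<Gamma>" "a (\<alpha> x) i = g (a x i)" "z \<in> gset (X i)"
  shows "D i \<alpha> z = g z"
  by (rule deck_unique[OF assms(2) D_deck[OF assms(1,2)] assms(3) a_gset[OF assms(2,4)] _ assms(6)])
    (use D_a[OF assms(1,2,4)] assms(5) in simp)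

lemma D_\<phi>:
  assumes \<alpha>: "\<alpha> \<in> carrier G" and ij: "i \<in> I" "j \<in> I" "prec i j" and z: "z \<in> gset (X j)"
  shows "\<phi> i j (D j \<alpha> z) = D i \<alpha> (\<phi> i j z)"
proof -
  obtain x where x: "x \<in> gset \<Gamma>" by (rule \<Gamma>_point)
  show ?thesis
    by (rule deck_\<phi>[OF ij D_deck[OF \<alpha> ij(2)] D_deck[OF \<alpha> ij(1)] a_gset[OF ij(2) x] _ z])
      (use a_comm[OF ij x] a_comm[OF ij G_D(4)[OF \<alpha> x]] D_a[OF \<alpha> ij(1) x] D_a[OF \<alpha> ij(2) x] in simp)
qed

text \<open>The action laws hold because both sides are deck maps that agree at the coordinate of
  one point of \<Gamma>. Freeness is comparison with the identity, and an inversion of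
  \<open>e\<close> would make \<open>F i e\<close> its own reverse.\<close>

lemma action:
  assumes i: "i \<in> I"
  shows "free_graph_action G (X i) (D i)"
proof -
  obtain x0 where x0: "x0 \<in> gset \<Gamma>" by (rule \<Gamma>_point)
  show ?thesis
  proof unfold_locales
    show "is_graph (X i)" "finite (gset (X i))" "graph_path_connected (X i)"
      using X_graph X_fin X_conn i by blast+
    fix \<alpha> assume \<alpha>: "\<alpha> \<in> carrier G"
    note d = D_deck[OF \<alpha> i]
    show m: "graph_map (X i) (X i) (D i \<alpha>)" using d by (simp add: deck_def)
    show "D i \<alpha> e \<noteq> bar (X i) e" if e: "e \<in> edges (X i)" for e
    proof
      assume eq: "D i \<alpha> e = bar (X i) e"
      have "F i (D i \<alpha> e) = F i e" using d gsetI(2)[OF e] by (simp add: deck_def)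
      then have "F i e = bar (Y i) (F i e)" using graph_mapD(5)[OF F_map[OF i] e] eq by simp
      then show False using is_graphD(6)[OF Y_graph[OF i] graph_mapD(2)[OF F_map[OF i] e]] by simp
    qed
    show "D i \<alpha> y = y" if "x \<in> gset (X i)" "D i \<alpha> x = x" "y \<in> gset (X i)" for x y
      using deck_unique[OF i d deck_id that] .
    fix \<beta> x assume \<beta>: "\<beta> \<in> carrier G" and x: "x \<in> gset (X i)"
    show "D i (\<alpha> \<otimes>\<^bsub>G\<^esub> \<beta>) x = D i \<alpha> (D i \<beta> x)"
      by (rule D_eq[OF _ i deck_comp[OF d D_deck[OF \<beta> i]] x0 _ x])
        (use \<alpha> \<beta> G_mult x0 D_a i G_D(4) in simp_all)
  next
    fix x assume x: "x \<in> gset (X i)"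
    show "D i \<one>\<^bsub>G\<^esub> x = x"
      by (rule D_eq[OF _ i deck_id x0 _ x]) (use G_one x0 in simp_all)
  qed
qed

section \<open>Closed subgroups as limits of their images\<close>

text \<open>Otherwise the complement of \<open>H\<close> is an open neighbourhood of
  \<open>g\<close>, so for some level \<open>i\<close> it contains every automorphism that agrees
  with \<open>g\<close> there. By \<open>lim\<close>, one of these lies in \<open>H\<close>.\<close>

lemma closed_subgroup_limit:
  assumes H: "closedin (Aut_topology \<Gamma> f) H" and g: "g \<in> carrier G"
    and lim: "\<And>i. i \<in> I \<Longrightarrow> \<exists>h\<in>H. h \<in> carrier G \<and> (\<forall>x\<in>gset \<Gamma>. a (g x) i = a (h x) i)"
  shows "g \<in> H"
proof (rule ccontr)
  assume gH: "g \<notin> H"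
  let ?B = "{g <#\<^bsub>G\<^esub> congruence_subgroup \<Gamma> f R | g R. g \<in> carrier G \<and> R \<in> invariant_entourages \<Gamma> f}"
  have T: "topspace (Aut_topology \<Gamma> f) = \<Union>?B" by (simp add: Aut_topology_def)
  \<comment> \<open>The cosets are treated as a subbase only, so the claim is proved along the
    generation of open sets; an intersection is handled by a level above the two given ones.\<close>
  have open_nbhd: "\<exists>i\<in>I. \<forall>g'\<in>carrier G. (\<forall>x\<in>gset \<Gamma>. a (g x) i = a (g' x) i) \<longrightarrow> g' \<in> U"
    if "generate_topology_on ?B U" "g \<in> U" for U
    using that
  proof (induction)
    case (Int U V)
    then obtain i j where ij: "i \<in> I" "j \<in> I"
      "\<forall>g'\<in>carrier G. (\<forall>x\<in>gset \<Gamma>. a (g x) i = a (g' x) i) \<longrightarrow> g' \<in> U"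
      "\<forall>g'\<in>carrier G. (\<forall>x\<in>gset \<Gamma>. a (g x) j = a (g' x) j) \<longrightarrow> g' \<in> V" by blast
    obtain k where k: "k \<in> I" "prec i k" "prec j k" using prec_directed ij(1,2) by blast
    have L: "a (g x) l = a (g' x) l"
      if "g' \<in> carrier G" "x \<in> gset \<Gamma>" "a (g x) k = a (g' x) k" "l \<in> I" "prec l k" for g' x l
      using a_comm[OF that(4) k(1) that(5) G_D(4)[OF g that(2)]]
        a_comm[OF that(4) k(1) that(5) G_D(4)[OF that(1,2)]] that(3) by simp
    show ?case
    proof (intro bexI[of _ k] ballI impI k(1))
      fix g' assume g': "g' \<in> carrier G" "\<forall>x\<in>gset \<Gamma>. a (g x) k = a (g' x) k"
      have "g' \<in> U" using ij(3) g' L[OF g'(1) _ _ ij(1) k(2)] by simp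
      moreover have "g' \<in> V" using ij(4) g' L[OF g'(1) _ _ ij(2) k(3)] by simp
      ultimately show "g' \<in> U \<inter> V" by blast
    qed
  next
    case (UN K)
    then show ?case by blast
  next
    case (Basis U)
    then obtain k R where U: "U = k <#\<^bsub>G\<^esub> congruence_subgroup \<Gamma> f R" and k: "k \<in> carrier G"
      and R: "R \<in> invariant_entourages \<Gamma> f" by blast
    have Re: "R \<in> sep.fiber_uniformity" and "compatible \<Gamma> R"
      using R by (simp_all add: invariant_entourages_def cofinite_entourages_def sep.entourages)
    then have eq: "equiv (gset \<Gamma>) R" by (simp add: compatible_def)
    obtain i where i: "i \<in> I" "fiber_rel (gset \<Gamma>) (\<lambda>x. a x i) \<subseteq> R"
      using Re unfolding sep.fiber_uniformity_def by blast
    obtain n where n: "n \<in> carrier G" "g = k \<otimes>\<^bsub>G\<^esub> n" "\<forall>x\<in>gset \<Gamma>. (n x, x) \<in> R"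
      using Basis(2) U by (auto simp: l_coset_def congruence_subgroup_def)
    have "g' \<in> U" if g': "g' \<in> carrier G" "\<forall>x\<in>gset \<Gamma>. a (g x) i = a (g' x) i" for g'
    proof -
      \<comment> \<open>Left multiplication acts on coordinates through \<open>D i\<close>, so
        \<open>g\<close> and \<open>g'\<close> still agree at level \<open>i\<close> after
        translation by the inverse of \<open>k\<close>. The translate of \<open>g\<close> is
        \<open>n\<close>, which is close to the identity with respect to \<open>R\<close>.\<close>
      let ?n = "inv\<^bsub>G\<^esub> k \<otimes>\<^bsub>G\<^esub> g'"
      have ik: "inv\<^bsub>G\<^esub> k \<in> carrier G" using k by simp
      have nG: "?n \<in> carrier G" using g'(1) k by simp
      have "(?n x, x) \<in> R" if x: "x \<in> gset \<Gamma>" for x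
      proof -
        have "inv\<^bsub>G\<^esub> k \<otimes>\<^bsub>G\<^esub> g = n" unfolding n(2) using n(1) k by (simp flip: G.m_assoc)
        then have "n x = (inv\<^bsub>G\<^esub> k) (g x)" using G_mult[OF ik g x] by simp
        then have "a (n x) i = D i (inv\<^bsub>G\<^esub> k) (a (g x) i)" using D_a[OF ik i(1) G_D(4)[OF g x]] by simp
        also have "\<dots> = a (?n x) i"
          using D_a[OF ik i(1) G_D(4)[OF g'(1) x]] g'(2) x G_mult[OF ik g'(1) x] by simp
        finally have "(?n x, n x) \<in> R"
          using i(2) G_D(4)[OF n(1) x] G_D(4)[OF nG x] by (auto simp: fiber_rel_def)
        then show ?thesis using n(3) x eq unfolding equiv_def trans_def by blast
      qed
      then have "?n \<in> congruence_subgroup \<Gamma> f R" using nG by (simp add: congruence_subgroup_def)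
      moreover have "g' = k \<otimes>\<^bsub>G\<^esub> ?n" using k g'(1) by (simp add: G.inv_solve_left flip: G.m_assoc)
      ultimately show ?thesis unfolding U l_coset_def by blast
    qed
    then show ?case using i(1) by blast
  qed simp
  \<comment> \<open>The kernel of one coordinate is invariant, as the group acts on that coordinate
    through \<open>D i\<close>, and so it yields a generating coset around \<open>g\<close>.\<close>
  have "g \<in> \<Union>?B"
  proof -
    obtain i where i: "i \<in> I" using I_nonempty by blast
    let ?R = "fiber_rel (gset \<Gamma>) (\<lambda>x. a x i)"
    have "map_prod \<alpha> \<alpha> ` ?R = ?R" if \<alpha>: "\<alpha> \<in> carrier G" for \<alpha>
    proof -
      have sub: "map_prod \<beta> \<beta> ` ?R \<subseteq> ?R" if "\<beta> \<in> carrier G" for \<beta>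
        using G_D(4)[OF that] D_a[OF that i] by (auto simp: fiber_rel_def)
      have \<alpha>i: "inv\<^bsub>G\<^esub> \<alpha> \<in> carrier G" using \<alpha> by simp
      have inv: "\<alpha> ((inv\<^bsub>G\<^esub> \<alpha>) x) = x" if "x \<in> gset \<Gamma>" for x
        using G_mult[OF \<alpha> \<alpha>i that] \<alpha> G_one[OF that] by simp
      have "?R \<subseteq> map_prod \<alpha> \<alpha> ` ?R"
      proof
        fix p assume p: "p \<in> ?R"
        then have "map_prod (inv\<^bsub>G\<^esub> \<alpha>) (inv\<^bsub>G\<^esub> \<alpha>) p \<in> ?R" using sub[OF \<alpha>i] by blast
        moreover have "p = map_prod \<alpha> \<alpha> (map_prod (inv\<^bsub>G\<^esub> \<alpha>) (inv\<^bsub>G\<^esub> \<alpha>) p)"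
          using p inv by (cases p) (auto simp: fiber_rel_def)
        ultimately show "p \<in> map_prod \<alpha> \<alpha> ` ?R" by (metis imageI)
      qed
      then show ?thesis using sub[OF \<alpha>] by blast
    qed
    then have "?R \<in> invariant_entourages \<Gamma> f"
      using fiber_rel_cofinite_entourage[OF \<Gamma>_profinite X_disc[OF i] a_cont[OF i]]
      by (simp add: invariant_entourages_def)
    moreover have "\<one>\<^bsub>G\<^esub> \<in> congruence_subgroup \<Gamma> f ?R"
      by (simp add: congruence_subgroup_def G_one fiber_rel_def)
    then have "g \<in> g <#\<^bsub>G\<^esub> congruence_subgroup \<Gamma> f ?R" using g by (force simp: l_coset_def)
    ultimately show ?thesis using g by blast
  qed
  then have "g \<in> topspace (Aut_topology \<Gamma> f) - H" using gH T by blast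
  moreover have "generate_topology_on ?B (topspace (Aut_topology \<Gamma> f) - H)"
    using H unfolding closedin_def Aut_topology_def openin_topology_generated_by_iff by blast
  ultimately obtain i where "i \<in> I"
    "\<forall>g'\<in>carrier G. (\<forall>x\<in>gset \<Gamma>. a (g x) i = a (g' x) i) \<longrightarrow> g' \<in> topspace (Aut_topology \<Gamma> f) - H"
    using open_nbhd by blast
  then show False using lim by blast
qed

end

section \<open>Quotients by closed subgroups\<close>

lemma cont_graph_map_finite_discrete:
  assumes "finite_discrete_graph A" "finite_discrete_graph B" "graph_map A B h"
  shows "cont_graph_map A B h"
  using assms graph_mapD(6)[OF assms(3)] by (auto simp: cont_graph_map_def finite_discrete_graph_def)

context regular_covering_system
begin

abbreviation rep :: "'i \<Rightarrow> ('a \<Rightarrow> 'a) set \<Rightarrow> nat \<Rightarrow> nat" where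
  "rep i \<equiv> free_graph_action.rep (D i)"

abbreviation level :: "('a \<Rightarrow> 'a) set \<Rightarrow> 'i \<Rightarrow> nat top_graph" where
  "level H i \<equiv> free_graph_action.quot (X i) (D i) H"

text \<open>A bonding map need not send least elements of orbits to least elements, so its value is
  normalized by \<open>rep i H\<close>.\<close>

abbreviation bond :: "('a \<Rightarrow> 'a) set \<Rightarrow> 'i \<Rightarrow> 'i \<Rightarrow> nat \<Rightarrow> nat" where
  "bond H i j \<equiv> (\<lambda>x. rep i H (\<phi> i j x))"

text \<open>\<open>limit_closed H\<close> says that the subgroup \<open>H\<close> is the inverse limit of its images in the finite
  deck groups.\<close>

definition limit_closed :: "('a \<Rightarrow> 'a) set \<Rightarrow> bool" where
  "limit_closed H \<longleftrightarrow> subgroup H G \<and>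
    (\<forall>g\<in>carrier G. (\<forall>i\<in>I. \<exists>h\<in>H. \<forall>x\<in>gset \<Gamma>. a (g x) i = a (h x) i) \<longrightarrow> g \<in> H)"

text \<open>Describes \<Gamma>/H up to isomorphism, on any carrier type. In this way \<Gamma>, the
  orbit graph and \<Delta> are all instances, for the trivial group, \<open>H\<close> and
  \<open>carrier G\<close>.\<close>

definition orbit_quotient :: "('a \<Rightarrow> 'a) set \<Rightarrow> 'c top_graph \<Rightarrow> ('a \<Rightarrow> 'c) \<Rightarrow> bool" where
  "orbit_quotient H Z q \<longleftrightarrow> is_graph Z \<and> topspace (gtop Z) = gset Z \<and>
    quotient_map (gtop \<Gamma>) (gtop Z) q \<and> graph_map \<Gamma> Z q \<and>
    verts Z \<subseteq> q ` verts \<Gamma> \<and> edges Z \<subseteq> q ` edges \<Gamma> \<and>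
    (\<forall>x\<in>gset \<Gamma>. \<forall>y\<in>gset \<Gamma>. q x = q y \<longleftrightarrow> (\<exists>h\<in>H. y = h x))"

text \<open>The orbit of the level coordinate, read off at an arbitrary preimage in \<Gamma>; by
  \<open>coord_q\<close> the choice of preimage does not matter.\<close>

definition coord :: "('a \<Rightarrow> 'a) set \<Rightarrow> ('a \<Rightarrow> 'c) \<Rightarrow> 'i \<Rightarrow> 'c \<Rightarrow> nat" where
  "coord H q i z = rep i H (a (inv_into (gset \<Gamma>) q z) i)"

section \<open>The inverse system of quotient levels\<close>

text \<open>Bonding maps are equivariant (\<open>D_\<phi>\<close>), so moving a point within its
  orbit at \<open>j\<close> moves its image within its orbit at \<open>i\<close>.\<close>

lemma rep_bond:
  assumes H: "subgroup H G" and ij: "i \<in> I" "j \<in> I" "prec i j" and x: "x \<in> gset (X j)"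
  shows "rep i H (\<phi> i j (rep j H x)) = rep i H (\<phi> i j x)"
proof -
  obtain h where h: "h \<in> H" "rep j H x = D j h x"
    using free_graph_action.rep_orbit[OF action[OF ij(2)] H x] by blast
  have "h \<in> carrier G" using subgroup.mem_carrier[OF H h(1)] .
  then show ?thesis
    unfolding h(2) using D_\<phi>[OF _ ij x]
      free_graph_action.rep_D[OF action[OF ij(1)] H graph_mapD(6)[OF \<phi>_map[OF ij] x] h(1)] by simp
qed

lemma level_gset:
  assumes H: "subgroup H G" and i: "i \<in> I"
  shows "gset (level H i) \<subseteq> gset (X i)"
  using free_graph_action.rep_gset[OF action[OF i] H]
  by (auto simp: free_graph_action.gset_quot[OF action[OF i]])

lemma level_rep:
  assumes H: "subgroup H G" and i: "i \<in> I" and x: "x \<in> gset (level H i)"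
  shows "rep i H x = x"
  using x free_graph_action.rep_rep[OF action[OF i] H]
  by (auto simp: free_graph_action.gset_quot[OF action[OF i]])

lemma level_disc:
  assumes "subgroup H G" "i \<in> I"
  shows "finite_discrete_graph (level H i)"
  using free_graph_action.quot_finite_discrete[OF action assms(1)] assms(2) by blast

lemma bond_map:
  assumes H: "subgroup H G" and ij: "i \<in> I" "j \<in> I" "prec i j"
  shows "graph_map (level H j) (level H i) (bond H i j)"
proof -
  interpret i: free_graph_action G "X i" "D i" using action[OF ij(1)] .
  interpret j: free_graph_action G "X j" "D j" using action[OF ij(2)] .
  note m = graph_mapD[OF \<phi>_map[OF ij]]
  note sub = j.rep_verts[OF H] j.rep_edges[OF H]
  show ?thesis
  proof (rule graph_mapI)
    fix v assume "v \<in> verts (level H j)"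
    then have "v \<in> verts (X j)" using sub by (auto simp: j.quot_def)
    then show "i.rep H (\<phi> i j v) \<in> verts (level H i)" using m(1) by (auto simp: i.quot_def)
  next
    fix e assume "e \<in> edges (level H j)"
    then have e: "e \<in> edges (X j)" using sub by (auto simp: j.quot_def)
    then show "i.rep H (\<phi> i j e) \<in> edges (level H i)" using m(2) by (auto simp: i.quot_def)
    note b = rep_bond[OF H ij] and g = is_graphD(2-4)[OF X_graph[OF ij(2)] e]
    show "i.rep H (\<phi> i j (src (level H j) e)) = src (level H i) (i.rep H (\<phi> i j e))"
      using b[OF gsetI(1)[OF g(1)]] i.rep_ends(1)[OF H m(2)[OF e]] m(3)[OF e]
      by (simp add: i.quot_def j.quot_def)
    show "i.rep H (\<phi> i j (tgt (level H j) e)) = tgt (level H i) (i.rep H (\<phi> i j e))"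
      using b[OF gsetI(1)[OF g(2)]] i.rep_ends(2)[OF H m(2)[OF e]] m(4)[OF e]
      by (simp add: i.quot_def j.quot_def)
    show "i.rep H (\<phi> i j (bar (level H j) e)) = bar (level H i) (i.rep H (\<phi> i j e))"
      using b[OF gsetI(2)[OF g(3)]] i.rep_ends(3)[OF H m(2)[OF e]] m(5)[OF e]
      by (simp add: i.quot_def j.quot_def)
  qed
qed

lemma level_system:
  assumes H: "subgroup H G"
  shows "inverse_system I prec (level H) (bond H)"
  unfolding inverse_system_def
proof (intro conjI ballI impI)
  fix i j assume ij: "i \<in> I" "j \<in> I" "prec i j"
  show "cont_graph_map (level H j) (level H i) (bond H i j)"
    by (rule cont_graph_map_finite_discrete[OF level_disc[OF H ij(2)] level_disc[OF H ij(1)] bond_map[OF H ij]])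
next
  fix i x assume i: "i \<in> I" and x: "x \<in> gset (level H i)"
  then show "bond H i i x = x" using \<phi>_id[OF i] level_gset[OF H i] level_rep[OF H i x] by auto
next
  fix i j k x assume ijk: "i \<in> I" "j \<in> I" "k \<in> I" "prec i j \<and> prec j k" and x: "x \<in> gset (level H k)"
  have x': "x \<in> gset (X k)" using level_gset[OF H ijk(3)] x by blast
  then show "bond H i j (bond H j k x) = bond H i k x"
    using rep_bond[OF H ijk(1,2) _ graph_mapD(6)[OF \<phi>_map[OF ijk(2,3)] x']] \<phi>_comp[OF ijk(1,2,3) _ _ x'] ijk(4)
    by simp
qed

section \<open>Coordinates on an orbit quotient\<close>

lemma orbit_quotientD:
  assumes "orbit_quotient H Z q"
  shows "is_graph Z" "topspace (gtop Z) = gset Z" "quotient_map (gtop \<Gamma>) (gtop Z) q" "graph_map \<Gamma> Z q"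
    "v \<in> verts Z \<Longrightarrow> \<exists>x\<in>verts \<Gamma>. v = q x" "e \<in> edges Z \<Longrightarrow> \<exists>x\<in>edges \<Gamma>. e = q x"
    "x \<in> gset \<Gamma> \<Longrightarrow> y \<in> gset \<Gamma> \<Longrightarrow> q x = q y \<longleftrightarrow> (\<exists>h\<in>H. y = h x)"
    "z \<in> gset Z \<Longrightarrow> \<exists>x\<in>gset \<Gamma>. z = q x"
  using assms unfolding orbit_quotient_def gset_def by blast+

lemma coord_q:
  assumes H: "subgroup H G" and Z: "orbit_quotient H Z q" and i: "i \<in> I" and x: "x \<in> gset \<Gamma>"
  shows "coord H q i (q x) = rep i H (a x i)"
proof -
  let ?y = "inv_into (gset \<Gamma>) q (q x)"
  have y: "?y \<in> gset \<Gamma>" "q ?y = q x" using x by (auto intro: inv_into_into f_inv_into_f)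
  then obtain h where h: "h \<in> H" "x = h ?y" using orbit_quotientD(7)[OF Z y(1) x] by blast
  have "a x i = D i h (a ?y i)" using D_a[OF subgroup.mem_carrier[OF H h(1)] i y(1)] h(2) by simp
  then show ?thesis
    using free_graph_action.rep_D[OF action[OF i] H a_gset[OF i y(1)] h(1)] by (simp add: coord_def)
qed

text \<open>Continuity is tested after composing with the quotient map \<open>q\<close>, where the
  coordinate becomes the continuous map \<open>\<lambda>x. rep i H (a x i)\<close>.\<close>

lemma coord_cont:
  assumes H: "subgroup H G" and Z: "orbit_quotient H Z q" and i: "i \<in> I"
  shows "cont_graph_map Z (level H i) (coord H q i)"
  unfolding cont_graph_map_def
proof
  interpret i: free_graph_action G "X i" "D i" using action[OF i] .
  note c = coord_q[OF H Z i] and z = orbit_quotientD[OF Z]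
  have m: "graph_map \<Gamma> (level H i) (\<lambda>x. rep i H (a x i))"
    by (rule graph_map_comp[OF a_map[OF i] i.rep_map[OF H]])
  show "graph_map Z (level H i) (coord H q i)"
  proof (rule graph_mapI)
    fix v assume "v \<in> verts Z"
    then obtain x where x: "x \<in> verts \<Gamma>" "v = q x" using z(5) by blast
    then show "coord H q i v \<in> verts (level H i)" using c[OF gsetI(1)] graph_mapD(1)[OF m] by simp
  next
    fix e assume "e \<in> edges Z"
    then obtain x where x: "x \<in> edges \<Gamma>" "e = q x" using z(6) by blast
    note cx = c[OF gsetI(2)[OF x(1)]] and g = is_graphD(2-4)[OF \<Gamma>_simps(1) x(1)]
    show "coord H q i e \<in> edges (level H i)" using cx x graph_mapD(2)[OF m] by simp
    show "coord H q i (src Z e) = src (level H i) (coord H q i e)"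
      unfolding x(2) graph_mapD(3)[OF z(4) x(1), symmetric] cx c[OF gsetI(1)[OF g(1)]]
      by (rule graph_mapD(3)[OF m x(1)])
    show "coord H q i (tgt Z e) = tgt (level H i) (coord H q i e)"
      unfolding x(2) graph_mapD(4)[OF z(4) x(1), symmetric] cx c[OF gsetI(1)[OF g(2)]]
      by (rule graph_mapD(4)[OF m x(1)])
    show "coord H q i (bar Z e) = bar (level H i) (coord H q i e)"
      unfolding x(2) graph_mapD(5)[OF z(4) x(1), symmetric] cx c[OF gsetI(2)[OF g(3)]]
      by (rule graph_mapD(5)[OF m x(1)])
  qed
  have "continuous_map (gtop (X i)) (gtop (level H i)) (rep i H)"
    using cont_graph_map_finite_discrete[OF X_disc[OF i] level_disc[OF H i] i.rep_map[OF H]]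
    by (simp add: cont_graph_map_def)
  then have "continuous_map (gtop \<Gamma>) (gtop (level H i)) (\<lambda>x. rep i H (a x i))"
    using continuous_map_compose[of "gtop \<Gamma>" "gtop (X i)" "\<lambda>x. a x i"] a_cont[OF i]
    by (simp add: cont_graph_map_def o_def)
  then have "continuous_map (gtop \<Gamma>) (gtop (level H i)) (coord H q i \<circ> q)"
    by (rule continuous_map_eq) (simp add: c \<Gamma>_simps(4))
  then show "continuous_map (gtop Z) (gtop (level H i)) (coord H q i)"
    by (rule continuous_compose_quotient_map[OF z(3)])
qed

lemma coord_comm:
  assumes H: "subgroup H G" and Z: "orbit_quotient H Z q" and ij: "i \<in> I" "j \<in> I" "prec i j"
    and z: "z \<in> gset Z"
  shows "bond H i j (coord H q j z) = coord H q i z"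
proof -
  obtain x where x: "x \<in> gset \<Gamma>" "z = q x" using orbit_quotientD(8)[OF Z z] by blast
  show ?thesis
    unfolding x(2) coord_q[OF H Z ij(1) x(1)] coord_q[OF H Z ij(2) x(1)]
    using rep_bond[OF H ij a_gset[OF ij(2) x(1)]] a_comm[OF ij x(1)] by simp
qed

text \<open>Agreement at one point of \<Gamma> is agreement of two deck maps at one point of the
  level, hence everywhere on it.\<close>

lemma G_free:
  assumes "\<alpha> \<in> carrier G" "\<beta> \<in> carrier G" "i \<in> I" "x \<in> gset \<Gamma>" "a (\<alpha> x) i = a (\<beta> x) i" "y \<in> gset \<Gamma>"
  shows "a (\<alpha> y) i = a (\<beta> y) i"
  using D_eq[OF assms(1,3) D_deck[OF assms(2,3)] assms(4) _ a_gset[OF assms(3,6)]]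
    D_a[OF assms(1,3)] D_a[OF assms(2,3)] assms(4-6) by simp

text \<open>If \<open>x\<close> and \<open>y\<close> lie in the same orbit at every level, they lie in the same fiber of \<open>f\<close>, so
  \<open>y = g x\<close> for some \<open>g\<close> in \<open>G\<close>; by freeness \<open>g\<close> agrees at every level with an element of \<open>H\<close>.\<close>

lemma coord_inj:
  assumes H: "limit_closed H" and Z: "orbit_quotient H Z q" and z: "z \<in> gset Z" "w \<in> gset Z"
    and eq: "\<And>i. i \<in> I \<Longrightarrow> coord H q i z = coord H q i w"
  shows "z = w"
proof -
  have Hs: "subgroup H G" using H by (simp add: limit_closed_def)
  obtain x where x: "x \<in> gset \<Gamma>" "z = q x" using orbit_quotientD(8)[OF Z z(1)] by blast
  obtain y where y: "y \<in> gset \<Gamma>" "w = q y" using orbit_quotientD(8)[OF Z z(2)] by blast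
  have lev: "\<exists>h\<in>H. a y i = a (h x) i" if i: "i \<in> I" for i
  proof -
    have "rep i H (a x i) = rep i H (a y i)"
      using eq[OF i] coord_q[OF Hs Z i] x y by simp
    then obtain h where "h \<in> H" "a y i = D i h (a x i)"
      using free_graph_action.rep_eq_iff[OF action[OF i] Hs a_gset[OF i x(1)] a_gset[OF i y(1)]] by blast
    then show ?thesis using D_a[OF subgroup.mem_carrier[OF Hs] i x(1)] by auto
  qed
  have "f x = f y"
  proof (rule b_inj)
    show "f x \<in> gset \<Delta>" "f y \<in> gset \<Delta>" using graph_mapD(6)[OF f_map] x y by blast+
    fix i assume i: "i \<in> I"
    obtain h where h: "h \<in> H" "a y i = a (h x) i" using lev[OF i] by blast
    then show "b (f x) i = b (f y) i"
      using F_a[OF subgroup.mem_carrier[OF Hs h(1)] i x(1)] b_f[OF i x(1)] b_f[OF i y(1)] by simp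
  qed
  then obtain g where g: "g \<in> carrier G" "g x = y" using G_transitive[OF x(1) y(1)] by blast
  have "\<exists>h\<in>H. \<forall>u\<in>gset \<Gamma>. a (g u) i = a (h u) i" if i: "i \<in> I" for i
  proof -
    obtain h where h: "h \<in> H" "a y i = a (h x) i" using lev[OF i] by blast
    then show ?thesis
      using G_free[OF g(1) subgroup.mem_carrier[OF Hs h(1)] i x(1)] g(2) by blast
  qed
  then have "g \<in> H" using H g(1) unfolding limit_closed_def by blast
  then show ?thesis using orbit_quotientD(7)[OF Z x(1) y(1)] g(2) x(2) y(2) by blast
qed

text \<open>The orbits making up a thread form an inverse system of nonempty finite sets.\<close>

lemma level_thread_lift:
  assumes H: "subgroup H G" and S: "\<And>i. i \<in> I \<Longrightarrow> S i \<subseteq> gset (X i)"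
    and S_\<phi>: "\<And>i j x. i \<in> I \<Longrightarrow> j \<in> I \<Longrightarrow> prec i j \<Longrightarrow> x \<in> S j \<Longrightarrow> \<phi> i j x \<in> S i"
    and t: "t \<in> threads I prec (\<lambda>i. rep i H ` S i) (bond H)"
  shows "\<exists>s\<in>threads I prec S \<phi>. \<forall>i\<in>I. rep i H (s i) = t i"
proof -
  let ?S = "\<lambda>i. {x \<in> S i. rep i H x = t i}"
  have "threads I prec ?S \<phi> \<noteq> {}"
  proof (rule threads_nonempty[OF dir])
    fix i assume i: "i \<in> I"
    show "finite (?S i)" by (rule finite_subset[OF _ X_fin[OF i]]) (use S[OF i] in auto)
    have "t i \<in> rep i H ` S i" using t i by (auto simp: threads_def)
    then show "?S i \<noteq> {}" by auto
    show "\<phi> i i x = x" if "x \<in> ?S i" for x using that \<phi>_id[OF i] S[OF i] by blast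
    fix j assume j: "j \<in> I" and ij: "prec i j"
    have "rep i H (\<phi> i j x) = t i" if x: "x \<in> S j" "rep j H x = t j" for x
    proof -
      have "x \<in> gset (X j)" using S[OF j] x(1) by blast
      then have "rep i H (\<phi> i j x) = bond H i j (t j)" using rep_bond[OF H i j ij] x(2) by metis
      then show ?thesis using t i j ij by (auto simp: threads_def)
    qed
    then show "\<phi> i j x \<in> ?S i" if "x \<in> ?S j" for x using that S_\<phi>[OF i j ij] by blast
    show "\<phi> i j (\<phi> j k x) = \<phi> i k x" if "k \<in> I" "prec j k" "x \<in> ?S k" for k x
      using \<phi>_comp[OF i j that(1) ij that(2)] that(3) S[OF that(1)] by blast
  qed
  then obtain s where s: "s \<in> threads I prec ?S \<phi>" by blast
  have "s \<in> threads I prec S \<phi>" using s by (auto simp: threads_def PiE_def Pi_def)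
  moreover have "rep i H (s i) = t i" if "i \<in> I" for i
  proof -
    have "s i \<in> ?S i" using s that by (auto simp: threads_def)
    then show ?thesis by simp
  qed
  ultimately show ?thesis by blast
qed

text \<open>Coordinates separate points by \<open>coord_inj\<close>, where
  \<open>limit_closed\<close> enters. Every thread of orbits is hit: it lifts to a thread of points
  by \<open>level_thread_lift\<close>, and that one comes from a vertex or an edge of
  \<Gamma>.\<close>

lemma orbit_quotient_iso:
  assumes H: "limit_closed H" and Z: "orbit_quotient H Z q"
  shows "top_graph_iso Z (inverse_limit I prec (level H) (bond H)) (\<lambda>z. \<lambda>i\<in>I. coord H q i z)"
    and "profinite_graph Z"
proof -
  have Hs: "subgroup H G" using H by (simp add: limit_closed_def)
  note z = orbit_quotientD[OF Z]
  have "compact_space (gtop Z)"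
    using z(3) \<Gamma>_simps(2) image_compactin[of "gtop \<Gamma>" "topspace (gtop \<Gamma>)" "gtop Z" q]
      quotient_imp_continuous_map quotient_imp_surjective_map unfolding compact_space_def by metis
  note zc = z(1) this z(2)
  show "profinite_graph Z"
  proof (rule separating_family.profinite)
    show "separating_family Z I (level H) (coord H q)"
    proof
      fix i j assume ij: "i \<in> I" "j \<in> I"
      obtain k where k: "k \<in> I" "prec i k" "prec j k" using prec_directed ij by blast
      have "coord H q l u = coord H q l w"
        if "u \<in> gset Z" "w \<in> gset Z" "coord H q k u = coord H q k w" "l \<in> I" "prec l k" for u w l
        using coord_comm[OF Hs Z that(4) k(1) that(5,1)] coord_comm[OF Hs Z that(4) k(1) that(5,2)] that(3)
        by simp
      then show "\<exists>k\<in>I. fiber_rel (gset Z) (coord H q k) \<subseteq>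
          fiber_rel (gset Z) (coord H q i) \<inter> fiber_rel (gset Z) (coord H q j)"
        using k ij by (intro bexI[of _ k]) (auto simp: fiber_rel_def)
    qed (use zc I_nonempty level_disc[OF Hs] coord_cont[OF Hs Z] coord_inj[OF H Z] in auto)
  qed
  show "top_graph_iso Z (inverse_limit I prec (level H) (bond H)) (\<lambda>z. \<lambda>i\<in>I. coord H q i z)"
  proof (rule top_graph_iso_inverse_limit[OF zc])
    fix t assume t: "t \<in> threads I prec (\<lambda>i. verts (level H i)) (bond H)"
    then have "t \<in> threads I prec (\<lambda>i. rep i H ` verts (X i)) (bond H)"
      by (simp add: threads_def free_graph_action.quot_def[OF action] PiE_def Pi_def)
    moreover have "verts (X i) \<subseteq> gset (X i)" for i by (simp add: gset_def)
    ultimately obtain s where s: "s \<in> threads I prec (\<lambda>i. verts (X i)) \<phi>" "\<forall>i\<in>I. rep i H (s i) = t i"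
      using level_thread_lift[OF Hs, of "\<lambda>i. verts (X i)" t] graph_mapD(1)[OF \<phi>_map] by blast
    obtain x where x: "x \<in> verts \<Gamma>" "a x = s" using a_verts[OF s(1)] by blast
    then have "coord H q i (q x) = t i" if "i \<in> I" for i
      using coord_q[OF Hs Z that gsetI(1)[OF x(1)]] s(2) that by simp
    then show "\<exists>u\<in>verts Z. \<forall>i\<in>I. coord H q i u = t i" using graph_mapD(1)[OF z(4) x(1)] by blast
  next
    fix t assume t: "t \<in> threads I prec (\<lambda>i. edges (level H i)) (bond H)"
    then have "t \<in> threads I prec (\<lambda>i. rep i H ` edges (X i)) (bond H)"
      by (simp add: threads_def free_graph_action.quot_def[OF action] PiE_def Pi_def)
    moreover have "edges (X i) \<subseteq> gset (X i)" for i by (simp add: gset_def)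
    ultimately obtain s where s: "s \<in> threads I prec (\<lambda>i. edges (X i)) \<phi>" "\<forall>i\<in>I. rep i H (s i) = t i"
      using level_thread_lift[OF Hs, of "\<lambda>i. edges (X i)" t] graph_mapD(2)[OF \<phi>_map] by blast
    obtain x where x: "x \<in> edges \<Gamma>" "a x = s" using a_edges[OF s(1)] by blast
    then have "coord H q i (q x) = t i" if "i \<in> I" for i
      using coord_q[OF Hs Z that gsetI(2)[OF x(1)]] s(2) that by simp
    then show "\<exists>u\<in>edges Z. \<forall>i\<in>I. coord H q i u = t i" using graph_mapD(2)[OF z(4) x(1)] by blast
  qed (use level_disc[OF Hs] coord_cont[OF Hs Z] coord_comm[OF Hs Z] coord_inj[OF H Z] in auto)
qed

section \<open>Coverings between orbit quotients\<close>

text \<open>Stated for nested subgroups so that it serves both the orbit map and the induced map.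
  Since \<open>p\<close> is onto, \<open>t (p x) = q x\<close> fixes \<open>t\<close> on all of
  \<open>Z\<close>; continuity comes from the universal property of \<open>p\<close>, and on
  coordinates \<open>t\<close> becomes \<open>rep i K\<close>.\<close>

lemma quotient_covering:
  assumes H: "limit_closed H" and K: "limit_closed K" and HK: "H \<subseteq> K"
    and Z: "orbit_quotient H Z p" and W: "orbit_quotient K W q"
    and t: "\<And>x. x \<in> gset \<Gamma> \<Longrightarrow> t (p x) = q x"
  shows "covering TYPE('i) Z W t"
    and "(\<And>k h. k \<in> K \<Longrightarrow> h \<in> H \<Longrightarrow> k \<otimes>\<^bsub>G\<^esub> h \<otimes>\<^bsub>G\<^esub> inv\<^bsub>G\<^esub> k \<in> H) \<Longrightarrow> regular_covering TYPE('i) Z W t"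
proof -
  have Hs: "subgroup H G" and Ks: "subgroup K G" using H K by (simp_all add: limit_closed_def)
  note z = orbit_quotientD[OF Z] and w = orbit_quotientD[OF W]
  have cont: "cont_graph_map Z W t"
    unfolding cont_graph_map_def
  proof
    show "graph_map Z W t"
    proof (rule graph_mapI)
      fix v assume "v \<in> verts Z"
      then obtain x where "x \<in> verts \<Gamma>" "v = p x" using z(5) by blast
      then show "t v \<in> verts W" using t[OF gsetI(1)] graph_mapD(1)[OF w(4)] by simp
    next
      fix e assume "e \<in> edges Z"
      then obtain x where x: "x \<in> edges \<Gamma>" "e = p x" using z(6) by blast
      note tx = t[OF gsetI(2)[OF x(1)]] and g = is_graphD(2-4)[OF \<Gamma>_simps(1) x(1)]
      show "t e \<in> edges W" using tx x graph_mapD(2)[OF w(4)] by simp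
      show "t (src Z e) = src W (t e)"
        unfolding x(2) graph_mapD(3)[OF z(4) x(1), symmetric] tx t[OF gsetI(1)[OF g(1)]]
        by (rule graph_mapD(3)[OF w(4) x(1)])
      show "t (tgt Z e) = tgt W (t e)"
        unfolding x(2) graph_mapD(4)[OF z(4) x(1), symmetric] tx t[OF gsetI(1)[OF g(2)]]
        by (rule graph_mapD(4)[OF w(4) x(1)])
      show "t (bar Z e) = bar W (t e)"
        unfolding x(2) graph_mapD(5)[OF z(4) x(1), symmetric] tx t[OF gsetI(2)[OF g(3)]]
        by (rule graph_mapD(5)[OF w(4) x(1)])
    qed
    have "continuous_map (gtop \<Gamma>) (gtop W) (t \<circ> p)"
      by (rule continuous_map_eq[OF quotient_imp_continuous_map[OF w(3)]]) (simp add: t \<Gamma>_simps(4))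
    then show "continuous_map (gtop Z) (gtop W) t" by (rule continuous_compose_quotient_map[OF z(3)])
  qed
  have rr: "rep i K (rep i H x) = rep i K x" if "i \<in> I" "x \<in> gset (X i)" for i x
    using free_graph_action.rep_rep_le[OF action[OF that(1)] Hs Ks HK that(2)] .
  have maps: "inverse_system_maps I prec (level H) (bond H) (level K) (bond K) (\<lambda>i. rep i K)"
    unfolding inverse_system_maps_def
  proof (intro conjI ballI impI dir level_system Hs Ks)
    fix i assume i: "i \<in> I"
    show "cont_graph_map (level H i) (level K i) (rep i K)"
      by (rule cont_graph_map_finite_discrete[OF level_disc[OF Hs i] level_disc[OF Ks i]
            free_graph_action.quot_le_map[OF action[OF i] Hs Ks HK]])
    fix j x assume j: "j \<in> I" "prec i j" and x: "x \<in> gset (level H j)"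
    have x': "x \<in> gset (X j)" using level_gset[OF Hs j(1)] x by blast
    show "rep i K (bond H i j x) = bond K i j (rep j K x)"
      using rr[OF i graph_mapD(6)[OF \<phi>_map[OF i j] x']] rep_bond[OF Ks i j x'] by simp
  qed
  have lim: "is_inverse_limit_map I prec (level H) (bond H) (level K) (bond K) (\<lambda>i. rep i K) Z W t"
    unfolding is_inverse_limit_map_def
  proof (intro exI conjI ballI)
    show "top_graph_iso Z (inverse_limit I prec (level H) (bond H)) (\<lambda>z. \<lambda>i\<in>I. coord H p i z)"
      by (rule orbit_quotient_iso(1)[OF H Z])
    show "top_graph_iso W (inverse_limit I prec (level K) (bond K)) (\<lambda>z. \<lambda>i\<in>I. coord K q i z)"
      by (rule orbit_quotient_iso(1)[OF K W])
    fix u assume "u \<in> gset Z"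
    then obtain x where x: "x \<in> gset \<Gamma>" "u = p x" using z(8) by blast
    show "(\<lambda>i\<in>I. coord K q i (t u)) = (\<lambda>i\<in>I. rep i K ((\<lambda>i\<in>I. coord H p i u) i))"
      unfolding x(2) t[OF x(1)]
      by (rule restrict_ext) (simp add: coord_q[OF Hs Z _ x(1)] coord_q[OF Ks W _ x(1)] rr a_gset[OF _ x(1)])
  qed
  have disc: "finite_discrete_graph (level H i)" "finite_discrete_graph (level K i)" if "i \<in> I" for i
    using level_disc Hs Ks that by blast+
  have lb: "locally_bijective (level H i) (level K i) (rep i K)" if "i \<in> I" for i
    using free_graph_action.quot_locally_bijective[OF action[OF that] Hs Ks HK] .
  note pf = orbit_quotient_iso(2)[OF H Z] orbit_quotient_iso(2)[OF K W]
  show "covering TYPE('i) Z W t"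
    unfolding covering_def using pf cont maps disc lb lim by blast
  assume N: "\<And>k h. k \<in> K \<Longrightarrow> h \<in> H \<Longrightarrow> k \<otimes>\<^bsub>G\<^esub> h \<otimes>\<^bsub>G\<^esub> inv\<^bsub>G\<^esub> k \<in> H"
  have "finite_regular_covering (level H i) (level K i) (rep i K)" if "i \<in> I" for i
    using free_graph_action.quot_regular[OF action[OF that] Hs Ks HK N] by blast
  then show "regular_covering TYPE('i) Z W t"
    unfolding regular_covering_def using pf cont maps disc lim by blast
qed

section \<open>The three orbit quotients: \<Gamma>, \<Delta> and the orbit graph\<close>

lemma limit_closed_one: "limit_closed {\<one>\<^bsub>G\<^esub>}"
  unfolding limit_closed_def
proof (intro conjI ballI impI G.triv_subgroup)
  fix g assume g: "g \<in> carrier G" and "\<forall>i\<in>I. \<exists>h\<in>{\<one>\<^bsub>G\<^esub>}. \<forall>x\<in>gset \<Gamma>. a (g x) i = a (h x) i"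
  then have "g = \<one>\<^bsub>G\<^esub>" by (intro G_eqI) simp_all
  then show "g \<in> {\<one>\<^bsub>G\<^esub>}" by simp
qed

lemma limit_closed_carrier: "limit_closed (carrier G)"
  unfolding limit_closed_def using G.subgroup_self by simp

lemma limit_closed_closed:
  assumes "subgroup H G" "closedin (Aut_topology \<Gamma> f) H"
  shows "limit_closed H"
  unfolding limit_closed_def
proof (intro conjI ballI impI assms(1))
  fix g assume g: "g \<in> carrier G" and lim: "\<forall>i\<in>I. \<exists>h\<in>H. \<forall>x\<in>gset \<Gamma>. a (g x) i = a (h x) i"
  show "g \<in> H"
  proof (rule closed_subgroup_limit[OF assms(2) g])
    fix i assume "i \<in> I"
    then obtain h where "h \<in> H" "\<forall>x\<in>gset \<Gamma>. a (g x) i = a (h x) i" using lim by blast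
    then show "\<exists>h\<in>H. h \<in> carrier G \<and> (\<forall>x\<in>gset \<Gamma>. a (g x) i = a (h x) i)"
      using subgroup.mem_carrier[OF assms(1)] by (intro bexI[of _ h]) simp_all
  qed
qed

lemma orbit_quotient_one: "orbit_quotient {\<one>\<^bsub>G\<^esub>} \<Gamma> (\<lambda>x. x)"
proof -
  have "quotient_map (gtop \<Gamma>) (gtop \<Gamma>) (\<lambda>x. x)"
    by (rule continuous_imp_quotient_map) (simp_all add: \<Gamma>_simps)
  then show ?thesis
    using \<Gamma>_simps unfolding orbit_quotient_def by (auto simp: graph_map_def G_one)
qed

text \<open>Each vertex of the connected graph \<open>Y i\<close> is the end of a path that starts
  at the image of a vertex of \<open>X i\<close>, and this path lifts. Edges are then lifted at a
  preimage of their source.\<close>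

lemma F_surj:
  assumes i: "i \<in> I"
  shows "verts (Y i) \<subseteq> F i ` verts (X i)" "edges (Y i) \<subseteq> F i ` edges (X i)"
proof -
  interpret C: graph_covering "X i" "Y i" "F i" by (rule F_cov[OF i])
  obtain x0 where x0: "x0 \<in> gset \<Gamma>" by (rule \<Gamma>_point)
  obtain x where x: "x \<in> verts \<Gamma>" using connected_profinite_vertex[OF \<Gamma>] by blast
  have ax: "a x i \<in> verts (X i)" using graph_mapD(1)[OF a_map[OF i] x] .
  have V: "\<exists>w\<in>verts (X i). F i w = v" if v: "v \<in> verts (Y i)" for v
  proof -
    obtain p where p: "edge_path (Y i) (F i (a x i)) p v"
      using Y_conn[OF i] graph_mapD(1)[OF F_map[OF i] ax] v unfolding graph_path_connected_def by blast
    obtain w where w: "C.lifts (a x i) p w" using C.lifts_exists[OF ax p] by blast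
    then have "F i w = v" using C.lifts_path[OF w] p edge_path_end_unique by metis
    then show ?thesis using C.lifts_verts(2)[OF w] by blast
  qed
  then show "verts (Y i) \<subseteq> F i ` verts (X i)" by blast
  show "edges (Y i) \<subseteq> F i ` edges (X i)"
  proof
    fix e assume e: "e \<in> edges (Y i)"
    obtain w where w: "w \<in> verts (X i)" "F i w = src (Y i) e" using V[OF is_graphD(2)[OF C.Y e]] by blast
    obtain e' where "e' \<in> edges (X i)" "F i e' = e" using C.edge_lift[OF w(1) e] w(2) by metis
    then show "e \<in> F i ` edges (X i)" by blast
  qed
qed

text \<open>The points of the levels over the coordinates of \<open>d\<close> form an inverse system
  of nonempty finite sets, and a thread of it gives a preimage of \<open>d\<close>.\<close>

lemma f_surj: "verts \<Delta> \<subseteq> f ` verts \<Gamma>" "edges \<Delta> \<subseteq> f ` edges \<Gamma>"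
proof -
  have bm: "graph_map \<Delta> (Y i) (\<lambda>x. b x i)" if "i \<in> I" for i
    using top_graph_iso_inverse_limitD(1)[OF b Y_disc I_nonempty that] by (simp add: cont_graph_map_def)
  have bc: "\<psi> i j (b d j) = b d i" if "i \<in> I" "j \<in> I" "prec i j" "d \<in> gset \<Delta>" for i j d
    by (rule top_graph_iso_inverse_limitD(2)[OF b Y_disc I_nonempty that])
  \<comment> \<open>\<open>S\<close> stands for the vertices or for the edges of the levels, so that
    the preimage is of the same kind as \<open>d\<close>.\<close>
  have lift: "threads I prec (\<lambda>i. {x \<in> S i. F i x = b d i}) \<phi> \<noteq> {}"
    if d: "d \<in> gset \<Delta>" and S: "\<And>i. i \<in> I \<Longrightarrow> S i \<subseteq> gset (X i)" "\<And>i. i \<in> I \<Longrightarrow> b d i \<in> F i ` S i"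
      "\<And>i j x. i \<in> I \<Longrightarrow> j \<in> I \<Longrightarrow> prec i j \<Longrightarrow> x \<in> S j \<Longrightarrow> \<phi> i j x \<in> S i" for d S
  proof (rule threads_nonempty[OF dir])
    fix i assume i: "i \<in> I"
    show "finite {x \<in> S i. F i x = b d i}" by (rule finite_subset[OF _ X_fin[OF i]]) (use S(1)[OF i] in auto)
    show "{x \<in> S i. F i x = b d i} \<noteq> {}" using S(2)[OF i] by auto
    show "\<phi> i i x = x" if "x \<in> {x \<in> S i. F i x = b d i}" for x using that \<phi>_id[OF i] S(1)[OF i] by blast
    fix j assume j: "j \<in> I" "prec i j"
    show "\<phi> i j x \<in> {x \<in> S i. F i x = b d i}" if x: "x \<in> {x \<in> S j. F j x = b d j}" for x
      using F_\<phi>[OF i j, of x] S(1)[OF j(1)] S(3)[OF i j] bc[OF i j d] x by auto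
    show "\<phi> i j (\<phi> j k x) = \<phi> i k x" if "k \<in> I" "prec j k" "x \<in> {x \<in> S k. F k x = b d k}" for k x
      using \<phi>_comp[OF i j(1) that(1) j(2) that(2)] that(3) S(1)[OF that(1)] by blast
  qed
  have fd: "f x = d" if "x \<in> gset \<Gamma>" "d \<in> gset \<Delta>" "\<And>i. i \<in> I \<Longrightarrow> F i (a x i) = b d i" for x d
    by (rule b_inj) (use that b_f graph_mapD(6)[OF f_map] in auto)
  show "verts \<Delta> \<subseteq> f ` verts \<Gamma>"
  proof
    fix d assume d: "d \<in> verts \<Delta>"
    have "threads I prec (\<lambda>i. {x \<in> verts (X i). F i x = b d i}) \<phi> \<noteq> {}"
      by (rule lift[OF gsetI(1)[OF d]])
        (use subsetD[OF F_surj(1) graph_mapD(1)[OF bm d]] graph_mapD(1)[OF \<phi>_map] in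
          \<open>simp_all add: gset_def\<close>)
    then obtain s where s: "s \<in> threads I prec (\<lambda>i. {x \<in> verts (X i). F i x = b d i}) \<phi>" by blast
    then have "s \<in> threads I prec (\<lambda>i. verts (X i)) \<phi>" by (auto simp: threads_def PiE_def Pi_def)
    then obtain x where x: "x \<in> verts \<Gamma>" "a x = s" using a_verts by blast
    have "F i (a x i) = b d i" if "i \<in> I" for i using s that x(2) by (auto simp: threads_def PiE_def Pi_def)
    then show "d \<in> f ` verts \<Gamma>" using fd[OF gsetI(1)[OF x(1)] gsetI(1)[OF d]] x(1) by blast
  qed
  show "edges \<Delta> \<subseteq> f ` edges \<Gamma>"
  proof
    fix d assume d: "d \<in> edges \<Delta>"
    have "threads I prec (\<lambda>i. {x \<in> edges (X i). F i x = b d i}) \<phi> \<noteq> {}"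
      by (rule lift[OF gsetI(2)[OF d]])
        (use subsetD[OF F_surj(2) graph_mapD(2)[OF bm d]] graph_mapD(2)[OF \<phi>_map] in
          \<open>simp_all add: gset_def\<close>)
    then obtain s where s: "s \<in> threads I prec (\<lambda>i. {x \<in> edges (X i). F i x = b d i}) \<phi>" by blast
    then have "s \<in> threads I prec (\<lambda>i. edges (X i)) \<phi>" by (auto simp: threads_def PiE_def Pi_def)
    then obtain x where x: "x \<in> edges \<Gamma>" "a x = s" using a_edges by blast
    have "F i (a x i) = b d i" if "i \<in> I" for i using s that x(2) by (auto simp: threads_def PiE_def Pi_def)
    then show "d \<in> f ` edges \<Gamma>" using fd[OF gsetI(2)[OF x(1)] gsetI(2)[OF d]] x(1) by blast
  qed
qed

text \<open>Identifies \<Delta> with \<Gamma>/G: a continuous surjection from a compact to a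
  Hausdorff space is a quotient map, and by \<open>G_transitive\<close> the fibers of
  \<open>f\<close> are exactly the orbits.\<close>

lemma orbit_quotient_carrier: "orbit_quotient (carrier G) \<Delta> f"
proof -
  have "f ` gset \<Gamma> = gset \<Delta>"
    using f_surj graph_mapD(6)[OF f_map] by (auto simp: gset_def)
  then have "quotient_map (gtop \<Gamma>) (gtop \<Delta>) f"
    by (intro continuous_imp_quotient_map[OF f_cont]) (simp_all add: \<Gamma>_simps \<Delta>_simps)
  moreover have "f x = f y \<longleftrightarrow> (\<exists>h\<in>carrier G. y = h x)" if "x \<in> gset \<Gamma>" "y \<in> gset \<Gamma>" for x y
    using G_transitive[OF that] G_D(3)[OF _ that(1)] by metis
  ultimately show ?thesis
    unfolding orbit_quotient_def using \<Delta>_simps f_map f_surj by simp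
qed

lemma orbit_quotient_orbit_graph:
  assumes H: "subgroup H G"
  shows "orbit_quotient H (orbit_graph \<Gamma> H) (orbit_map \<Gamma> H)"
proof -
  let ?R = "orbit_rel \<Gamma> H" and ?Q = "quotient_graph \<Gamma> (orbit_rel \<Gamma> H)" and ?Z = "orbit_graph \<Gamma> H"
  have HG: "h \<in> carrier G" if "h \<in> H" for h using subgroup.mem_carrier[OF H that] .
  have mem: "(x, y) \<in> ?R \<longleftrightarrow> x \<in> gset \<Gamma> \<and> (\<exists>h\<in>H. y = h x)" for x y
    by (auto simp: orbit_rel_def)
  have fR: "f x = f y" if "(x, y) \<in> ?R" for x y
    using that G_D(3)[OF HG] by (auto simp: mem)
  have eq: "equiv (gset \<Gamma>) ?R"
  proof (rule equivI)
    show "?R \<subseteq> gset \<Gamma> \<times> gset \<Gamma>" using G_D(4)[OF HG] by (auto simp: mem)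
    show "refl_on (gset \<Gamma>) ?R"
    proof (rule refl_onI)
      fix x assume x: "x \<in> gset \<Gamma>"
      then show "(x, x) \<in> ?R"
        using G_one[OF x] subgroup.one_closed[OF H] by (auto simp: mem intro!: bexI[of _ "\<one>\<^bsub>G\<^esub>"])
    qed
    show "sym ?R"
    proof (rule symI)
      fix x y assume "(x, y) \<in> ?R"
      then obtain h where h: "x \<in> gset \<Gamma>" "h \<in> H" "y = h x" by (auto simp: mem)
      have "(inv\<^bsub>G\<^esub> h) y = x"
        using G_mult[OF G.inv_closed[OF HG[OF h(2)]] HG[OF h(2)] h(1)] HG[OF h(2)] G_one[OF h(1)] h(3) by simp
      then show "(y, x) \<in> ?R"
        using h G_D(4)[OF HG[OF h(2)] h(1)] subgroup.m_inv_closed[OF H h(2)] unfolding mem by metis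
    qed
    show "trans ?R"
    proof (rule transI)
      fix x y z assume "(x, y) \<in> ?R" "(y, z) \<in> ?R"
      then obtain h k where h: "x \<in> gset \<Gamma>" "h \<in> H" "y = h x" "k \<in> H" "z = k y" by (auto simp: mem)
      then have "z = (k \<otimes>\<^bsub>G\<^esub> h) x" using G_mult HG by simp
      then show "(x, z) \<in> ?R" using h subgroup.m_closed[OF H] unfolding mem by blast
    qed
  qed
  have comp: "compatible \<Gamma> ?R"
    unfolding compatible_def
  proof (intro conjI ballI impI eq)
    fix v e assume v: "v \<in> verts \<Gamma>" and e: "e \<in> edges \<Gamma>"
    show "(v, e) \<notin> ?R"
      using graph_mapD(1)[OF G_D(1)[OF HG] v] e is_graphD(1)[OF \<Gamma>_simps(1)] by (auto simp: mem)
  next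
    fix e assume e: "e \<in> edges \<Gamma>"
    \<comment> \<open>Orbits lie in fibers of \<open>f\<close>, and \<open>f e\<close> differs from
      its reverse in \<Delta>.\<close>
    show "(e, bar \<Gamma> e) \<notin> ?R"
      using fR[of e "bar \<Gamma> e"] graph_mapD(5)[OF f_map e]
        is_graphD(6)[OF \<Delta>_simps(1) graph_mapD(2)[OF f_map e]] by auto
  next
    fix e e' assume e: "e \<in> edges \<Gamma>" and "(e, e') \<in> ?R"
    then obtain h where h: "h \<in> H" "e' = h e" by (auto simp: mem)
    note m = graph_mapD(3-5)[OF G_D(1)[OF HG[OF h(1)]] e] and g = is_graphD(2-4)[OF \<Gamma>_simps(1) e]
    show "(src \<Gamma> e, src \<Gamma> e') \<in> ?R" "(tgt \<Gamma> e, tgt \<Gamma> e') \<in> ?R" "(bar \<Gamma> e, bar \<Gamma> e') \<in> ?R"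
      unfolding mem h(2) m[symmetric] using h(1) g by (auto simp: gset_def)
  qed
  have Zs: "verts ?Z = verts ?Q" "edges ?Z = edges ?Q" "src ?Z = src ?Q" "tgt ?Z = tgt ?Q" "bar ?Z = bar ?Q"
    "gtop ?Z = quotient_topology (gtop \<Gamma>) (orbit_map \<Gamma> H)" "gset ?Z = gset ?Q"
    by (simp_all add: orbit_graph_def graph.defs gset_def)
  have q: "orbit_map \<Gamma> H = (\<lambda>x. ?R `` {x})" by (simp add: fun_eq_iff orbit_map_def)
  have im: "orbit_map \<Gamma> H ` gset \<Gamma> = gset ?Z"
    by (auto simp: Zs q gset_quotient_graph quotient_def)
  have "topspace (gtop ?Z) = orbit_map \<Gamma> H ` gset \<Gamma>"
  proof -
    have "openin (gtop ?Z) (orbit_map \<Gamma> H ` gset \<Gamma>)"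
      using openin_topspace[of "gtop \<Gamma>"]
      by (auto simp: Zs openin_quotient_topology \<Gamma>_simps(4) elim!: back_subst[where P = "openin (gtop \<Gamma>)"])
    moreover have "topspace (gtop ?Z) \<subseteq> orbit_map \<Gamma> H ` gset \<Gamma>"
      using openin_topspace[of "gtop ?Z", unfolded Zs(6) openin_quotient_topology]
      by (simp add: Zs \<Gamma>_simps(4))
    ultimately show ?thesis using openin_subset by blast
  qed
  then have top: "topspace (gtop ?Z) = gset ?Z" using im by simp
  moreover have "quotient_map (gtop \<Gamma>) (gtop ?Z) (orbit_map \<Gamma> H)"
    unfolding quotient_map_def using top im by (simp add: Zs(6) openin_quotient_topology \<Gamma>_simps(4))
  moreover have "is_graph ?Z"
    using is_graph_quotient_graph[OF comp \<Gamma>_simps(1)] by (simp add: is_graph_def Zs)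
  moreover have "graph_map \<Gamma> ?Z (orbit_map \<Gamma> H)"
    using graph_map_quotient_graph[OF comp \<Gamma>_simps(1)] by (simp add: graph_map_def Zs q)
  moreover have "verts ?Z \<subseteq> orbit_map \<Gamma> H ` verts \<Gamma>" "edges ?Z \<subseteq> orbit_map \<Gamma> H ` edges \<Gamma>"
    by (auto simp: Zs q quotient_graph_def quotient_def)
  moreover have "orbit_map \<Gamma> H x = orbit_map \<Gamma> H y \<longleftrightarrow> (\<exists>h\<in>H. y = h x)"
    if "x \<in> gset \<Gamma>" "y \<in> gset \<Gamma>" for x y
    using eq_equiv_class_iff[OF eq that] that by (simp add: q mem)
  ultimately show ?thesis unfolding orbit_quotient_def by blast
qed

lemma induced_map_orbit_map:
  assumes H: "subgroup H G" and x: "x \<in> gset \<Gamma>"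
  shows "induced_map f (orbit_map \<Gamma> H x) = f x"
proof -
  have "x \<in> orbit_map \<Gamma> H x"
    unfolding orbit_map_def orbit_rel_def
    by (rule ImageI[of x]) (use x G_one[OF x] subgroup.one_closed[OF H] in \<open>auto intro!: exI[of _ "\<one>\<^bsub>G\<^esub>"]\<close>)
  moreover have "f y = f x" if "y \<in> orbit_map \<Gamma> H x" for y
    using that G_D(3)[OF subgroup.mem_carrier[OF H] x] by (auto simp: orbit_map_def orbit_rel_def)
  ultimately have "f ` orbit_map \<Gamma> H x = {f x}" by blast
  then show ?thesis by (simp add: induced_map_def)
qed

end

theorem lemma22:
  fixes \<Gamma> :: "'a top_graph" and \<Delta> :: "'b top_graph" and f :: "'a \<Rightarrow> 'b"
    and H :: "('a \<Rightarrow> 'a) set"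
  assumes "connected_profinite_graph \<Gamma>" and "connected_profinite_graph \<Delta>"
    and "regular_covering TYPE('i) \<Gamma> \<Delta> f"
    and "subgroup H (Aut \<Gamma> f)" and "closedin (Aut_topology \<Gamma> f) H"
  shows "connected_profinite_graph (orbit_graph \<Gamma> H) \<and>
    regular_covering TYPE('i) \<Gamma> (orbit_graph \<Gamma> H) (orbit_map \<Gamma> H) \<and>
    (\<forall>x\<in>gset \<Gamma>. induced_map f (orbit_map \<Gamma> H x) = f x) \<and>
    covering TYPE('i) (orbit_graph \<Gamma> H) \<Delta> (induced_map f) \<and>
    (H \<lhd> Aut \<Gamma> f \<longrightarrow> regular_covering TYPE('i) (orbit_graph \<Gamma> H) \<Delta> (induced_map f))"
proof -
  obtain I :: "'i set" and prec and X :: "'i \<Rightarrow> nat top_graph" and \<phi>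
    and Y :: "'i \<Rightarrow> nat top_graph" and \<psi> F where sys: "inverse_system_maps I prec X \<phi> Y \<psi> F"
    and XY: "\<forall>i\<in>I. finite_discrete_graph (X i) \<and> finite_discrete_graph (Y i) \<and>
      finite_regular_covering (X i) (Y i) (F i)"
    and lim: "is_inverse_limit_map I prec X \<phi> Y \<psi> F \<Gamma> \<Delta> f"
    and f: "profinite_graph \<Delta>" "cont_graph_map \<Gamma> \<Delta> f"
    using assms(3) unfolding regular_covering_def by blast
  obtain a b where ab: "top_graph_iso \<Gamma> (inverse_limit I prec X \<phi>) a"
    "top_graph_iso \<Delta> (inverse_limit I prec Y \<psi>) b" "\<forall>x\<in>gset \<Gamma>. b (f x) = (\<lambda>i\<in>I. F i (a x i))"
    using lim unfolding is_inverse_limit_map_def by blast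
  interpret regular_covering_system \<Gamma> \<Delta> f I prec X \<phi> Y \<psi> F a b
    by unfold_locales (rule assms(1) f sys XY ab)+
  have H: "limit_closed H" by (rule limit_closed_closed[OF assms(4,5)])
  note Q = orbit_quotient_orbit_graph[OF assms(4)]
  \<comment> \<open>The trivial subgroup inside \<open>H\<close>: \<Gamma> is its own quotient, and
    conjugates of the unit are the unit.\<close>
  have h: "regular_covering TYPE('i) \<Gamma> (orbit_graph \<Gamma> H) (orbit_map \<Gamma> H)"
    by (rule quotient_covering(2)[OF limit_closed_one H _ orbit_quotient_one Q])
      (use subgroup.one_closed[OF assms(4)] subgroup.mem_carrier[OF assms(4)] in auto)
  have HG: "H \<subseteq> carrier G" using subgroup.subset[OF assms(4)] .
  have ind: "induced_map f (orbit_map \<Gamma> H x) = f x" if "x \<in> gset \<Gamma>" for x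
    by (rule induced_map_orbit_map[OF assms(4) that])
  note c = quotient_covering[OF H limit_closed_carrier HG Q orbit_quotient_carrier ind]
  have conn: "connected_profinite_graph (orbit_graph \<Gamma> H)"
    by (rule connected_profinite_image[OF assms(1) orbit_quotient_iso(2)[OF H Q]])
      (use h orbit_quotientD(5)[OF Q] in \<open>auto simp: regular_covering_def\<close>)
  \<comment> \<open>For the pair \<open>H\<close> and \<open>carrier G\<close>, the conjugation
    condition of \<open>quotient_covering\<close> is normality of \<open>H\<close>.\<close>
  have "regular_covering TYPE('i) (orbit_graph \<Gamma> H) \<Delta> (induced_map f)" if N: "H \<lhd> G"
    by (rule c(2)) (use normal.inv_op_closed2[OF N] in auto)
  then show ?thesis using h ind c(1) conn by blast
qed

end
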